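(* Let $\beta=1$, let $\varrho_0:\mathbb T\to[0,1]$ be a measurable function, and let $\{\mu_n\}_{n}$, with $\mu_n$ a probability measure on $\Omega_n$, be a sequence associated with the profile $\varrho_0$. Assume that $$\lim_{n\to+\infty}|a_n+b_n-c_n|=\kappa:=a+b-c\neq 0 .$$ Let $m>3/2$ be an integer. Then the sequence $\{\mathbb Q_{n,1}\}_{n\in\mathbb N}$ of laws of the processes $\{\pi^{n,1}_t\}_{t\in[0,T]}$ under $\mathbb P_{\mu_n}$ converges, as $n\to+\infty$, with respect to the weak topology of probability measures on $\mathcal D([0,T],\mathcal H_{-m})$, to the Dirac measure $\mathbb Q_1$ concentrated on the trajectory $\pi^1_t(du)=\varrho^\kappa(t,u)\,du$, $t\in[0,T]$, where $\varrho^\kappa$ is the unique weak solution of the transport equation $\partial_t\varrho^\kappa=\kappa\nabla\varrho^\kappa$ on $\mathbb T$ with initial condition $\varrho_0$.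
   Context: **Particle system.** Let $\{a_n\},\{b_n\},\{c_n\},\{d_n\}$ be sequences in $[0,1]$ converging respectively to $a,b,c,d$. Let $\mathbb Z_n=\mathbb Z/n\mathbb Z$, identified with $\{1,\dots,n\}$, and $\Omega_n=\{0,1\}^{\mathbb Z_n}$. For $\eta=(\eta(1),\dots,\eta(n))\in\Omega_n$ set $\eta^{1\to n-1}=(\eta(2),\dots,\eta(n-1),\eta(1),\eta(n))$, $\eta^{1\to n}=(\eta(2),\dots,\eta(n),\eta(1))$, $\eta^{n\to1}=(\eta(n),\eta(1),\dots,\eta(n-1))$, $\eta^{1\leftrightarrow2}=(\eta(2),\eta(1),\eta(3),\dots,\eta(n))$. Let $\{\eta_t\}_{t\ge0}$ be the continuous-time Markov chain on $\Omega_n$ with generator $$L_nf(\eta)=a_n(f(\eta^{1\to n-1})-f(\eta))+b_n(f(\eta^{1\to n})-f(\eta))+c_n(f(\eta^{n\to1})-f(\eta))+d_n(f(\eta^{1\leftrightarrow2})-f(\eta)).$$ This is the projection (black cards = 1, red cards = 0) of the analogous card-shuffling chain on the symmetric group $S_n$, with the same moves and rates. Standing assumption: $a_n,b_n,c_n,d_n$ are such that the chain on $S_n$ is irreducible and $\{\eta_t\}$ is irreducible on each set of configurations with a fixed number of particles. For $\beta>0$ the accelerated process $\{\eta_{tn^\beta}\}_{t\ge0}$ has generator $n^\beta L_n$. **Laws.** Fix $T>0$. $\mathbb P_{\mu_n}$ is the law of $\{\eta_{tn^\beta}\}_{t\in[0,T]}$ started from $\mu_n$. The empirical measure on the torus $\mathbb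 T=[0,1)$ is $\pi^{n,\beta}_t(du)=\frac1n\sum_{x\in\mathbb Z_n}\eta_{tn^\beta}(x)\,\delta_{x/n}(du)$, and $\mathbb Q_{n,\beta}$ is the law of $\{\pi_t^{n,\beta}\}_{t\in[0,T]}$ under $\mathbb P_{\mu_n}$. **Associated sequences.** $\{\mu_n\}$ is associated with a measurable $\mathfrak h:\mathbb T\to[0,1]$ if for every continuous $G:\mathbb T\to\mathbb R$ and every $\delta>0$, $\lim_n\mu_n\big(\eta:|\frac1n\sum_{x\in\mathbb Z_n}G(x/n)\eta(x)-\int_{\mathbb T}G(u)\mathfrak h(u)du|>\delta\big)=0$. **Sobolev spaces.** Let $\psi_k(u)=\sqrt2\sin(2\pi ku)$ for $k<0$, $\psi_0=1$, $\psi_k(u)=\sqrt2\cos(2\pi ku)$ for $k>0$ (an orthonormal basis of $L^2(\mathbb T)$), and $\gamma_k=1+4\pi^2k^2$. For a positive integer $m$, $\mathcal H_m$ is the completion of $C^\infty(\mathbb T)$ under $\langle f,g\rangle_m=\langle f,(1-\Delta)^mg\rangle$ and $\mathcal H_{-m}$ is its dual with respect to the $L^2(\mathbb T)$ inner product, with $\langle f,g\rangle_{-m}=\sum_{k\in\mathbb Z}\langle f,\psi_k\rangle\langle g,\psi_k\rangle\gamma_k^{-m}$. Finite measures on $\mathbb T$ are viewed as elements of $\mathcal H_{-m}$. $\mathcal D([0,T],\mathcal H_{-m})$ is the Skorokhod space of càdlàg $\mathcal H_{-m}$-valued trajectories. **Weak solution.** For $\theta\in\mathbb R$ and measurable $\mathfrak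 g:\mathbb T\to[0,1]$, $\varrho^\theta:[0,T]\times\mathbb T\to[0,1]$ is a weak solution of $\partial_t\varrho^\theta=\theta\nabla\varrho^\theta$, $\varrho^\theta(0,\cdot)=\mathfrak g$ (where $\nabla=\partial_u$), if for all $f\in C^1(\mathbb T)$ and all $t\in[0,T]$, $0=\langle\varrho^\theta_t-\mathfrak g,f\rangle+\theta\int_0^t\langle\varrho^\theta_s,\nabla f\rangle ds$. The unique weak solution is $\varrho^\theta_t(u)=\mathfrak g(u+\theta t)$. *)

theory Defs
  imports "HOL-Probability.Probability" "HOL-Combinatorics.Permutations"
begin

section \<open>Continuous-time Markov chains on a finite state space\<close>

text \<open>
  Cadlag functions on an index set \<open>I\<close> of reals with values in a topological space.  At an end
  point of \<open>I\<close> the corresponding one-sided filter is trivial and nothing is required there.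
\<close>

definition cadlag :: "'e topology \<Rightarrow> real set \<Rightarrow> (real \<Rightarrow> 'e) \<Rightarrow> bool" where
  "cadlag X I x \<longleftrightarrow>
     (\<forall>t\<in>I. x t \<in> topspace X \<and>
            limitin X x (x t) (at t within (I \<inter> {t<..})) \<and>
            (\<exists>l. limitin X x l (at t within (I \<inter> {..<t}))))"

definition markov_semigroup :: "'s set \<Rightarrow> (real \<Rightarrow> 's \<Rightarrow> 's \<Rightarrow> real) \<Rightarrow> bool" where
  "markov_semigroup S P \<longleftrightarrow>
     (\<forall>t\<ge>0. \<forall>x\<in>S. (\<forall>y\<in>S. 0 \<le> P t x y) \<and> (\<Sum>y\<in>S. P t x y) = 1) \<and>
     (\<forall>x\<in>S. \<forall>y\<in>S. P 0 x y = of_bool (x = y)) \<and>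
     (\<forall>s\<ge>0. \<forall>t\<ge>0. \<forall>x\<in>S. \<forall>y\<in>S. P (s + t) x y = (\<Sum>z\<in>S. P s x z * P t z y))"

definition has_generator ::
  "'s set \<Rightarrow> (real \<Rightarrow> 's \<Rightarrow> 's \<Rightarrow> real) \<Rightarrow> (('s \<Rightarrow> real) \<Rightarrow> 's \<Rightarrow> real) \<Rightarrow> bool" where
  "has_generator S P L \<longleftrightarrow>
     (\<forall>f. \<forall>x\<in>S. ((\<lambda>t. ((\<Sum>y\<in>S. P t x y * f y) - f x) / t) \<longlongrightarrow> L f x) (at_right 0))"

text \<open>
  \<open>X\<close> is, on the probability space \<open>M\<close>, a Markov chain with (finite) state space \<open>S\<close>, generator
  \<open>L\<close>, initial law \<open>\<mu>\<close> and cadlag trajectories.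
\<close>

definition markov_chain ::
  "'w measure \<Rightarrow> (real \<Rightarrow> 'w \<Rightarrow> 's) \<Rightarrow> 's set \<Rightarrow> (('s \<Rightarrow> real) \<Rightarrow> 's \<Rightarrow> real) \<Rightarrow> 's pmf \<Rightarrow> bool" where
  "markov_chain M X S L \<mu> \<longleftrightarrow>
     prob_space M \<and>
     (\<forall>t\<ge>0. X t \<in> measurable M (count_space S)) \<and>
     (\<forall>w\<in>space M. cadlag (discrete_topology S) {0..} (\<lambda>t. X t w)) \<and>
     (\<exists>P. markov_semigroup S P \<and> has_generator S P L \<and>
        (\<forall>(k::nat) (t :: nat \<Rightarrow> real) (x :: nat \<Rightarrow> 's).
           t 0 = 0 \<and> (\<forall>i<k. t i \<le> t (Suc i)) \<and> (\<forall>i\<le>k. x i \<in> S) \<longrightarrow>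
           measure M {w \<in> space M. \<forall>i\<le>k. X (t i) w = x i} =
             pmf \<mu> (x 0) * (\<Prod>i<k. P (t (Suc i) - t i) (x i) (x (Suc i)))))"

text \<open>
  For \<open>u \<noteq> v\<close> the jump rate from \<open>u\<close> to \<open>v\<close> is \<open>L\<close> applied to the indicator of \<open>v\<close>, evaluated
  at \<open>u\<close>.
\<close>

definition irreducible_on :: "'s set \<Rightarrow> (('s \<Rightarrow> real) \<Rightarrow> 's \<Rightarrow> real) \<Rightarrow> bool" where
  "irreducible_on S L \<longleftrightarrow>
     (\<forall>x\<in>S. \<forall>y\<in>S. (x, y) \<in> {(u, v). u \<in> S \<and> v \<in> S \<and> u \<noteq> v \<and> L (indicator {v}) u > 0}\<^sup>*)"


section \<open>The particle system\<close>

text \<open>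
  A configuration is a function on the positions \<open>{1..n}\<close>; the moves are polymorphic in the labels,
  so that they act both on particle configurations and on decks of cards (permutations of
  \<open>{1..n}\<close>).  They leave values outside \<open>{1..n}\<close> untouched.
\<close>

definition move_1_to_pred_n :: "nat \<Rightarrow> (nat \<Rightarrow> 'l) \<Rightarrow> nat \<Rightarrow> 'l" where
  "move_1_to_pred_n n \<eta> x =
     (if 1 \<le> x \<and> x < n - 1 then \<eta> (x + 1) else if 1 \<le> x \<and> x = n - 1 then \<eta> 1 else \<eta> x)"

definition move_1_to_n :: "nat \<Rightarrow> (nat \<Rightarrow> 'l) \<Rightarrow> nat \<Rightarrow> 'l" where
  "move_1_to_n n \<eta> x =
     (if 1 \<le> x \<and> x < n then \<eta> (x + 1) else if 1 \<le> x \<and> x = n then \<eta> 1 else \<eta> x)"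

definition move_n_to_1 :: "nat \<Rightarrow> (nat \<Rightarrow> 'l) \<Rightarrow> nat \<Rightarrow> 'l" where
  "move_n_to_1 n \<eta> x =
     (if x = 1 then \<eta> n else if 1 < x \<and> x \<le> n then \<eta> (x - 1) else \<eta> x)"

definition swap_1_2 :: "(nat \<Rightarrow> 'l) \<Rightarrow> nat \<Rightarrow> 'l" where
  "swap_1_2 \<eta> x = (if x = 1 then \<eta> 2 else if x = 2 then \<eta> 1 else \<eta> x)"

definition gen ::
  "nat \<Rightarrow> real \<Rightarrow> real \<Rightarrow> real \<Rightarrow> real \<Rightarrow> ((nat \<Rightarrow> 'l) \<Rightarrow> real) \<Rightarrow> (nat \<Rightarrow> 'l) \<Rightarrow> real" where
  "gen n a b c d f \<eta> =
     a * (f (move_1_to_pred_n n \<eta>) - f \<eta>) + b * (f (move_1_to_n n \<eta>) - f \<eta>) +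
     c * (f (move_n_to_1 n \<eta>) - f \<eta>) + d * (f (swap_1_2 \<eta>) - f \<eta>)"

definition Omega :: "nat \<Rightarrow> (nat \<Rightarrow> nat) set" where
  "Omega n = {1..n} \<rightarrow>\<^sub>E {0, 1}"

definition Omega_k :: "nat \<Rightarrow> nat \<Rightarrow> (nat \<Rightarrow> nat) set" where
  "Omega_k n k = {\<eta> \<in> Omega n. (\<Sum>x\<in>{1..n}. \<eta> x) = k}"

definition Sym :: "nat \<Rightarrow> (nat \<Rightarrow> nat) set" where
  "Sym n = {\<sigma>. \<sigma> permutes {1..n}}"

definition irreducible_rates :: "nat \<Rightarrow> real \<Rightarrow> real \<Rightarrow> real \<Rightarrow> real \<Rightarrow> bool" where
  "irreducible_rates n a b c d \<longleftrightarrow>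
     irreducible_on (Sym n) (gen n a b c d) \<and>
     (\<forall>k\<le>n. irreducible_on (Omega_k n k) (gen n a b c d))"


section \<open>Functions on the torus and Sobolev spaces\<close>

text \<open>
  Functions on the torus are 1-periodic functions on the real line; the torus as a measure space is
  \<open>{0..<1}\<close> with Lebesgue measure (on Borel sets).
\<close>

definition torus :: "real measure" where
  "torus = restrict_space lborel {0..<1}"

definition periodic :: "(real \<Rightarrow> real) \<Rightarrow> bool" where
  "periodic f \<longleftrightarrow> (\<forall>u. f (u + 1) = f u)"

definition tinner :: "(real \<Rightarrow> real) \<Rightarrow> (real \<Rightarrow> real) \<Rightarrow> real" where
  "tinner f g = (\<integral>u. f u * g u \<partial>torus)"

definition profile :: "(real \<Rightarrow> real) \<Rightarrow> bool" where
  "profile h \<longleftrightarrow> h \<in> borel_measurable borel \<and> periodic h \<and> (\<forall>u. h u \<in> {0..1})"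

definition C1_torus :: "(real \<Rightarrow> real) set" where
  "C1_torus = {f. periodic f \<and> (\<forall>u. f field_differentiable (at u)) \<and> continuous_on UNIV (deriv f)}"

definition Cinf_torus :: "(real \<Rightarrow> real) set" where
  "Cinf_torus = {f. periodic f \<and> (\<forall>k u. ((deriv ^^ k) f) field_differentiable (at u))}"

definition psi :: "int \<Rightarrow> real \<Rightarrow> real" where
  "psi k u = (if k < 0 then sqrt 2 * sin (2 * pi * of_int k * u)
              else if k = 0 then 1
              else sqrt 2 * cos (2 * pi * of_int k * u))"

definition gamma :: "int \<Rightarrow> real" where
  "gamma k = 1 + 4 * pi\<^sup>2 * (of_int k)\<^sup>2"

definition one_minus_Laplace :: "(real \<Rightarrow> real) \<Rightarrow> real \<Rightarrow> real" where
  "one_minus_Laplace f = (\<lambda>u. f u - deriv (deriv f) u)"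

definition H_norm :: "nat \<Rightarrow> (real \<Rightarrow> real) \<Rightarrow> real" where
  "H_norm m f = sqrt (tinner f ((one_minus_Laplace ^^ m) f))"

text \<open>
  A continuous linear functional on the completion of \<open>Cinf_torus\<close> under \<open>H_norm m\<close> is the same as
  a bounded linear functional on \<open>Cinf_torus\<close> itself.  A square integrable \<open>f\<close> is identified with
  the functional \<open>tinner f\<close>, so that \<open>\<phi> (psi k)\<close> is the pairing of \<open>\<phi>\<close> with \<open>psi k\<close>.
\<close>

definition H_neg :: "nat \<Rightarrow> ((real \<Rightarrow> real) \<Rightarrow> real) set" where
  "H_neg m = {\<phi> \<in> extensional Cinf_torus.
     (\<forall>f\<in>Cinf_torus. \<forall>g\<in>Cinf_torus. \<forall>r. \<phi> (\<lambda>u. f u + r * g u) = \<phi> f + r * \<phi> g) \<and>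
     (\<exists>C. \<forall>f\<in>Cinf_torus. \<bar>\<phi> f\<bar> \<le> C * H_norm m f)}"

definition H_neg_inner ::
  "nat \<Rightarrow> ((real \<Rightarrow> real) \<Rightarrow> real) \<Rightarrow> ((real \<Rightarrow> real) \<Rightarrow> real) \<Rightarrow> real" where
  "H_neg_inner m \<phi> \<xi> = infsum (\<lambda>k. \<phi> (psi k) * \<xi> (psi k) / gamma k ^ m) UNIV"

definition H_neg_dist ::
  "nat \<Rightarrow> ((real \<Rightarrow> real) \<Rightarrow> real) \<Rightarrow> ((real \<Rightarrow> real) \<Rightarrow> real) \<Rightarrow> real" where
  "H_neg_dist m \<phi> \<xi> =
     (let \<delta> = restrict (\<lambda>f. \<phi> f - \<xi> f) Cinf_torus in sqrt (H_neg_inner m \<delta> \<delta>))"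

definition H_neg_topology :: "nat \<Rightarrow> ((real \<Rightarrow> real) \<Rightarrow> real) topology" where
  "H_neg_topology m = Metric_space.mtopology (H_neg m) (H_neg_dist m)"

definition functional_of_measure :: "real measure \<Rightarrow> (real \<Rightarrow> real) \<Rightarrow> real" where
  "functional_of_measure \<nu> = restrict (\<lambda>f. \<integral>u. f u \<partial>\<nu>) Cinf_torus"


section \<open>The Skorokhod space and weak convergence\<close>

definition D_space :: "real \<Rightarrow> nat \<Rightarrow> (real \<Rightarrow> (real \<Rightarrow> real) \<Rightarrow> real) set" where
  "D_space T m = {x \<in> extensional {0..T}. cadlag (H_neg_topology m) {0..T} x}"

definition time_changes :: "real \<Rightarrow> (real \<Rightarrow> real) set" where
  "time_changes T = {l. continuous_on {0..T} l \<and> strict_mono_on {0..T} l \<and> l 0 = 0 \<and> l T = T}"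

text \<open>
  Skorokhod's J1 distance: the infimum over time changes of the maximum of the two uniform
  distances.  The value off \<open>D_space\<close> is irrelevant to the topology.
\<close>

definition skorokhod_dist ::
  "real \<Rightarrow> nat \<Rightarrow> (real \<Rightarrow> (real \<Rightarrow> real) \<Rightarrow> real) \<Rightarrow> (real \<Rightarrow> (real \<Rightarrow> real) \<Rightarrow> real) \<Rightarrow> real" where
  "skorokhod_dist T m x y =
     (if x \<in> D_space T m \<and> y \<in> D_space T m then
        Inf {e. \<exists>l\<in>time_changes T. \<forall>t\<in>{0..T}.
                  \<bar>l t - t\<bar> \<le> e \<and> H_neg_dist m (x (l t)) (y t) \<le> e}
      else 0)"

definition skorokhod_topology :: "real \<Rightarrow> nat \<Rightarrow> (real \<Rightarrow> (real \<Rightarrow> real) \<Rightarrow> real) topology" where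
  "skorokhod_topology T m = Metric_space.mtopology (D_space T m) (skorokhod_dist T m)"

definition borel_of :: "'e topology \<Rightarrow> 'e measure" where
  "borel_of X = sigma (topspace X) {U. openin X U}"

definition weak_conv_topology :: "'e topology \<Rightarrow> (nat \<Rightarrow> 'e measure) \<Rightarrow> 'e measure \<Rightarrow> bool" where
  "weak_conv_topology X Q Q' \<longleftrightarrow>
     (\<forall>\<^sub>F n in sequentially. prob_space (Q n) \<and> sets (Q n) = sets (borel_of X)) \<and>
     prob_space Q' \<and> sets Q' = sets (borel_of X) \<and>
     (\<forall>F. continuous_map X euclideanreal F \<and> (\<exists>B. \<forall>x\<in>topspace X. \<bar>F x\<bar> \<le> B) \<longrightarrow>
        (\<lambda>n. \<integral>x. F x \<partial>Q n) \<longlonglongrightarrow> (\<integral>x. F x \<partial>Q'))"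


section \<open>Empirical measures, associated profiles and the transport equation\<close>

text \<open>
  \<open>frac\<close> reduces \<open>x / n\<close> modulo 1: the position \<open>x = n\<close> sits at the point 0 of the torus.
\<close>

definition empirical_measure :: "nat \<Rightarrow> (nat \<Rightarrow> nat) \<Rightarrow> real measure" where
  "empirical_measure n \<eta> =
     distr (point_measure {1..n} (\<lambda>x. ennreal (real (\<eta> x) / real n))) torus
       (\<lambda>x. frac (real x / real n))"

text \<open>
  The trajectory of empirical measures of the process accelerated by \<open>n powr \<beta>\<close>, for a given path
  of the original chain.
\<close>

definition empirical_path ::
  "real \<Rightarrow> nat \<Rightarrow> real \<Rightarrow> (real \<Rightarrow> nat \<Rightarrow> nat) \<Rightarrow> real \<Rightarrow> (real \<Rightarrow> real) \<Rightarrow> real" where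
  "empirical_path T n \<beta> x =
     restrict (\<lambda>t. functional_of_measure (empirical_measure n (x (t * real n powr \<beta>)))) {0..T}"

definition empirical_law ::
  "real \<Rightarrow> nat \<Rightarrow> nat \<Rightarrow> real \<Rightarrow> 'w measure \<Rightarrow> (real \<Rightarrow> 'w \<Rightarrow> nat \<Rightarrow> nat) \<Rightarrow>
     (real \<Rightarrow> (real \<Rightarrow> real) \<Rightarrow> real) measure" where
  "empirical_law T m n \<beta> M X =
     distr M (borel_of (skorokhod_topology T m)) (\<lambda>w. empirical_path T n \<beta> (\<lambda>t. X t w))"

definition associated :: "(nat \<Rightarrow> (nat \<Rightarrow> nat) pmf) \<Rightarrow> (real \<Rightarrow> real) \<Rightarrow> bool" where
  "associated \<mu> h \<longleftrightarrow>
     (\<forall>G \<delta>. periodic G \<and> continuous_on UNIV G \<and> \<delta> > 0 \<longrightarrow>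
        (\<lambda>n. measure_pmf.prob (\<mu> n)
               {\<eta>. \<bar>(\<Sum>x\<in>{1..n}. G (real x / real n) * real (\<eta> x)) / real n - tinner G h\<bar> > \<delta>})
          \<longlonglongrightarrow> 0)"

text \<open>
  Weak solutions on \<open>[0, T]\<close> of the transport equation with velocity \<open>\<theta>\<close> and initial condition
  \<open>g\<close>.  Joint measurability is what makes the time integral meaningful.
\<close>

definition weak_solution ::
  "real \<Rightarrow> real \<Rightarrow> (real \<Rightarrow> real) \<Rightarrow> (real \<Rightarrow> real \<Rightarrow> real) \<Rightarrow> bool" where
  "weak_solution T \<theta> g \<rho> \<longleftrightarrow>
     (\<forall>t\<in>{0..T}. periodic (\<rho> t) \<and> (\<forall>u. \<rho> t u \<in> {0..1})) \<and>
     (\<lambda>(t, u). \<rho> t u) \<in> borel_measurable (restrict_space borel ({0..T} \<times> UNIV)) \<and>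
     (\<forall>f\<in>C1_torus. \<forall>t\<in>{0..T}.
        0 = tinner (\<lambda>u. \<rho> t u - g u) f + \<theta> * (LINT s:{0..t}|lborel. tinner (\<rho> s) (deriv f)))"

definition density_path ::
  "real \<Rightarrow> (real \<Rightarrow> real \<Rightarrow> real) \<Rightarrow> real \<Rightarrow> (real \<Rightarrow> real) \<Rightarrow> real" where
  "density_path T \<rho> =
     restrict (\<lambda>t. functional_of_measure (density torus (\<lambda>u. ennreal (\<rho> t u)))) {0..T}"

end

theory Submission
  imports Defs
begin

text \<open>
  The moves \<open>1 \<rightarrow> n\<close> and \<open>n \<rightarrow> 1\<close> rotate the configuration, and the other two moves differ from a rotation, respectively
  from the identity, by one adjacent transposition.  Hence the \<open>k\<close>-th Fourier mode \<open>z\<close> of the empirical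
  measure satisfies \<open>n L z = - 2 \<pi> i k (a\<^sub>n + b\<^sub>n - c\<^sub>n) z + O(1/n)\<close>, and its squared jumps, summed with the
  accelerated rates, are \<open>O(1/n)\<close>.  So \<open>z\<close> stays, in mean square, within \<open>O(1/n)\<close> of its rotated initial value at every fixed
  time.  As the deterministic flow of a mode is an isometry, Ottaviani's inequality upgrades this to all times at
  once, without martingales.  In \<open>\<H>\<^sub>-\<^sub>m\<close> the high modes are uniformly negligible, so finitely many modes control
  the distance: the paths converge uniformly in probability, which implies convergence for Skorokhod's
  distance to the deterministic limit.
\<close>

section \<open>Integration on the torus\<close>

text \<open>The chain is given through its finite-dimensional distributions, so no stopping-time
  calculus is at hand. Pathwise bounds are proved for the skeleton at times \<open>i * h\<close>,
  whose kernel \<open>P h\<close> takes over from the generator a rotation angle, a mean error and a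
  squared error all proportional to \<open>h\<close>. The error accumulated over a horizon then does
  not depend on the mesh, and dyadic refinement with right continuity reaches all times. The size of
  the errors has two sources: an adjacent transposition changes a mode by at most
  \<open>2 pi |k| / n^2\<close>, and linearising a rotation costs the square of its angle
  \<open>2 pi k / n\<close>. Both are \<open>O(1/n^2)\<close>, against a total time
  \<open>T n\<close>. Two obstacles lie in the target space. \<open>infsum\<close> and
  \<open>Inf\<close> are total, so that the two distances are metrics must be earned: definiteness
  in \<open>H_neg\<close> is uniqueness of Fourier coefficients, finiteness in the Skorokhod space
  is boundedness of cadlag paths. And a law is a \<open>distr\<close>, meaningful only once the path
  map is Borel measurable; discretised paths with finitely many values provide this.\<close>

lemma space_torus [simp]: "space torus = {0..<1}"
  by (simp add: torus_def space_restrict_space)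

lemma torus_measurable: "f \<in> borel_measurable borel \<Longrightarrow> f \<in> borel_measurable torus"
  by (simp add: torus_def measurable_restrict_space1)

interpretation torus: prob_space torus
  by (standard) (simp add: torus_def emeasure_restrict_space space_restrict_space)

lemma torus_integral_eq:
  fixes f :: "real \<Rightarrow> real"
  shows "(\<integral>u. f u \<partial>torus) = (\<integral>u. indicator {0..<1} u * f u \<partial>lborel)"
  unfolding torus_def by (subst integral_restrict_space) auto

text \<open>Bounded Borel functions are integrable on the torus and stable under sums and products,
  so the bilinearity rules for \<open>tinner\<close> need no separate integrability
  conditions.\<close>

definition bdd_fun :: "(real \<Rightarrow> real) set" where
  "bdd_fun = {f \<in> borel_measurable borel. \<exists>C. \<forall>u. \<bar>f u\<bar> \<le> C}"

lemma bdd_funI: "f \<in> borel_measurable borel \<Longrightarrow> (\<And>u. \<bar>f u\<bar> \<le> C) \<Longrightarrow> f \<in> bdd_fun"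
  unfolding bdd_fun_def by auto

lemma bdd_fun_measurable: "f \<in> bdd_fun \<Longrightarrow> f \<in> borel_measurable borel"
  by (auto simp: bdd_fun_def)

lemma bdd_fun_mult: assumes "f \<in> bdd_fun" "g \<in> bdd_fun" shows "(\<lambda>u. f u * g u) \<in> bdd_fun"
proof -
  obtain C D where "\<And>u. \<bar>f u\<bar> \<le> C" "\<And>u. \<bar>g u\<bar> \<le> D" using assms by (auto simp: bdd_fun_def)
  then have "\<bar>f u * g u\<bar> \<le> \<bar>C\<bar> * \<bar>D\<bar>" for u
    unfolding abs_mult by (intro mult_mono) (auto intro: order_trans[OF _ abs_ge_self])
  moreover have "(\<lambda>u. f u * g u) \<in> borel_measurable borel"
    using assms[THEN bdd_fun_measurable] by measurable
  ultimately show ?thesis by (rule bdd_funI[rotated])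
qed

lemma bdd_fun_add: assumes "f \<in> bdd_fun" "g \<in> bdd_fun" shows "(\<lambda>u. f u + g u) \<in> bdd_fun"
proof -
  obtain C D where "\<And>u. \<bar>f u\<bar> \<le> C" "\<And>u. \<bar>g u\<bar> \<le> D" using assms by (auto simp: bdd_fun_def)
  then have "\<bar>f u + g u\<bar> \<le> C + D" for u
    by (rule order_trans[OF abs_triangle_ineq add_mono])
  moreover have "(\<lambda>u. f u + g u) \<in> borel_measurable borel"
    using assms[THEN bdd_fun_measurable] by measurable
  ultimately show ?thesis by (rule bdd_funI[rotated])
qed

lemma bdd_fun_const: "(\<lambda>u. c) \<in> bdd_fun"
  by (rule bdd_funI[of _ "\<bar>c\<bar>"]) auto

lemma bdd_fun_cmult: "f \<in> bdd_fun \<Longrightarrow> (\<lambda>u. c * f u) \<in> bdd_fun"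
  by (rule bdd_fun_mult[OF bdd_fun_const])

lemma bdd_fun_diff: assumes "f \<in> bdd_fun" "g \<in> bdd_fun" shows "(\<lambda>u. f u - g u) \<in> bdd_fun"
  using bdd_fun_add[OF assms(1) bdd_fun_cmult[OF assms(2), of "-1"]] by simp

lemma bdd_fun_sum: "(\<And>i. i \<in> A \<Longrightarrow> f i \<in> bdd_fun) \<Longrightarrow> (\<lambda>u. \<Sum>i\<in>A. f i u) \<in> bdd_fun"
  by (induction A rule: infinite_finite_induct) (auto intro!: bdd_fun_add bdd_fun_const)

lemmas bdd_fun_intros = bdd_fun_add bdd_fun_diff bdd_fun_mult bdd_fun_cmult bdd_fun_const bdd_fun_sum

lemma bdd_fun_integrable: assumes "f \<in> bdd_fun" shows "integrable torus f"
proof -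
  obtain C where "\<And>u. \<bar>f u\<bar> \<le> C" using assms by (auto simp: bdd_fun_def)
  then show ?thesis using assms
    by (intro torus.integrable_const_bound[of _ C]) (auto intro: torus_measurable bdd_fun_measurable)
qed

lemma periodic_int: assumes "periodic f" shows "f (u + of_int k) = f u"
proof (induction k rule: int_induct[of _ 0])
  case (step1 i) then show ?case
    using assms[unfolded periodic_def, rule_format, of "u + of_int i"] by (simp add: add.assoc)
next
  case (step2 i) then show ?case
    using assms[unfolded periodic_def, rule_format, of "u + of_int (i - 1)"] by (simp add: add.assoc)
qed simp

lemma periodic_frac: "periodic f \<Longrightarrow> f (frac u) = f u"
  using periodic_int[of f u "- \<lfloor>u\<rfloor>"] by (simp add: frac_def)

lemma continuous_periodic_bdd_fun:
  assumes "periodic f" "continuous_on UNIV f" shows "f \<in> bdd_fun"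
proof -
  have "compact (f ` {0..1})"
    by (rule compact_continuous_image) (auto intro: continuous_on_subset[OF assms(2)])
  then obtain C where C: "\<And>u. u \<in> {0..1} \<Longrightarrow> \<bar>f u\<bar> \<le> C"
    by (force simp: bounded_iff dest!: compact_imp_bounded)
  have "\<bar>f u\<bar> \<le> C" for u
    using C[of "frac u"] periodic_frac[OF assms(1), of u] by (simp add: frac_lt_1 less_imp_le)
  then show ?thesis using assms(2) by (intro bdd_funI) (auto intro: borel_measurable_continuous_onI)
qed

text \<open>Periodicity reduces the shift to \<open>r = frac s\<close>. The shifted window
  \<open>{r..<1+r}\<close> is cut at 1 and its overhang \<open>{1..<1+r}\<close> is moved back to
  \<open>{0..<r}\<close>.\<close>

lemma torus_integral_shift:
  assumes "f \<in> bdd_fun" "periodic f"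
  shows "(\<integral>u. f (u + s) \<partial>torus) = (\<integral>u. f u \<partial>torus)"
proof -
  define r where "r = frac s"
  have r: "0 \<le> r" "r < 1" by (auto simp: r_def frac_lt_1)
  have fs: "f (u + s) = f (r + 1 * u)" for u
    using periodic_int[OF assms(2), of "u + r" "\<lfloor>s\<rfloor>"] by (simp add: r_def frac_def algebra_simps)
  have [measurable]: "f \<in> borel_measurable borel" using assms(1) by (rule bdd_fun_measurable)
  obtain C where C: "\<And>u. \<bar>f u\<bar> \<le> C" using assms by (auto simp: bdd_fun_def)
  have int: "integrable lborel (\<lambda>u. indicator {a..<b} u * f u)" for a b :: real
  proof (rule Bochner_Integration.integrable_bound)
    show "integrable lborel (\<lambda>u. C * indicator {a..<b} u :: real)"
      by (cases "a \<le> b") auto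
    show "AE u in lborel. norm (indicator {a..<b} u * f u) \<le> norm (C * indicator {a..<b} u :: real)"
      using C by (auto simp: indicator_def intro!: order_trans[OF C abs_ge_self])
  qed auto
  have "(\<integral>u. f (u + s) \<partial>torus) = (\<integral>u. indicator {r..<1+r} (r + 1 * u) * f (r + 1 * u) \<partial>lborel)"
    unfolding torus_integral_eq fs
    by (intro Bochner_Integration.integral_cong) (auto simp: indicator_def)
  also have "\<dots> = (\<integral>u. indicator {r..<1+r} u * f u \<partial>lborel)"
    using lborel_integral_real_affine[of 1 "\<lambda>u. indicator {r..<1+r} u * f u" r] by simp
  also have "\<dots> = (\<integral>u. indicator {r..<1} u * f u + indicator {1..<1+r} u * f u \<partial>lborel)"
    by (intro Bochner_Integration.integral_cong) (use r in \<open>auto simp: indicator_def\<close>)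
  also have "\<dots> = (\<integral>u. indicator {r..<1} u * f u \<partial>lborel) + (\<integral>u. indicator {1..<1+r} u * f u \<partial>lborel)"
    by (intro Bochner_Integration.integral_add int)
  also have "(\<integral>u. indicator {1..<1+r} u * f u \<partial>lborel) = (\<integral>u. indicator {1..<1+r} (1 + 1 * u) * f (1 + 1 * u) \<partial>lborel)"
    using lborel_integral_real_affine[of 1 "\<lambda>u. indicator {1..<1+r} u * f u" 1] by simp
  also have "\<dots> = (\<integral>u. indicator {0..<r} u * f u \<partial>lborel)"
    using assms(2) by (intro Bochner_Integration.integral_cong)
      (auto simp: indicator_def periodic_def add.commute)
  also have "(\<integral>u. indicator {r..<1} u * f u \<partial>lborel) + (\<integral>u. indicator {0..<r} u * f u \<partial>lborel)
    = (\<integral>u. indicator {r..<1} u * f u + indicator {0..<r} u * f u \<partial>lborel)"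
    by (intro Bochner_Integration.integral_add[symmetric] int)
  also have "\<dots> = (\<integral>u. f u \<partial>torus)" unfolding torus_integral_eq
    by (intro Bochner_Integration.integral_cong) (use r in \<open>auto simp: indicator_def\<close>)
  finally show ?thesis .
qed

lemma torus_integral_FTC:
  assumes F: "\<And>u. (F has_real_derivative f u) (at u)" and f: "continuous_on UNIV f"
  shows "(\<integral>u. f u \<partial>torus) = F 1 - F 0"
proof -
  have [measurable]: "f \<in> borel_measurable borel" by (rule borel_measurable_continuous_onI[OF f])
  have "(\<integral>u. f u \<partial>torus) = (\<integral>u. indicator {0..1} u *\<^sub>R f u \<partial>lborel)"
    unfolding torus_integral_eq
  proof (rule integral_cong_AE)
    have "AE u in lborel. u \<noteq> (1::real)" by (rule AE_lborel_singleton)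
    then show "AE u in lborel. indicator {0..<1} u * f u = indicator {0..1} u *\<^sub>R f u"
      by eventually_elim (auto simp: indicator_def)
  qed auto
  also have "\<dots> = F 1 - F 0"
    by (rule integral_FTC_atLeastAtMost)
      (auto intro: has_field_derivative_at_within[OF F] continuous_on_subset[OF f]
        simp flip: has_real_derivative_iff_has_vector_derivative)
  finally show ?thesis .
qed

section \<open>The L2 pairing on the torus\<close>

lemma tinner_commute: "tinner f g = tinner g f"
  by (simp add: tinner_def mult.commute)

lemma tinner_add_left:
  "f \<in> bdd_fun \<Longrightarrow> g \<in> bdd_fun \<Longrightarrow> h \<in> bdd_fun \<Longrightarrow> tinner (\<lambda>u. f u + g u) h = tinner f h + tinner g h"
  unfolding tinner_def distrib_right
  by (intro Bochner_Integration.integral_add bdd_fun_integrable bdd_fun_mult)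

lemma tinner_diff_left:
  "f \<in> bdd_fun \<Longrightarrow> g \<in> bdd_fun \<Longrightarrow> h \<in> bdd_fun \<Longrightarrow> tinner (\<lambda>u. f u - g u) h = tinner f h - tinner g h"
  unfolding tinner_def left_diff_distrib
  by (intro Bochner_Integration.integral_diff bdd_fun_integrable bdd_fun_mult)

lemma tinner_cmult_left: "tinner (\<lambda>u. c * f u) h = c * tinner f h"
  by (simp add: tinner_def mult.assoc)

lemma tinner_sum_left:
  assumes "\<And>i. i \<in> A \<Longrightarrow> f i \<in> bdd_fun" "h \<in> bdd_fun"
  shows "tinner (\<lambda>u. \<Sum>i\<in>A. f i u) h = (\<Sum>i\<in>A. tinner (f i) h)"
  unfolding tinner_def sum_distrib_right using assms
  by (intro Bochner_Integration.integral_sum bdd_fun_integrable bdd_fun_mult)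

lemma tinner_add_right:
  "f \<in> bdd_fun \<Longrightarrow> g \<in> bdd_fun \<Longrightarrow> h \<in> bdd_fun \<Longrightarrow> tinner h (\<lambda>u. f u + g u) = tinner h f + tinner h g"
  using tinner_add_left[of f g h] by (simp add: tinner_commute)

lemma tinner_diff_right:
  "f \<in> bdd_fun \<Longrightarrow> g \<in> bdd_fun \<Longrightarrow> h \<in> bdd_fun \<Longrightarrow> tinner h (\<lambda>u. f u - g u) = tinner h f - tinner h g"
  using tinner_diff_left[of f g h] by (simp add: tinner_commute)

lemma tinner_cmult_right: "tinner h (\<lambda>u. c * f u) = c * tinner h f"
  using tinner_cmult_left[of c f h] by (simp add: tinner_commute)

lemma tinner_sum_right:
  assumes "\<And>i. i \<in> A \<Longrightarrow> f i \<in> bdd_fun" "h \<in> bdd_fun"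
  shows "tinner h (\<lambda>u. \<Sum>i\<in>A. f i u) = (\<Sum>i\<in>A. tinner h (f i))"
  using tinner_sum_left[OF assms] by (simp add: tinner_commute)

lemma tinner_nonneg: "0 \<le> tinner f f"
  unfolding tinner_def by (intro integral_nonneg_AE) auto

text \<open>The squared norm of \<open>f - t * g\<close> is a nonnegative quadratic in
  \<open>t\<close>; its value at the minimiser is the inequality.\<close>

lemma tinner_Cauchy_Schwarz:
  assumes "f \<in> bdd_fun" "g \<in> bdd_fun"
  shows "\<bar>tinner f g\<bar> \<le> sqrt (tinner f f) * sqrt (tinner g g)"
proof -
  define A B I where "A = tinner f f" and "B = tinner g g" and "I = tinner f g"
  have quad: "0 \<le> A - 2 * t * I + t\<^sup>2 * B" for t
  proof -
    have "0 \<le> tinner (\<lambda>u. f u - t * g u) (\<lambda>u. f u - t * g u)" by (rule tinner_nonneg)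
    also have "\<dots> = A - 2 * t * I + t\<^sup>2 * B"
      using assms unfolding A_def B_def I_def
      by (simp add: tinner_diff_left tinner_diff_right tinner_cmult_left tinner_cmult_right
          bdd_fun_intros tinner_commute[of g f] power2_eq_square algebra_simps)
    finally show ?thesis .
  qed
  have B0: "0 \<le> B" and A0: "0 \<le> A" unfolding A_def B_def by (rule tinner_nonneg)+
  have "I\<^sup>2 \<le> A * B"
  proof (cases "B = 0")
    case True
    have "I = 0"
    proof (rule ccontr)
      assume "I \<noteq> 0"
      \<comment> \<open>With \<open>B = 0\<close> the quadratic is affine, and at
        \<open>(A + 1) / I\<close> it equals \<open>- A - 2\<close>, which is negative.\<close>
      then show False using quad[of "(A + 1) / I"] True A0 by simp
    qed
    then show ?thesis using True by simp
  next
    case False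
    then show ?thesis using quad[of "I / B"] B0
      by (simp add: field_simps power2_eq_square)
  qed
  then have "\<bar>I\<bar> \<le> sqrt (A * B)" by (metis real_sqrt_abs real_sqrt_le_iff)
  then show ?thesis by (simp add: A_def B_def I_def real_sqrt_mult)
qed

lemma tinner_bound:
  assumes "f \<in> bdd_fun" "g \<in> bdd_fun" "\<And>u. \<bar>f u\<bar> \<le> C" "\<And>u. \<bar>g u\<bar> \<le> D"
  shows "\<bar>tinner f g\<bar> \<le> C * D"
proof -
  have "\<bar>tinner f g\<bar> \<le> (\<integral>u. \<bar>f u * g u\<bar> \<partial>torus)" unfolding tinner_def by simp
  also have "\<dots> \<le> (\<integral>u. C * D \<partial>torus)"
    using assms(3,4) order_trans[OF abs_ge_zero assms(3)]
    by (intro Bochner_Integration.integral_mono integrable_abs bdd_fun_integrable bdd_fun_intros assms)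
       (auto simp: abs_mult intro!: mult_mono)
  also have "\<dots> = C * D" using torus.prob_space by simp
  finally show ?thesis .
qed

section \<open>Fourier series\<close>

lemma two_pi_int: "cos (2 * pi * of_int k + x) = cos x" "sin (2 * pi * of_int k + x) = sin x"
  by (simp_all add: cos_add sin_add cos_int_2pin sin_int_2pin)

text \<open>A sine is a cosine with phase \<open>- pi / 2\<close>, so the whole basis belongs to one
  family of phase-shifted cosines. That family is closed under differentiation and, up to sums,
  under products.\<close>

lemma psi_eq_cos:
  "psi k = (\<lambda>u. (if k = 0 then 1 else sqrt 2) * cos (2 * pi * of_int k * u + (if k < 0 then - pi / 2 else 0)))"
  by (auto simp: psi_def fun_eq_iff cos_add)

lemma continuous_psi: "continuous_on UNIV (psi k)"
  unfolding psi_eq_cos by (intro continuous_intros)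

lemma periodic_wave: "periodic (\<lambda>u. c * cos (2 * pi * of_int k * u + p))"
proof -
  have "2 * pi * of_int k * (u + 1) + p = 2 * pi * of_int k + (2 * pi * of_int k * u + p)" for u
    by (simp add: algebra_simps)
  then show ?thesis unfolding periodic_def by (simp only: two_pi_int) simp
qed

lemma periodic_psi: "periodic (psi k)"
  unfolding psi_eq_cos by (rule periodic_wave)

lemma psi_bdd_fun: "psi k \<in> bdd_fun"
  by (intro continuous_periodic_bdd_fun periodic_psi continuous_psi)

lemma wave_integral:
  "(\<integral>u. cos (2 * pi * of_int k * u + p) \<partial>torus) = (if k = 0 then cos p else 0)"
proof (cases "k = 0")
  case False
  have "(\<integral>u. cos (2 * pi * of_int k * u + p) \<partial>torus)
    = sin (2 * pi * of_int k * 1 + p) / (2 * pi * of_int k) - sin (2 * pi * of_int k * 0 + p) / (2 * pi * of_int k)"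
    using False by (intro torus_integral_FTC) (auto intro!: derivative_eq_intros continuous_intros)
  also have "\<dots> = 0" by (simp add: two_pi_int)
  finally show ?thesis using False by simp
qed (use torus.prob_space in simp)

lemma wave_integrable: "integrable torus (\<lambda>u. cos (2 * pi * of_int k * u + p))"
  using periodic_wave[of 1 k p]
  by (intro bdd_fun_integrable continuous_periodic_bdd_fun continuous_intros) simp

text \<open>The product splits into waves of frequencies \<open>j - k\<close> and
  \<open>j + k\<close>, and a wave has nonzero mean only at frequency zero. For
  \<open>j = k = 0\<close> both terms contribute.\<close>

lemma tinner_wave:
  "tinner (\<lambda>u. cos (2 * pi * of_int j * u + p)) (\<lambda>u. cos (2 * pi * of_int k * u + q))
    = ((if j = k then cos (p - q) else 0) + (if j = - k then cos (p + q) else 0)) / 2"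
proof -
  have "(\<integral>u. cos (2 * pi * of_int j * u + p) * cos (2 * pi * of_int k * u + q) \<partial>torus)
    = (\<integral>u. (cos (2 * pi * of_int (j - k) * u + (p - q)) + cos (2 * pi * of_int (j + k) * u + (p + q))) / 2 \<partial>torus)"
    by (simp add: cos_times_cos algebra_simps)
  also have "\<dots> = ((if j = k then cos (p - q) else 0) + (if j = - k then cos (p + q) else 0)) / 2"
    unfolding integral_divide_zero
    by (subst Bochner_Integration.integral_add)
      (auto simp only: wave_integral wave_integrable eq_neg_iff_add_eq_0 right_minus_eq)
  finally show ?thesis unfolding tinner_def .
qed

lemma psi_orthonormal: "tinner (psi j) (psi k) = of_bool (j = k)"
  unfolding psi_eq_cos tinner_cmult_left tinner_cmult_right tinner_wave
  by (auto simp: cos_diff cos_add)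

section \<open>Trigonometric polynomials and their uniform density\<close>

inductive_set trig_poly :: "(real \<Rightarrow> real) set" where
  wave: "(\<lambda>u. c * cos (2 * pi * of_int k * u + p)) \<in> trig_poly"
| add: "f \<in> trig_poly \<Longrightarrow> g \<in> trig_poly \<Longrightarrow> (\<lambda>u. f u + g u) \<in> trig_poly"

lemma trig_poly_const: "(\<lambda>u. c) \<in> trig_poly"
  using trig_poly.wave[of c 0 0] by simp

lemma trig_poly_wave_mult:
  "f \<in> trig_poly \<Longrightarrow> (\<lambda>u. f u * (c * cos (2 * pi * of_int k * u + p))) \<in> trig_poly"
proof (induction rule: trig_poly.induct)
  case (wave d j q)
  have "(\<lambda>u. d * cos (2 * pi * of_int j * u + q) * (c * cos (2 * pi * of_int k * u + p)))
    = (\<lambda>u. d * c / 2 * cos (2 * pi * of_int (j - k) * u + (q - p)) + d * c / 2 * cos (2 * pi * of_int (j + k) * u + (q + p)))"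
  proof
    fix u
    let ?A = "2 * pi * of_int j * u + q" and ?B = "2 * pi * of_int k * u + p"
    have "d * cos ?A * (c * cos ?B) = d * c * (cos ?A * cos ?B)" by simp
    also have "\<dots> = d * c * ((cos (?A - ?B) + cos (?A + ?B)) / 2)" by (simp only: cos_times_cos)
    also have "?A - ?B = 2 * pi * of_int (j - k) * u + (q - p)" by (simp add: algebra_simps)
    also have "?A + ?B = 2 * pi * of_int (j + k) * u + (q + p)" by (simp add: algebra_simps)
    finally show "d * cos ?A * (c * cos ?B)
      = d * c / 2 * cos (2 * pi * of_int (j - k) * u + (q - p)) + d * c / 2 * cos (2 * pi * of_int (j + k) * u + (q + p))"
      by (simp only: distrib_left add_divide_distrib) simp
  qed
  then show ?case by (simp only: trig_poly.intros)
qed (auto simp: distrib_right intro: trig_poly.add)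

lemma trig_poly_mult: "g \<in> trig_poly \<Longrightarrow> f \<in> trig_poly \<Longrightarrow> (\<lambda>u. f u * g u) \<in> trig_poly"
  by (induction rule: trig_poly.induct) (auto simp: distrib_left intro: trig_poly.add trig_poly_wave_mult)

lemma trig_poly_bdd_fun: "f \<in> trig_poly \<Longrightarrow> f \<in> bdd_fun"
  by (induction rule: trig_poly.induct)
    (auto intro: bdd_fun_add intro!: continuous_periodic_bdd_fun[OF periodic_wave] continuous_intros)

text \<open>Real-linear functions of a point on the circle are combinations of its cosine and sine;
  products stay in the class by the product-to-sum formula. This turns Stone-Weierstrass on the
  circle into density of trigonometric polynomials.\<close>

lemma real_polynomial_cis_trig_poly:
  "real_polynomial_function (q :: complex \<Rightarrow> real) \<Longrightarrow> (\<lambda>u. q (cis (2 * pi * u))) \<in> trig_poly"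
proof (induction rule: real_polynomial_function.induct)
  case (linear f)
  interpret bounded_linear f by fact
  have "cis (2 * pi * u) = cos (2 * pi * u) *\<^sub>R 1 + sin (2 * pi * u) *\<^sub>R \<i>" for u
    by (simp add: complex_eq_iff)
  then have "(\<lambda>u. f (cis (2 * pi * u))) = (\<lambda>u. f 1 * cos (2 * pi * of_int 1 * u + 0) + f \<i> * cos (2 * pi * of_int 1 * u + - pi / 2))"
    by (simp add: add scaleR cos_diff mult.commute)
  then show ?case by (simp only: trig_poly.intros)
qed (auto intro: trig_poly.intros trig_poly_const trig_poly_mult)

text \<open>A continuous function on the torus is a continuous function on the unit circle; away from each
  of the two branch cuts one of the two arguments is continuous.\<close>

lemma periodic_continuous_circle:
  assumes per: "periodic f" and cont: "continuous_on UNIV f"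
  shows "continuous_on (- {0}) (\<lambda>z. f (Arg z / (2 * pi)))"
proof -
  have eq: "f (Arg z / (2 * pi)) = f (Arg2pi z / (2 * pi))" if "z \<noteq> 0" for z
  proof -
    have "cis (Arg z) = cis (Arg2pi z)"
      using that cis_Arg[of z] Arg2pi_eq[of z]
      by (metis cis_conv_exp divide_eq_eq mult.commute norm_eq_zero of_real_eq_0_iff sgn_eq)
    then obtain n :: int where "Arg z = Arg2pi z + 2 * pi * of_int n"
      using sin_cos_eq_iff[of "Arg z" "Arg2pi z"] by (auto simp: complex_eq_iff)
    then show ?thesis using periodic_int[OF per, of "Arg2pi z / (2 * pi)" n]
      by (simp add: add_divide_distrib)
  qed
  have f: "isCont f x" for x using cont by (simp add: continuous_on_eq_continuous_at)
  have "isCont (\<lambda>z. f (Arg z / (2 * pi))) z" if z: "z \<noteq> 0" for z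
  proof (cases "z \<in> \<real>\<^sub>\<le>\<^sub>0")
    case False
    then show ?thesis
      by (intro isCont_o2[OF _ f] continuous_intros continuous_at_Arg) auto
  next
    case True
    then have "z \<notin> \<real>\<^sub>\<ge>\<^sub>0" using z by (auto simp: complex_nonpos_Reals_iff complex_nonneg_Reals_iff complex_eq_iff)
    then have "isCont (\<lambda>z. f (Arg2pi z / (2 * pi))) z"
      by (intro isCont_o2[OF _ f] continuous_intros continuous_at_Arg2pi) auto
    moreover have "eventually (\<lambda>z. f (Arg z / (2 * pi)) = f (Arg2pi z / (2 * pi))) (nhds z)"
      using t1_space_nhds[OF z] by eventually_elim (rule eq)
    ultimately show ?thesis
      by (rule isCont_cong[THEN iffD2, rotated])
  qed
  then show ?thesis by (intro continuous_at_imp_continuous_on) auto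
qed

lemma trig_poly_dense:
  assumes "periodic f" "continuous_on UNIV f" "e > 0"
  obtains p where "p \<in> trig_poly" "\<And>u. \<bar>f u - p u\<bar> < e"
proof -
  have "continuous_on (sphere 0 1) (\<lambda>z. f (Arg z / (2 * pi)))"
    by (rule continuous_on_subset[OF periodic_continuous_circle]) (use assms in auto)
  then obtain q where q: "real_polynomial_function q"
    "\<And>z. z \<in> sphere 0 1 \<Longrightarrow> \<bar>f (Arg z / (2 * pi)) - q z\<bar> < e"
    using Stone_Weierstrass_real_polynomial_function[OF compact_sphere _ \<open>e > 0\<close>] by metis
  have "\<bar>f u - q (cis (2 * pi * u))\<bar> < e" for u
  proof -
    \<comment> \<open>\<open>cis\<close> determines its argument only up to full turns, which the
      periodicity of \<open>f\<close> absorbs.\<close>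
    have "cis (Arg (cis (2 * pi * u))) = cis (2 * pi * u)"
      by (simp add: cis_Arg sgn_eq)
    then obtain n :: int where "Arg (cis (2 * pi * u)) = 2 * pi * u + 2 * pi * of_int n"
      using sin_cos_eq_iff[of "Arg (cis (2 * pi * u))" "2 * pi * u"] by (auto simp: complex_eq_iff)
    then have "f (Arg (cis (2 * pi * u)) / (2 * pi)) = f u"
      using periodic_int[OF assms(1), of u n] by (simp add: add_divide_distrib)
    then show ?thesis using q(2)[of "cis (2 * pi * u)"] by simp
  qed
  then show ?thesis using that real_polynomial_cis_trig_poly[OF q(1)] by blast
qed

text \<open>A trigonometric polynomial lies in the span of finitely many \<open>psi k\<close>. The
  dual form, by annihilators, spares the bookkeeping of coefficients.\<close>

lemma trig_poly_band_limited:
  "p \<in> trig_poly \<Longrightarrow> \<exists>N::nat. \<forall>h\<in>bdd_fun. (\<forall>k. \<bar>k\<bar> \<le> int N \<longrightarrow> tinner h (psi k) = 0) \<longrightarrow> tinner h p = 0"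
proof (induction rule: trig_poly.induct)
  case (wave c k q)
  \<comment> \<open>Coefficients from the addition theorem. The sine of frequency
    \<open>\<bar>k\<bar>\<close> is minus \<open>psi (- \<bar>k\<bar>) / sqrt 2\<close>, which
    cancels the minus sign of that theorem and leaves \<open>sgn k\<close>.\<close>
  define a b where "a = c * cos q / (if k = 0 then 1 else sqrt 2)" and "b = (if k = 0 then 0 else c * sin q / sqrt 2)"
  have eq: "(\<lambda>u. c * cos (2 * pi * of_int k * u + q)) = (\<lambda>u. a * psi \<bar>k\<bar> u + b * of_int (sgn k) * psi (- \<bar>k\<bar>) u)"
    by (auto simp: a_def b_def psi_def cos_add fun_eq_iff abs_if algebra_simps)
  show ?case
  proof (intro exI[of _ "nat \<bar>k\<bar>"] ballI impI)
    fix h assume h: "h \<in> bdd_fun" "\<forall>j. \<bar>j\<bar> \<le> int (nat \<bar>k\<bar>) \<longrightarrow> tinner h (psi j) = 0"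
    then show "tinner h (\<lambda>u. c * cos (2 * pi * of_int k * u + q)) = 0"
      unfolding eq by (subst tinner_add_right)
        (auto intro!: bdd_fun_cmult psi_bdd_fun simp: tinner_cmult_right)
  qed
next
  case (add f g)
  then obtain N M where
    "\<forall>h\<in>bdd_fun. (\<forall>k. \<bar>k\<bar> \<le> int N \<longrightarrow> tinner h (psi k) = 0) \<longrightarrow> tinner h f = 0"
    "\<forall>h\<in>bdd_fun. (\<forall>k. \<bar>k\<bar> \<le> int M \<longrightarrow> tinner h (psi k) = 0) \<longrightarrow> tinner h g = 0" by auto
  then show ?case using add(1,2)
    by (intro exI[of _ "max N M"]) (auto simp: tinner_add_right trig_poly_bdd_fun)
qed

section \<open>Mean-square convergence of Fourier series\<close>

definition fourier_sum :: "nat \<Rightarrow> (real \<Rightarrow> real) \<Rightarrow> real \<Rightarrow> real" where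
  "fourier_sum N f u = (\<Sum>k\<in>{- int N..int N}. tinner f (psi k) * psi k u)"

lemma fourier_sum_bdd_fun: "fourier_sum N f \<in> bdd_fun"
  unfolding fourier_sum_def[abs_def] by (intro bdd_fun_sum bdd_fun_cmult psi_bdd_fun)

lemma tinner_fourier_sum: "tinner (fourier_sum N f) (psi k) = (if \<bar>k\<bar> \<le> int N then tinner f (psi k) else 0)"
  unfolding fourier_sum_def[abs_def]
  by (subst tinner_sum_left)
    (auto intro!: bdd_fun_cmult psi_bdd_fun sum.neutral simp: tinner_cmult_left psi_orthonormal if_distrib of_bool_def cong: if_cong)

lemma tinner_fourier_rest:
  "f \<in> bdd_fun \<Longrightarrow> \<bar>k\<bar> \<le> int N \<Longrightarrow> tinner (\<lambda>u. f u - fourier_sum N f u) (psi k) = 0"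
  by (simp add: tinner_diff_left fourier_sum_bdd_fun psi_bdd_fun tinner_fourier_sum)

text \<open>The remainder \<open>g\<close> is orthogonal to all modes up to \<open>n\<close>, hence
  to the partial sum and to a trigonometric polynomial \<open>p\<close> of lower degree. So
  \<open>tinner g g\<close> equals the pairing of \<open>g\<close> with \<open>f - p\<close>, and
  Cauchy-Schwarz bounds the remainder by the uniform error of \<open>p\<close>.\<close>

lemma fourier_sum_tendsto:
  assumes "periodic f" "continuous_on UNIV f"
  shows "(\<lambda>N. tinner (\<lambda>u. f u - fourier_sum N f u) (\<lambda>u. f u - fourier_sum N f u)) \<longlonglongrightarrow> 0"
proof (rule LIMSEQ_I)
  fix e :: real assume e: "e > 0"
  have f: "f \<in> bdd_fun" using assms by (rule continuous_periodic_bdd_fun)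
  obtain p where p: "p \<in> trig_poly" "\<And>u. \<bar>f u - p u\<bar> < sqrt (e / 2)"
    using trig_poly_dense[OF assms, of "sqrt (e / 2)"] e by auto
  obtain N where N: "\<And>h. h \<in> bdd_fun \<Longrightarrow> (\<And>k. \<bar>k\<bar> \<le> int N \<Longrightarrow> tinner h (psi k) = 0) \<Longrightarrow> tinner h p = 0"
    using trig_poly_band_limited[OF p(1)] by blast
  show "\<exists>N. \<forall>n\<ge>N. norm (tinner (\<lambda>u. f u - fourier_sum n f u) (\<lambda>u. f u - fourier_sum n f u) - 0) < e"
  proof (intro exI[of _ N] allI impI)
    fix n assume n: "n \<ge> N"
    define g where "g = (\<lambda>u. f u - fourier_sum n f u)"
    have g: "g \<in> bdd_fun" unfolding g_def by (intro bdd_fun_diff f fourier_sum_bdd_fun)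
    have gk: "tinner g (psi k) = 0" if "\<bar>k\<bar> \<le> int n" for k
      unfolding g_def using that by (rule tinner_fourier_rest[OF f])
    have pb: "p \<in> bdd_fun" using p(1) by (rule trig_poly_bdd_fun)
    have "tinner g (fourier_sum n f) = 0"
      unfolding fourier_sum_def[abs_def]
      by (subst tinner_sum_right) (auto intro!: bdd_fun_cmult psi_bdd_fun g sum.neutral simp: tinner_cmult_right gk)
    moreover have "tinner g p = 0" using n by (intro N g gk) auto
    moreover have "tinner g g = tinner g f - tinner g (fourier_sum n f)"
      using tinner_diff_right[OF f fourier_sum_bdd_fun[of n f] g] by (simp flip: g_def)
    ultimately have "tinner g g = tinner g (\<lambda>u. f u - p u)"
      by (simp add: tinner_diff_right f pb g)
    then have "tinner g g \<le> sqrt (tinner g g) * sqrt (tinner (\<lambda>u. f u - p u) (\<lambda>u. f u - p u))"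
      using tinner_Cauchy_Schwarz[OF g bdd_fun_diff[OF f pb]] by linarith
    then have "sqrt (tinner g g) * sqrt (tinner g g) \<le> sqrt (tinner g g) * sqrt (tinner (\<lambda>u. f u - p u) (\<lambda>u. f u - p u))"
      by (simp add: tinner_nonneg)
    then have "sqrt (tinner g g) \<le> sqrt (tinner (\<lambda>u. f u - p u) (\<lambda>u. f u - p u))"
      by (metis mult_le_cancel_left_pos real_sqrt_ge_zero tinner_nonneg less_eq_real_def)
    then have "tinner g g \<le> tinner (\<lambda>u. f u - p u) (\<lambda>u. f u - p u)" by simp
    also have "\<dots> \<le> sqrt (e / 2) * sqrt (e / 2)"
      using tinner_bound[OF bdd_fun_diff[OF f pb] bdd_fun_diff[OF f pb] less_imp_le[OF p(2)] less_imp_le[OF p(2)]]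
      by linarith
    also have "\<dots> < e" using e by simp
    finally show "norm (tinner (\<lambda>u. f u - fourier_sum n f u) (\<lambda>u. f u - fourier_sum n f u) - 0) < e"
      using tinner_nonneg[of g] by (simp add: g_def)
  qed
qed

section \<open>Uniqueness of Fourier coefficients up to null sets\<close>

lemma tinner_continuous_zero:
  assumes h: "h \<in> bdd_fun" and 0: "\<And>k. tinner h (psi k) = 0" and f: "periodic f" "continuous_on UNIV f"
  shows "tinner h f = 0"
proof -
  obtain C where C: "\<And>u. \<bar>h u\<bar> \<le> C" using h by (auto simp: bdd_fun_def)
  have fb: "f \<in> bdd_fun" using f by (rule continuous_periodic_bdd_fun)
  have "\<bar>tinner h f\<bar> \<le> 0 + e" if e: "e > 0" for e
  proof -
    have C0: "0 \<le> C" using C order_trans[OF abs_ge_zero] by blast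
    \<comment> \<open>The \<open>+ 1\<close> keeps the quotient positive when the bound
      \<open>C\<close> is zero.\<close>
    obtain p where p: "p \<in> trig_poly" "\<And>u. \<bar>f u - p u\<bar> < e / (C + 1)"
      using trig_poly_dense[OF f, of "e / (C + 1)"] e C0 by auto
    have pb: "p \<in> bdd_fun" using p(1) by (rule trig_poly_bdd_fun)
    have "tinner h p = 0" using trig_poly_band_limited[OF p(1)] h 0 by blast
    then have "\<bar>tinner h f\<bar> = \<bar>tinner h (\<lambda>u. f u - p u)\<bar>"
      by (simp add: tinner_diff_right fb pb h)
    also have "\<dots> \<le> C * (e / (C + 1))"
      using h C p(2) by (intro tinner_bound bdd_fun_diff fb pb) (auto simp: less_imp_le)
    also have "\<dots> \<le> 0 + e" using e C0 by (simp add: field_simps)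
    finally show ?thesis .
  qed
  then have "\<bar>tinner h f\<bar> \<le> 0" by (rule field_le_epsilon)
  then show ?thesis by simp
qed


text \<open>Indicators of intervals are limits of continuous periodic functions: the distance to a closed
  periodic set is continuous and periodic.\<close>

lemma torus_integral_interval_zero:
  assumes h: "h \<in> bdd_fun" and 0: "\<And>k. tinner h (psi k) = 0"
  shows "(\<integral>u. indicator {x<..} u * h u \<partial>torus) = 0"
proof -
  \<comment> \<open>The periodic extension of \<open>{max x 0 <..< 1}\<close>: the part of the
    half-line inside the torus, made open and periodic. It is empty when \<open>x\<close> is at
    least 1.\<close>
  define U where "U = (\<Union>j::int. {max x 0 + of_int j <..< 1 + of_int j})"
  have openU: "open U" unfolding U_def by auto
  have shift: "u + 1 \<in> U \<longleftrightarrow> u \<in> U" for u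
  proof
    assume "u + 1 \<in> U"
    then obtain j :: int where "max x 0 + of_int j < u + 1" "u + 1 < 1 + of_int j" by (auto simp: U_def)
    then show "u \<in> U" unfolding U_def by (intro UN_I[of "j - 1"]) auto
  next
    assume "u \<in> U"
    then obtain j :: int where "max x 0 + of_int j < u" "u < 1 + of_int j" by (auto simp: U_def)
    then show "u + 1 \<in> U" unfolding U_def by (intro UN_I[of "j + 1"]) auto
  qed
  have ne: "- U \<noteq> {}"
  proof -
    have "0 \<notin> U"
    proof
      assume "0 \<in> U"
      then obtain j :: int where j: "max x 0 + of_int j < 0" "0 < 1 + real_of_int j" by (auto simp: U_def)
      have "0 \<le> max x 0" by simp
      then have "real_of_int j < 0" "-1 < real_of_int j" using j by linarith+
      then have "real_of_int j < real_of_int 0" "real_of_int (-1) < real_of_int j" by simp_all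
      then show False unfolding of_int_less_iff by linarith
    qed
    then show ?thesis by auto
  qed
  have img: "(\<lambda>u. u + 1) ` (- U) = - U"
  proof
    show "(\<lambda>u. u + 1) ` (- U) \<subseteq> - U" using shift by auto
    show "- U \<subseteq> (\<lambda>u. u + 1) ` (- U)"
    proof
      fix u assume "u \<in> - U"
      then have "u - 1 \<in> - U" using shift[of "u - 1"] by auto
      then show "u \<in> (\<lambda>u. u + 1) ` (- U)" by (intro image_eqI[of _ _ "u - 1"]) auto
    qed
  qed
  have "infdist (u + 1) (- U) = infdist u (- U)" for u
  proof -
    have "infdist (u + 1) (- U) = infdist (u + 1) ((\<lambda>u. u + 1) ` (- U))" by (simp only: img)
    also have "\<dots> = infdist u (- U)" using ne by (simp add: infdist_def image_image dist_real_def)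
    finally show ?thesis .
  qed
  \<comment> \<open>The complement of \<open>U\<close> is closed, so the distance to it is positive
    exactly on \<open>U\<close>; scaling by \<open>n\<close> and capping at 1 gives pointwise
    convergence to the indicator.\<close>
  define f where "f n u = min 1 (real n * infdist u (- U))" for n u
  have per: "periodic (f n)" for n
    unfolding periodic_def f_def using \<open>\<And>u. infdist (u + 1) (- U) = infdist u (- U)\<close> by simp
  have cont: "continuous_on UNIV (f n)" for n unfolding f_def by (intro continuous_intros)
  have f01: "0 \<le> f n u" "f n u \<le> 1" for n u by (auto simp: f_def infdist_nonneg)
  obtain C where C: "\<And>u. \<bar>h u\<bar> \<le> C" using h by (auto simp: bdd_fun_def)
  have [measurable]: "h \<in> borel_measurable torus" "\<And>n. f n \<in> borel_measurable torus"
    using h continuous_periodic_bdd_fun[OF per cont] by (auto intro: torus_measurable bdd_fun_measurable)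
  have indU[measurable]: "(\<lambda>u. indicator U u :: real) \<in> borel_measurable torus"
    using openU by (intro torus_measurable) auto
  have lim: "(\<lambda>n. f n u) \<longlonglongrightarrow> indicator U u" for u
  proof (cases "u \<in> U")
    case False
    then have "infdist u (- U) = 0" by simp
    then show ?thesis using False by (simp add: f_def)
  next
    case True
    have pos: "infdist u (- U) > 0"
      using True in_closed_iff_infdist_zero[OF closed_Compl[OF openU] ne, of u] infdist_nonneg[of u "- U"]
      by (auto simp: less_le)
    obtain N where N: "1 / infdist u (- U) < real N" using reals_Archimedean2 by blast
    have "f n u = 1" if "n \<ge> N" for n
    proof -
      have "1 / infdist u (- U) < real n" using N that by linarith
      then have "1 \<le> real n * infdist u (- U)" using pos by (simp add: field_simps)
      then show ?thesis by (simp add: f_def)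
    qed
    then have "eventually (\<lambda>n. f n u = indicator U u) sequentially"
      using True by (auto simp: eventually_sequentially)
    then show ?thesis by (rule tendsto_eventually)
  qed
  have "(\<lambda>n. \<integral>u. h u * f n u \<partial>torus) \<longlonglongrightarrow> (\<integral>u. h u * indicator U u \<partial>torus)"
  proof (rule integral_dominated_convergence[where w = "\<lambda>u. C"])
    show "AE u in torus. (\<lambda>n. h u * f n u) \<longlonglongrightarrow> h u * indicator U u"
      by (intro AE_I2 tendsto_intros lim)
    show "AE u in torus. norm (h u * f n u) \<le> C" for n
    proof (rule AE_I2)
      fix u
      have "\<bar>h u\<bar> * \<bar>f n u\<bar> \<le> C * 1"
        using C[of u] f01[of n u] order_trans[OF abs_ge_zero C] by (intro mult_mono) auto
      then show "norm (h u * f n u) \<le> C" by (simp add: abs_mult)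
    qed
  qed auto
  moreover have "(\<integral>u. h u * f n u \<partial>torus) = 0" for n
    using tinner_continuous_zero[OF h 0 per cont] unfolding tinner_def .
  ultimately have "(\<integral>u. h u * indicator U u \<partial>torus) = 0" by (simp add: LIMSEQ_const_iff)
  moreover have "(\<integral>u. h u * indicator U u \<partial>torus) = (\<integral>u. indicator {x<..} u * h u \<partial>torus)"
  proof -
    \<comment> \<open>The point 0 is left out: for negative \<open>x\<close> it lies in the
      half-line but not in \<open>U\<close>. It is a null set.\<close>
    have "h u * indicator U u = indicator {x<..} u * h u" if "u \<in> {0..<1}" "u \<noteq> 0" for u
    proof -
      have "u \<in> U \<longleftrightarrow> x < u"
      proof
        assume "u \<in> U"
        then obtain j :: int where j: "max x 0 + of_int j < u" "u < 1 + of_int j" by (auto simp: U_def)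
        then have "real_of_int j < 1" "-1 < real_of_int j" using that by auto
        then have "j = 0" by linarith
        then show "x < u" using j by auto
      next
        assume "x < u"
        then show "u \<in> U" using that unfolding U_def by (intro UN_I[of 0]) auto
      qed
      then show ?thesis by (auto simp: indicator_def)
    qed
    note eq = this
    have "AE u in lborel. indicator {0..<1} u * (h u * indicator U u) = indicator {0..<1} u * (indicator {x<..} u * h u)"
      using AE_lborel_singleton[of 0]
    proof eventually_elim
      case (elim u)
      then show ?case using eq[of u] by (cases "u \<in> {0..<1}") simp_all
    qed
    then show ?thesis unfolding torus_integral_eq using openU bdd_fun_measurable[OF h]
      by (intro integral_cong_AE) auto
  qed
  ultimately show ?thesis by simp
qed

text \<open>\<open>h + C\<close> and the constant \<open>C\<close> are nonnegative densities on the
  torus whose measures agree on all half-lines, hence are equal; densities are unique almost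
  everywhere. The constant is added because \<open>h\<close> may change sign.\<close>

lemma fourier_AE_zero:
  assumes h: "h \<in> bdd_fun" and 0: "\<And>k. tinner h (psi k) = 0"
  shows "AE u in torus. h u = 0"
proof -
  obtain C where C: "\<And>u. \<bar>h u\<bar> \<le> C" using h by (auto simp: bdd_fun_def)
  have [measurable]: "h \<in> borel_measurable borel" using h by (rule bdd_fun_measurable)
  have C0: "0 \<le> C" using C order_trans[OF abs_ge_zero] by blast
  have nn: "0 \<le> h u + C" for u using C[of u] by linarith
  define f where "f = (\<lambda>u. ennreal (indicator {0..<1} u * (h u + C)))"
  define g where "g = (\<lambda>u. ennreal (indicator {0..<1::real} u * C))"
  have [measurable]: "f \<in> borel_measurable lborel" "g \<in> borel_measurable lborel" by (auto simp: f_def g_def)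
  have hC: "(\<lambda>u. h u + C) \<in> bdd_fun" using h by (intro bdd_fun_intros)
  have E: "emeasure (density lborel (\<lambda>u. ennreal (indicator {0..<1} u * k u))) {x<..}
      = ennreal (\<integral>u. indicator {x<..} u * k u \<partial>torus)"
    if k: "k \<in> bdd_fun" "\<And>u. 0 \<le> k u" for k x
  proof -
    have [measurable]: "k \<in> borel_measurable borel" using k(1) by (rule bdd_fun_measurable)
    have kx: "(\<lambda>u. indicator {x<..} u * k u) \<in> bdd_fun"
      by (intro bdd_fun_mult k bdd_funI[of _ 1]) (auto simp: indicator_def)
    have "integrable torus (\<lambda>u. indicator {x<..} u * k u)" by (rule bdd_fun_integrable[OF kx])
    then have "integrable lborel (\<lambda>u. indicator {0..<1} u * (indicator {x<..} u * k u))"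
      unfolding torus_def by (subst (asm) integrable_restrict_space) auto
    then have "(\<integral>\<^sup>+u. ennreal (indicator {0..<1} u * (indicator {x<..} u * k u)) \<partial>lborel)
      = ennreal (\<integral>u. indicator {0..<1} u * (indicator {x<..} u * k u) \<partial>lborel)"
      by (intro nn_integral_eq_integral) (auto simp: k)
    moreover have "emeasure (density lborel (\<lambda>u. ennreal (indicator {0..<1} u * k u))) {x<..}
      = (\<integral>\<^sup>+u. ennreal (indicator {0..<1} u * (indicator {x<..} u * k u)) \<partial>lborel)"
      by (subst emeasure_density) (auto intro!: nn_integral_cong simp: indicator_def)
    ultimately show ?thesis by (simp add: torus_integral_eq)
  qed
  have "density lborel f = density lborel g"
  proof (rule measure_eqI_lessThan)
    show "emeasure (density lborel f) {x<..} < \<infinity>" for x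
      unfolding f_def using E[OF hC nn, of x] by simp
    show "emeasure (density lborel f) {x<..} = emeasure (density lborel g) {x<..}" for x
    proof -
      have ix: "(\<lambda>u. indicator {x<..} u * k u) \<in> bdd_fun" if "k \<in> bdd_fun" for k
        by (intro bdd_fun_mult that bdd_funI[of _ 1]) (auto simp: indicator_def)
      have "(\<integral>u. indicator {x<..} u * (h u + C) \<partial>torus)
        = (\<integral>u. indicator {x<..} u * h u \<partial>torus) + (\<integral>u. indicator {x<..} u * C \<partial>torus)"
        unfolding distrib_left
        by (intro Bochner_Integration.integral_add bdd_fun_integrable ix h bdd_fun_const)
      then show ?thesis
        unfolding f_def g_def using E[OF hC nn, of x] E[OF bdd_fun_const, of C x] C0
        by (simp add: torus_integral_interval_zero[OF h 0])
    qed
  qed auto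
  then have "AE u in lborel. f u = g u" by (intro sigma_finite_measure.density_unique[OF sigma_finite_lborel]) auto
  then have "AE u in lborel. u \<in> {0..<1} \<longrightarrow> h u = 0"
  proof eventually_elim
    case (elim u)
    then show ?case using nn[of u] C0 by (auto simp: f_def g_def indicator_def)
  qed
  then show ?thesis unfolding torus_def by (simp add: AE_restrict_space_iff)
qed

section \<open>The Sobolev spaces of negative order\<close>

lemma Cinf_torusD:
  assumes "f \<in> Cinf_torus"
  shows "periodic f" "(f has_real_derivative deriv f u) (at u)" "continuous_on UNIV f" "f \<in> bdd_fun"
proof -
  have "((deriv ^^ 0) f) field_differentiable (at u)" for u
    using assms unfolding Cinf_torus_def by blast
  then have d: "f field_differentiable (at u)" for u by simp
  then show "(f has_real_derivative deriv f u) (at u)" by (simp add: field_differentiable_derivI)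
  show per: "periodic f" using assms by (simp add: Cinf_torus_def)
  show cont: "continuous_on UNIV f"
    using d by (intro continuous_at_imp_continuous_on ballI field_differentiable_imp_continuous_at)
  show "f \<in> bdd_fun" by (rule continuous_periodic_bdd_fun[OF per cont])
qed

lemma Cinf_deriv:
  assumes "f \<in> Cinf_torus" shows "deriv f \<in> Cinf_torus"
proof -
  have "periodic (deriv f)"
    unfolding periodic_def
  proof
    fix u
    have "((\<lambda>x. f (x + 1)) has_real_derivative deriv f (u + 1)) (at u)"
      using Cinf_torusD(2)[OF assms, of "u + 1"] by (simp add: DERIV_shift)
    then have "(f has_real_derivative deriv f (u + 1)) (at u)"
      using Cinf_torusD(1)[OF assms] by (simp add: periodic_def)
    then show "deriv f (u + 1) = deriv f u" by (simp add: DERIV_imp_deriv)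
  qed
  moreover have "((deriv ^^ k) (deriv f)) field_differentiable (at u)" for k u
  proof -
    have "((deriv ^^ Suc k) f) field_differentiable (at u)" using assms unfolding Cinf_torus_def by blast
    then show ?thesis by (simp add: funpow_swap1)
  qed
  ultimately show ?thesis by (simp add: Cinf_torus_def)
qed

lemma deriv_lin:
  assumes "f \<in> Cinf_torus" "g \<in> Cinf_torus"
  shows "deriv (\<lambda>u. f u + r * g u) = (\<lambda>u. deriv f u + r * deriv g u)"
  by (intro ext DERIV_imp_deriv derivative_intros DERIV_cmult Cinf_torusD assms)

lemma Cinf_lin:
  assumes "f \<in> Cinf_torus" "g \<in> Cinf_torus"
  shows "(\<lambda>u. f u + r * g u) \<in> Cinf_torus"
proof -
  have "f \<in> Cinf_torus \<Longrightarrow> g \<in> Cinf_torus \<Longrightarrow> (deriv ^^ k) (\<lambda>u. f u + r * g u) field_differentiable (at u)" for k u f g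
  proof (induction k arbitrary: f g)
    case 0
    then have "((\<lambda>u. f u + r * g u) has_real_derivative deriv f u + r * deriv g u) (at u)"
      by (intro DERIV_add DERIV_cmult Cinf_torusD)
    then show ?case by (auto simp: field_differentiable_def)
  next
    case (Suc k)
    then have "(deriv ^^ k) (\<lambda>u. deriv f u + r * deriv g u) field_differentiable at u"
      by (intro Suc Cinf_deriv)
    then show ?case by (simp add: funpow_Suc_right deriv_lin Suc.prems del: funpow.simps)
  qed
  then show ?thesis using assms Cinf_torusD(1)[of f] Cinf_torusD(1)[of g]
    by (auto simp: Cinf_torus_def periodic_def)
qed

text \<open>Differentiation changes the amplitude and advances the phase by \<open>pi / 2\<close>,
  so the induction runs over all \<open>c\<close> and \<open>p\<close> at once.\<close>

lemma Cinf_wave: "(\<lambda>u. c * cos (2 * pi * of_int k * u + p)) \<in> Cinf_torus"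
proof -
  have "(deriv ^^ j) (\<lambda>u. c * cos (2 * pi * of_int k * u + p)) field_differentiable (at u)" for j u c p
  proof (induction j arbitrary: c p)
    case 0
    show ?case by (auto simp: field_differentiable_def intro!: exI derivative_eq_intros)
  next
    case (Suc j)
    have "deriv (\<lambda>u. c * cos (2 * pi * of_int k * u + p)) = (\<lambda>u. (2 * pi * of_int k * c) * cos (2 * pi * of_int k * u + (p + pi / 2)))"
      by (intro ext DERIV_imp_deriv) (auto intro!: derivative_eq_intros simp: cos_add sin_add algebra_simps)
    then show ?case using Suc by (simp add: funpow_Suc_right del: funpow.simps)
  qed
  then show ?thesis using periodic_wave by (simp add: Cinf_torus_def)
qed

lemma Cinf_psi: "psi k \<in> Cinf_torus"
  unfolding psi_eq_cos by (rule Cinf_wave)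

lemma Cinf_zero: "(\<lambda>u. 0) \<in> Cinf_torus"
  using Cinf_wave[of 0] by simp

lemma Cinf_sum:
  "finite A \<Longrightarrow> (\<And>i. i \<in> A \<Longrightarrow> f i \<in> Cinf_torus) \<Longrightarrow> (\<lambda>u. \<Sum>i\<in>A. c i * f i u) \<in> Cinf_torus"
proof (induction A rule: finite_induct)
  case (insert x A)
  then show ?case using Cinf_lin[of "\<lambda>u. \<Sum>i\<in>A. c i * f i u" "f x" "c x"] by (simp add: add.commute)
qed (simp add: Cinf_zero)

abbreviation Lap :: "(real \<Rightarrow> real) \<Rightarrow> real \<Rightarrow> real" where "Lap \<equiv> one_minus_Laplace"

lemma Lap_eq: "Lap f = (\<lambda>u. f u + (-1) * deriv (deriv f) u)"
  by (simp add: one_minus_Laplace_def)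

lemma Cinf_Lap: "f \<in> Cinf_torus \<Longrightarrow> Lap f \<in> Cinf_torus"
  unfolding Lap_eq by (intro Cinf_lin Cinf_deriv)

lemma Cinf_Lap_pow: "f \<in> Cinf_torus \<Longrightarrow> (Lap ^^ m) f \<in> Cinf_torus"
  by (induction m) (auto intro: Cinf_Lap)

lemma Lap_lin:
  assumes "f \<in> Cinf_torus" "g \<in> Cinf_torus"
  shows "Lap (\<lambda>u. f u + r * g u) = (\<lambda>u. Lap f u + r * Lap g u)"
  unfolding one_minus_Laplace_def using assms by (simp add: deriv_lin Cinf_deriv algebra_simps)

lemma Lap_pow_lin:
  assumes "f \<in> Cinf_torus" "g \<in> Cinf_torus"
  shows "(Lap ^^ m) (\<lambda>u. f u + r * g u) = (\<lambda>u. (Lap ^^ m) f u + r * (Lap ^^ m) g u)"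
  by (induction m) (simp_all add: Lap_lin Cinf_Lap_pow assms)

lemma Lap_deriv: "f \<in> Cinf_torus \<Longrightarrow> Lap (deriv f) = deriv (Lap f)"
  unfolding Lap_eq using deriv_lin[of f "deriv (deriv f)" "-1"] by (simp add: Cinf_deriv)

lemma Lap_pow_deriv: "f \<in> Cinf_torus \<Longrightarrow> (Lap ^^ m) (deriv f) = deriv ((Lap ^^ m) f)"
  by (induction m) (simp_all add: Lap_deriv Cinf_Lap_pow)

lemma Lap_psi: "Lap (psi k) = (\<lambda>u. gamma k * psi k u)"
proof -
  have *: "deriv (\<lambda>u. c * cos (2 * pi * of_int k * u + p)) = (\<lambda>u. (2 * pi * of_int k * c) * cos (2 * pi * of_int k * u + (p + pi / 2)))" for c p
    by (intro ext DERIV_imp_deriv) (auto intro!: derivative_eq_intros simp: cos_add sin_add algebra_simps)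
  show ?thesis
    unfolding one_minus_Laplace_def psi_eq_cos *
    by (intro ext) (simp add: gamma_def power2_eq_square algebra_simps cos_add sin_add)
qed

lemma Lap_pow_psi: "(Lap ^^ m) (psi k) = (\<lambda>u. gamma k ^ m * psi k u)"
proof (induction m)
  case (Suc m)
  have "Lap (\<lambda>u. 0 + gamma k ^ m * psi k u) = (\<lambda>u. Lap (\<lambda>u. 0) u + gamma k ^ m * Lap (psi k) u)"
    by (rule Lap_lin[OF Cinf_zero Cinf_psi])
  moreover have "Lap (\<lambda>u. 0) = (\<lambda>u. 0)" by (simp add: one_minus_Laplace_def)
  ultimately show ?case using Suc by (simp add: Lap_psi mult.assoc mult.left_commute)
qed simp

lemma Lap_pow_psi_sum:
  "finite A \<Longrightarrow> (Lap ^^ m) (\<lambda>u. \<Sum>k\<in>A. c k * psi k u) = (\<lambda>u. \<Sum>k\<in>A. (c k * gamma k ^ m) * psi k u)"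
proof (induction A rule: finite_induct)
  case empty
  have "Lap (\<lambda>u. 0) = (\<lambda>u. 0)" by (simp add: one_minus_Laplace_def)
  then show ?case by (induction m) simp_all
next
  case (insert x A)
  then show ?case using Lap_pow_lin[of "\<lambda>u. \<Sum>i\<in>A. c i * psi i u" "psi x" m "c x"]
    by (simp add: add.commute Cinf_sum Cinf_psi Lap_pow_psi mult.assoc)
qed

text \<open>Integration by parts; the boundary terms cancel by periodicity.\<close>

lemma tinner_deriv:
  assumes "f \<in> Cinf_torus" "g \<in> Cinf_torus"
  shows "tinner f (deriv g) = - tinner (deriv f) g"
proof -
  note i = bdd_fun_mult[OF Cinf_torusD(4) Cinf_torusD(4), THEN bdd_fun_integrable]
  have "(\<integral>u. deriv f u * g u + f u * deriv g u \<partial>torus) = f 1 * g 1 - f 0 * g 0"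
  proof (rule torus_integral_FTC)
    show "((\<lambda>u. f u * g u) has_real_derivative deriv f u * g u + f u * deriv g u) (at u)" for u
      using DERIV_mult[OF Cinf_torusD(2)[OF assms(1)] Cinf_torusD(2)[OF assms(2)], of u]
      by (simp add: algebra_simps)
    show "continuous_on UNIV (\<lambda>u. deriv f u * g u + f u * deriv g u)"
      by (intro continuous_on_add continuous_on_mult Cinf_torusD(3) Cinf_deriv assms)
  qed
  also have "\<dots> = 0"
    using Cinf_torusD(1)[OF assms(1), unfolded periodic_def, rule_format, of 0]
      Cinf_torusD(1)[OF assms(2), unfolded periodic_def, rule_format, of 0] by simp
  finally show ?thesis
    unfolding tinner_def
    by (subst (asm) Bochner_Integration.integral_add[OF i[OF Cinf_deriv[OF assms(1)] assms(2)] i[OF assms(1) Cinf_deriv[OF assms(2)]]])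
      linarith
qed

definition H_form :: "nat \<Rightarrow> (real \<Rightarrow> real) \<Rightarrow> real" where
  "H_form m f = tinner f ((Lap ^^ m) f)"

text \<open>Integrating by parts once in the outermost factor \<open>1 - \<Delta>\<close> leaves the
  same form for \<open>f\<close> and for its derivative. Nonnegativity and monotonicity in
  \<open>m\<close> follow by induction, with no spectral argument.\<close>

lemma H_form_Suc:
  assumes f: "f \<in> Cinf_torus"
  shows "H_form (Suc m) f = H_form m f + H_form m (deriv f)"
proof -
  let ?g = "(Lap ^^ m) f"
  have g: "?g \<in> Cinf_torus" by (rule Cinf_Lap_pow[OF f])
  have "H_form (Suc m) f = tinner f (\<lambda>u. ?g u - deriv (deriv ?g) u)"
    by (simp add: H_form_def one_minus_Laplace_def[of ?g])
  also have "\<dots> = tinner f ?g - tinner f (deriv (deriv ?g))"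
    by (intro tinner_diff_right Cinf_torusD(4) Cinf_deriv f g)
  also have "tinner f (deriv (deriv ?g)) = - tinner (deriv f) (deriv ?g)"
    by (intro tinner_deriv Cinf_deriv f g)
  finally show ?thesis unfolding H_form_def Lap_pow_deriv[OF f] by linarith
qed

lemma H_form_nonneg: "f \<in> Cinf_torus \<Longrightarrow> 0 \<le> H_form m f"
proof (induction m arbitrary: f)
  case 0 then show ?case by (simp add: H_form_def tinner_nonneg)
next
  case (Suc m)
  then show ?case using Suc.IH[OF Suc.prems] Suc.IH[OF Cinf_deriv[OF Suc.prems]] H_form_Suc[OF Suc.prems, of m]
    by linarith
qed

lemma H_form_mono:
  assumes f: "f \<in> Cinf_torus" and "j \<le> m" shows "H_form j f \<le> H_form m f"
proof -
  have "H_form m f \<le> H_form (Suc m) f" for m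
    using f by (simp add: H_form_Suc H_form_nonneg Cinf_deriv)
  then show ?thesis by (rule lift_Suc_mono_le[of "\<lambda>m. H_form m f"]) (rule assms(2))
qed

lemma H_norm_eq: "H_norm m f = sqrt (H_form m f)"
  by (simp add: H_norm_def H_form_def)

text \<open>Sobolev embedding in dimension one, from \<open>f(u) = \<integral> (v f(u+v))' dv\<close>.\<close>

lemma sup_le_H_norm:
  assumes f: "f \<in> Cinf_torus" and m: "m \<ge> 1"
  shows "\<bar>f u\<bar> \<le> 2 * H_norm m f"
proof -
  define g h where "g = (\<lambda>v. f (v + u))" and "h = (\<lambda>v. deriv f (v + u))"
  have f': "deriv f \<in> Cinf_torus" by (rule Cinf_deriv[OF f])
  have g': "(g has_real_derivative h v) (at v)" for v
    using Cinf_torusD(2)[OF f, of "v + u"] by (simp add: g_def h_def DERIV_shift)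
  have cont: "continuous_on UNIV g" "continuous_on UNIV h" unfolding g_def h_def
    by (auto intro!: continuous_on_compose2[OF Cinf_torusD(3)[OF f]] continuous_on_compose2[OF Cinf_torusD(3)[OF f']] continuous_intros)
  have "periodic g" "periodic h"
    unfolding periodic_def g_def h_def
    using Cinf_torusD(1)[OF f, unfolded periodic_def, rule_format, of "v + u" for v]
      Cinf_torusD(1)[OF f', unfolded periodic_def, rule_format, of "v + u" for v]
    by (simp_all add: add_ac)
  then have bdd: "g \<in> bdd_fun" "h \<in> bdd_fun"
    by (auto intro: continuous_periodic_bdd_fun cont)
  \<comment> \<open>\<open>frac\<close> replaces the weight \<open>v\<close>: the two agree on the
    torus, and \<open>frac\<close> is bounded on the whole line.\<close>
  have "frac \<in> borel_measurable (borel :: real measure)" unfolding frac_def[abs_def] by measurable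
  then have fr: "frac \<in> bdd_fun" by (rule bdd_funI[of _ 1]) (auto simp: frac_lt_1 less_imp_le)
  have "(\<integral>v. g v + v * h v \<partial>torus) = 1 * g 1 - 0 * g 0"
    by (intro torus_integral_FTC) (auto intro!: derivative_eq_intros g' continuous_intros cont)
  also have "\<dots> = f u" using Cinf_torusD(1)[OF f] unfolding g_def periodic_def by (simp add: add.commute[of 1])
  also have "(\<integral>v. g v + v * h v \<partial>torus) = (\<integral>v. 1 * g v + frac v * h v \<partial>torus)"
    by (intro Bochner_Integration.integral_cong) (auto simp: frac_eq)
  also have "\<dots> = tinner (\<lambda>v. 1) g + tinner frac h"
    unfolding tinner_def
    by (intro Bochner_Integration.integral_add bdd_fun_integrable bdd_fun_mult fr bdd bdd_fun_const)
  finally have "\<bar>f u\<bar> \<le> \<bar>tinner (\<lambda>v. 1) g\<bar> + \<bar>tinner frac h\<bar>" by linarith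
  also have "\<bar>tinner (\<lambda>v. 1) g\<bar> \<le> sqrt (tinner (\<lambda>v. 1) (\<lambda>v. 1)) * sqrt (tinner g g)"
    by (intro tinner_Cauchy_Schwarz bdd bdd_fun_const)
  also have "\<dots> = sqrt (tinner g g)" using torus.prob_space by (simp add: tinner_def)
  also have "\<bar>tinner frac h\<bar> \<le> sqrt (tinner frac frac) * sqrt (tinner h h)"
    by (intro tinner_Cauchy_Schwarz bdd fr)
  also have "\<dots> \<le> 1 * sqrt (tinner h h)"
  proof (rule mult_right_mono)
    have "\<bar>tinner frac frac\<bar> \<le> 1 * 1"
      by (intro tinner_bound fr) (auto simp: frac_lt_1 less_imp_le)
    then show "sqrt (tinner frac frac) \<le> 1" by simp
  qed (simp add: tinner_nonneg)
  also have "tinner g g = H_form 0 f" unfolding g_def tinner_def H_form_def using Cinf_torusD(1)[OF f]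
    by (subst torus_integral_shift[of "\<lambda>v. f v * f v"]) (auto intro: bdd_fun_mult Cinf_torusD(4)[OF f] simp: periodic_def)
  also have "tinner h h = H_form 0 (deriv f)" unfolding h_def tinner_def H_form_def using Cinf_torusD(1)[OF f']
    by (subst torus_integral_shift[of "\<lambda>v. deriv f v * deriv f v"]) (auto intro: bdd_fun_mult Cinf_torusD(4)[OF f'] simp: periodic_def)
  also have "sqrt (H_form 0 f) + 1 * sqrt (H_form 0 (deriv f)) \<le> 2 * sqrt (H_form 1 f)"
  proof -
    have "H_form 0 f \<le> H_form 1 f" "H_form 0 (deriv f) \<le> H_form 1 f"
      using H_form_Suc[OF f, of 0] H_form_nonneg[OF f, of 0] H_form_nonneg[OF f', of 0] by auto
    then have "sqrt (H_form 0 f) \<le> sqrt (H_form 1 f)" "sqrt (H_form 0 (deriv f)) \<le> sqrt (H_form 1 f)"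
      by simp_all
    then show ?thesis by linarith
  qed
  also have "\<dots> \<le> 2 * H_norm m f" using H_form_mono[OF f m] by (simp add: H_norm_eq)
  finally show ?thesis by simp
qed

text \<open>By the Sobolev embedding a sup-norm bound implies the bound that \<open>H_neg\<close>
  asks for, with constant 2. Measures of mass at most 1 satisfy it at once.\<close>

lemma H_negI:
  assumes "\<phi> \<in> extensional Cinf_torus" and m: "m \<ge> 1"
    and "\<And>f g r. f \<in> Cinf_torus \<Longrightarrow> g \<in> Cinf_torus \<Longrightarrow> \<phi> (\<lambda>u. f u + r * g u) = \<phi> f + r * \<phi> g"
    and b: "\<And>f B. f \<in> Cinf_torus \<Longrightarrow> (\<And>u. \<bar>f u\<bar> \<le> B) \<Longrightarrow> \<bar>\<phi> f\<bar> \<le> B"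
  shows "\<phi> \<in> H_neg m"
proof -
  have "\<forall>f\<in>Cinf_torus. \<bar>\<phi> f\<bar> \<le> 2 * H_norm m f"
    using b sup_le_H_norm[OF _ m] by simp
  then show ?thesis unfolding H_neg_def using assms(1,3) by auto
qed

section \<open>Fourier coefficients of functionals in the dual space\<close>

lemma gamma_pos: "gamma k > 0" and gamma_ge1: "gamma k \<ge> 1"
  by (auto simp: gamma_def add_pos_nonneg)

lemma gamma_nonneg [simp]: "0 \<le> gamma k"
  using gamma_pos[of k] by simp

lemma coeff_term_nonneg: "0 \<le> (a k)\<^sup>2 / gamma k ^ m"
  by (intro divide_nonneg_nonneg) simp_all

lemma H_neg_lin: "\<phi> \<in> H_neg m \<Longrightarrow> f \<in> Cinf_torus \<Longrightarrow> g \<in> Cinf_torus \<Longrightarrow> \<phi> (\<lambda>u. f u + r * g u) = \<phi> f + r * \<phi> g"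
  by (simp add: H_neg_def)

lemma H_neg_zero: "\<phi> \<in> H_neg m \<Longrightarrow> \<phi> (\<lambda>u. 0) = 0"
  using H_neg_lin[of \<phi> m "\<lambda>u. 0" "\<lambda>u. 0" "-1"] Cinf_zero by simp

lemma H_neg_sum:
  assumes "\<phi> \<in> H_neg m"
  shows "finite A \<Longrightarrow> \<phi> (\<lambda>u. \<Sum>k\<in>A. c k * psi k u) = (\<Sum>k\<in>A. c k * \<phi> (psi k))"
proof (induction A rule: finite_induct)
  case (insert x A)
  then show ?case using H_neg_lin[OF assms, of "\<lambda>u. \<Sum>k\<in>A. c k * psi k u" "psi x" "c x"]
    by (simp add: Cinf_sum Cinf_psi add.commute)
qed (simp add: H_neg_zero[OF assms])

text \<open>Test \<open>\<phi>\<close> on its own truncated Riesz representer: both the value of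
  \<open>\<phi>\<close> and the squared norm of the test function are then the partial sum
  \<open>S\<close>, so \<open>S \<le> C * sqrt S\<close>. The uniform bound makes the series in
  \<open>H_neg_inner\<close> genuinely summable, where \<open>infsum\<close> would otherwise be the
  default value 0.\<close>

lemma H_neg_coeff_bound:
  assumes "\<phi> \<in> H_neg m"
  shows "\<exists>B. \<forall>A. finite A \<longrightarrow> (\<Sum>k\<in>A. (\<phi> (psi k))\<^sup>2 / gamma k ^ m) \<le> B"
proof -
  obtain C where C: "\<And>f. f \<in> Cinf_torus \<Longrightarrow> \<bar>\<phi> f\<bar> \<le> C * H_norm m f"
    using assms unfolding H_neg_def by blast
  have "(\<Sum>k\<in>A. (\<phi> (psi k))\<^sup>2 / gamma k ^ m) \<le> C\<^sup>2" if A: "finite A" for A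
  proof -
    define c where "c k = \<phi> (psi k) / gamma k ^ m" for k
    define f where "f = (\<lambda>u. \<Sum>k\<in>A. c k * psi k u)"
    define S where "S = (\<Sum>k\<in>A. (\<phi> (psi k))\<^sup>2 / gamma k ^ m)"
    have g: "gamma k ^ m > 0" for k using gamma_pos by simp
    have f: "f \<in> Cinf_torus" unfolding f_def by (intro Cinf_sum A Cinf_psi)
    have "\<phi> f = S" unfolding f_def S_def H_neg_sum[OF assms A]
      by (simp add: c_def power2_eq_square)
    moreover have "H_form m f = S"
    proof -
      have "H_form m f = tinner (\<lambda>u. \<Sum>k\<in>A. c k * psi k u) (\<lambda>u. \<Sum>j\<in>A. (c j * gamma j ^ m) * psi j u)"
        unfolding H_form_def f_def Lap_pow_psi_sum[OF A] ..
      also have "\<dots> = (\<Sum>k\<in>A. \<Sum>j\<in>A. c k * (c j * gamma j ^ m * of_bool (k = j)))"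
        by (simp add: tinner_sum_left tinner_sum_right bdd_fun_intros psi_bdd_fun tinner_cmult_left tinner_cmult_right psi_orthonormal sum_distrib_left)
      also have "\<dots> = (\<Sum>k\<in>A. c k * (c k * gamma k ^ m))"
        using A by (intro sum.cong) (auto simp: of_bool_def if_distrib sum.delta cong: if_cong)
      also have "\<dots> = S" unfolding S_def c_def using g
        by (intro sum.cong) (auto simp: power2_eq_square less_imp_neq[OF g, symmetric])
      finally show ?thesis .
    qed
    ultimately have "S \<le> C * sqrt S" using C[OF f] by (simp add: H_norm_eq)
    moreover have "0 \<le> S" unfolding S_def by (intro sum_nonneg coeff_term_nonneg)
    ultimately have "S \<le> C\<^sup>2"
    proof (cases "S = 0")
      case False
      then have "sqrt S * sqrt S \<le> C * sqrt S" "sqrt S > 0" using \<open>S \<le> C * sqrt S\<close> \<open>0 \<le> S\<close> by auto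
      then have "sqrt S \<le> C" by (rule mult_right_le_imp_le)
      then have "(sqrt S)\<^sup>2 \<le> C\<^sup>2" using \<open>0 \<le> S\<close> by (intro power_mono) auto
      then show ?thesis using \<open>0 \<le> S\<close> by simp
    qed simp
    then show ?thesis by (simp add: S_def)
  qed
  then show ?thesis by blast
qed

text \<open>Write \<open>L = 1 - \<Delta>\<close> and let \<open>g\<close> be the remainder of the Fourier series of \<open>f\<close>.  As \<open>g\<close> is orthogonal to the
  Fourier sum, \<open>\<langle>g, L\<^sup>m g\<rangle> = \<langle>g, L\<^sup>m f\<rangle>\<close>, so \<open>L\<^sup>2\<close>-convergence of the series is enough for convergence in \<open>\<H>\<^sub>m\<close>.\<close>

lemma H_neg_ext:
  assumes \<phi>: "\<phi> \<in> H_neg m" and \<xi>: "\<xi> \<in> H_neg m" and eq: "\<And>k. \<phi> (psi k) = \<xi> (psi k)"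
  shows "\<phi> = \<xi>"
proof (rule extensionalityI)
  show "\<phi> \<in> extensional Cinf_torus" "\<xi> \<in> extensional Cinf_torus" using \<phi> \<xi> by (auto simp: H_neg_def)
  fix f assume f: "f \<in> Cinf_torus"
  obtain C D where C: "\<And>f. f \<in> Cinf_torus \<Longrightarrow> \<bar>\<phi> f\<bar> \<le> C * H_norm m f"
    and D: "\<And>f. f \<in> Cinf_torus \<Longrightarrow> \<bar>\<xi> f\<bar> \<le> D * H_norm m f"
    using \<phi> \<xi> unfolding H_neg_def by blast
  define g where "g N = (\<lambda>u. f u - fourier_sum N f u)" for N
  define Q where "Q = sqrt (tinner ((Lap ^^ m) f) ((Lap ^^ m) f))"
  have fs: "fourier_sum N f \<in> Cinf_torus" for N
    unfolding fourier_sum_def[abs_def] by (intro Cinf_sum Cinf_psi) auto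
  have gC: "g N \<in> Cinf_torus" for N
    using Cinf_lin[OF f fs, of "-1" N] by (simp add: g_def)
  have split: "\<phi> f = \<phi> (g N) + \<phi> (fourier_sum N f)" if "\<phi> \<in> H_neg m" for \<phi> N
    using H_neg_lin[OF that f fs, of "-1" N] by (simp add: g_def)
  have "\<phi> (fourier_sum N f) = \<xi> (fourier_sum N f)" for N
    unfolding fourier_sum_def[abs_def] by (simp add: H_neg_sum[OF \<phi>] H_neg_sum[OF \<xi>] eq)
  then have le: "\<bar>\<phi> f - \<xi> f\<bar> \<le> (C + D) * H_norm m (g N)" for N
    using split[OF \<phi>, of N] split[OF \<xi>, of N] C[OF gC, of N] D[OF gC, of N] by (simp add: distrib_right)
  have H: "H_form m (g N) \<le> sqrt (tinner (g N) (g N)) * Q" for N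
  proof -
    have gk: "tinner (g N) (psi k) = 0" if "k \<in> {- int N..int N}" for k
      unfolding g_def using that by (intro tinner_fourier_rest Cinf_torusD(4) f) auto
    have "(Lap ^^ m) (g N) = (\<lambda>u. (Lap ^^ m) f u + (-1) * (Lap ^^ m) (fourier_sum N f) u)"
      using Lap_pow_lin[OF f fs, of m "-1" N] by (simp add: g_def)
    then have "H_form m (g N) = tinner (g N) (\<lambda>u. (Lap ^^ m) f u + (-1) * (Lap ^^ m) (fourier_sum N f) u)"
      by (simp add: H_form_def)
    also have "\<dots> = tinner (g N) ((Lap ^^ m) f) + tinner (g N) (\<lambda>u. (-1) * (Lap ^^ m) (fourier_sum N f) u)"
      by (intro tinner_add_right bdd_fun_cmult Cinf_torusD(4) Cinf_Lap_pow f gC fs)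
    also have "tinner (g N) (\<lambda>u. (-1) * (Lap ^^ m) (fourier_sum N f) u) = 0"
      unfolding tinner_cmult_right fourier_sum_def[abs_def]
      by (simp add: Lap_pow_psi_sum tinner_sum_right bdd_fun_cmult psi_bdd_fun Cinf_torusD(4)[OF gC] tinner_cmult_right gk)
    finally show ?thesis
      using tinner_Cauchy_Schwarz[OF Cinf_torusD(4)[OF gC] Cinf_torusD(4)[OF Cinf_Lap_pow[OF f]], of N m]
      unfolding Q_def by linarith
  qed
  have "\<bar>\<phi> f - \<xi> f\<bar> \<le> (\<bar>C\<bar> + \<bar>D\<bar>) * sqrt (sqrt (tinner (g N) (g N)) * Q)" for N
  proof -
    have "\<bar>\<phi> f - \<xi> f\<bar> \<le> (\<bar>C\<bar> + \<bar>D\<bar>) * H_norm m (g N)"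
      by (rule order_trans[OF le mult_right_mono]) (auto simp: H_norm_eq H_form_nonneg[OF gC])
    also have "\<dots> \<le> (\<bar>C\<bar> + \<bar>D\<bar>) * sqrt (sqrt (tinner (g N) (g N)) * Q)"
      using H[of N] by (intro mult_left_mono) (auto simp: H_norm_eq)
    finally show ?thesis .
  qed
  moreover have "(\<lambda>N. (\<bar>C\<bar> + \<bar>D\<bar>) * sqrt (sqrt (tinner (g N) (g N)) * Q)) \<longlonglongrightarrow> (\<bar>C\<bar> + \<bar>D\<bar>) * sqrt (sqrt 0 * Q)"
    unfolding g_def by (intro tendsto_intros fourier_sum_tendsto Cinf_torusD f)
  ultimately have "\<bar>\<phi> f - \<xi> f\<bar> \<le> (\<bar>C\<bar> + \<bar>D\<bar>) * sqrt (sqrt 0 * Q)"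
    by (intro LIMSEQ_le_const) auto
  then show "\<phi> f = \<xi> f" by simp
qed

section \<open>The metric of \<open>H_neg\<close> in terms of coefficients\<close>

definition coeff_norm :: "nat \<Rightarrow> (int \<Rightarrow> real) \<Rightarrow> real" where
  "coeff_norm m a = sqrt (\<Sum>\<^sub>\<infinity>k. (a k)\<^sup>2 / gamma k ^ m)"

lemma H_neg_dist_eq: "H_neg_dist m \<phi> \<xi> = coeff_norm m (\<lambda>k. \<phi> (psi k) - \<xi> (psi k))"
  by (simp add: H_neg_dist_def H_neg_inner_def coeff_norm_def Cinf_psi power2_eq_square)

lemma nonneg_summable_onI:
  fixes f :: "'i \<Rightarrow> real"
  assumes "\<And>k. 0 \<le> f k" "\<And>A. finite A \<Longrightarrow> (\<Sum>k\<in>A. f k) \<le> B"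
  shows "f summable_on UNIV"
proof (rule nonneg_bdd_above_summable_on)
  show "bdd_above (sum f ` {F. F \<subseteq> UNIV \<and> finite F})"
    by (rule bdd_aboveI[of _ B]) (use assms(2) in auto)
qed (use assms(1) in auto)

lemma coeff_norm_le:
  assumes "\<And>A. finite A \<Longrightarrow> (\<Sum>k\<in>A. (a k)\<^sup>2 / gamma k ^ m) \<le> B\<^sup>2" "0 \<le> B"
  shows "coeff_norm m a \<le> B"
proof -
  have "(\<lambda>k. (a k)\<^sup>2 / gamma k ^ m) summable_on UNIV"
    by (rule nonneg_summable_onI[OF coeff_term_nonneg]) (rule assms(1))
  then have "(\<Sum>\<^sub>\<infinity>k. (a k)\<^sup>2 / gamma k ^ m) \<le> B\<^sup>2"
    by (rule infsum_le_finite_sums) (use assms in auto)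
  then have "coeff_norm m a \<le> sqrt (B\<^sup>2)" unfolding coeff_norm_def by (rule real_sqrt_le_mono)
  then show ?thesis using assms(2) by simp
qed

lemma coeff_norm_nonneg: "0 \<le> coeff_norm m a"
  unfolding coeff_norm_def by (intro real_sqrt_ge_zero infsum_nonneg coeff_term_nonneg)

lemma coeff_diff_summable:
  assumes "\<phi> \<in> H_neg m" "\<xi> \<in> H_neg m"
  shows "(\<lambda>k. (\<phi> (psi k) - \<xi> (psi k))\<^sup>2 / gamma k ^ m) summable_on UNIV"
proof -
  obtain B where B: "\<And>A. finite A \<Longrightarrow> (\<Sum>k\<in>A. (\<phi> (psi k))\<^sup>2 / gamma k ^ m) \<le> B"
    using H_neg_coeff_bound[OF assms(1)] by blast
  obtain C where C: "\<And>A. finite A \<Longrightarrow> (\<Sum>k\<in>A. (\<xi> (psi k))\<^sup>2 / gamma k ^ m) \<le> C"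
    using H_neg_coeff_bound[OF assms(2)] by blast
  have "(\<Sum>k\<in>A. (\<phi> (psi k) - \<xi> (psi k))\<^sup>2 / gamma k ^ m) \<le> 2 * B + 2 * C" if A: "finite A" for A
  proof -
    have sq: "(x - y)\<^sup>2 \<le> 2 * x\<^sup>2 + 2 * y\<^sup>2" for x y :: real
      using zero_le_power2[of "x + y"] by (simp add: power2_eq_square algebra_simps)
    have "(\<Sum>k\<in>A. (\<phi> (psi k) - \<xi> (psi k))\<^sup>2 / gamma k ^ m)
      \<le> (\<Sum>k\<in>A. 2 * ((\<phi> (psi k))\<^sup>2 / gamma k ^ m) + 2 * ((\<xi> (psi k))\<^sup>2 / gamma k ^ m))"
    proof (rule sum_mono)
      fix k
      have "(\<phi> (psi k) - \<xi> (psi k))\<^sup>2 / gamma k ^ m \<le> (2 * (\<phi> (psi k))\<^sup>2 + 2 * (\<xi> (psi k))\<^sup>2) / gamma k ^ m"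
        by (intro divide_right_mono sq) simp
      then show "(\<phi> (psi k) - \<xi> (psi k))\<^sup>2 / gamma k ^ m
        \<le> 2 * ((\<phi> (psi k))\<^sup>2 / gamma k ^ m) + 2 * ((\<xi> (psi k))\<^sup>2 / gamma k ^ m)"
        by (simp add: add_divide_distrib)
    qed
    also have "\<dots> \<le> 2 * B + 2 * C"
      unfolding sum.distrib sum_distrib_left[symmetric] using B[OF A] C[OF A] by linarith
    finally show ?thesis .
  qed
  then show ?thesis by (rule nonneg_summable_onI[OF coeff_term_nonneg])
qed

text \<open>Dividing by the square root of the weight turns finite sections into Euclidean norms,
  for which \<open>L2_set_triangle_ineq\<close> is available.\<close>

lemma L2_le_coeff_norm:
  assumes "(\<lambda>k. (a k)\<^sup>2 / gamma k ^ m) summable_on UNIV" "finite A"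
  shows "L2_set (\<lambda>k. a k / sqrt (gamma k ^ m)) A \<le> coeff_norm m a"
proof -
  have "(\<Sum>k\<in>A. (a k)\<^sup>2 / gamma k ^ m) \<le> (\<Sum>\<^sub>\<infinity>k. (a k)\<^sup>2 / gamma k ^ m)"
    using assms coeff_term_nonneg by (intro finite_sum_le_infsum) auto
  moreover have "(\<Sum>k\<in>A. (a k / sqrt (gamma k ^ m))\<^sup>2) = (\<Sum>k\<in>A. (a k)\<^sup>2 / gamma k ^ m)"
    by (intro sum.cong) (simp_all add: power_divide)
  ultimately show ?thesis by (simp add: coeff_norm_def L2_set_def)
qed

text \<open>Vanishing distance forces equal coefficients, and coefficients determine a functional by
  \<open>H_neg_ext\<close>. The triangle inequality is proved on finite sections, and
  \<open>coeff_norm_le\<close> passes it to the series.\<close>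

lemma Metric_space_H_neg: "Metric_space (H_neg m) (H_neg_dist m)"
proof
  show "0 \<le> H_neg_dist m \<phi> \<xi>" for \<phi> \<xi> unfolding H_neg_dist_eq by (rule coeff_norm_nonneg)
  show "H_neg_dist m \<phi> \<xi> = H_neg_dist m \<xi> \<phi>" for \<phi> \<xi>
    unfolding H_neg_dist_eq coeff_norm_def by (simp add: power2_commute)
next
  fix \<phi> \<xi> assume *: "\<phi> \<in> H_neg m" "\<xi> \<in> H_neg m"
  show "H_neg_dist m \<phi> \<xi> = 0 \<longleftrightarrow> \<phi> = \<xi>"
  proof
    assume 0: "H_neg_dist m \<phi> \<xi> = 0"
    have "\<phi> (psi k) = \<xi> (psi k)" for k
    proof -
      have "L2_set (\<lambda>k. (\<phi> (psi k) - \<xi> (psi k)) / sqrt (gamma k ^ m)) {k} \<le> 0"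
        using L2_le_coeff_norm[OF coeff_diff_summable[OF *], of "{k}"] 0 by (simp add: H_neg_dist_eq)
      then show ?thesis using zero_less_power[OF gamma_pos, of k m] by (auto simp: L2_set_def divide_le_0_iff)
    qed
    then show "\<phi> = \<xi>" by (rule H_neg_ext[OF *])
  qed (simp add: H_neg_dist_eq coeff_norm_def)
next
  fix \<phi> \<xi> \<zeta> assume *: "\<phi> \<in> H_neg m" "\<xi> \<in> H_neg m" "\<zeta> \<in> H_neg m"
  show "H_neg_dist m \<phi> \<zeta> \<le> H_neg_dist m \<phi> \<xi> + H_neg_dist m \<xi> \<zeta>"
    unfolding H_neg_dist_eq
  proof (rule coeff_norm_le)
    fix A :: "int set" assume A: "finite A"
    let ?g = "\<lambda>k. sqrt (gamma k ^ m)"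
    have "sqrt (\<Sum>k\<in>A. (\<phi> (psi k) - \<zeta> (psi k))\<^sup>2 / gamma k ^ m) = L2_set (\<lambda>k. (\<phi> (psi k) - \<xi> (psi k)) / ?g k + (\<xi> (psi k) - \<zeta> (psi k)) / ?g k) A"
      unfolding L2_set_def
      by (intro arg_cong[of _ _ sqrt] sum.cong) (simp_all add: power_divide flip: add_divide_distrib)
    also have "\<dots> \<le> L2_set (\<lambda>k. (\<phi> (psi k) - \<xi> (psi k)) / ?g k) A + L2_set (\<lambda>k. (\<xi> (psi k) - \<zeta> (psi k)) / ?g k) A"
      by (rule L2_set_triangle_ineq)
    also have "\<dots> \<le> coeff_norm m (\<lambda>k. \<phi> (psi k) - \<xi> (psi k)) + coeff_norm m (\<lambda>k. \<xi> (psi k) - \<zeta> (psi k))"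
      using * by (intro add_mono L2_le_coeff_norm coeff_diff_summable A)
    finally have "(sqrt (\<Sum>k\<in>A. (\<phi> (psi k) - \<zeta> (psi k))\<^sup>2 / gamma k ^ m))\<^sup>2
      \<le> (coeff_norm m (\<lambda>k. \<phi> (psi k) - \<xi> (psi k)) + coeff_norm m (\<lambda>k. \<xi> (psi k) - \<zeta> (psi k)))\<^sup>2"
      by (intro power_mono real_sqrt_ge_zero sum_nonneg coeff_term_nonneg)
    moreover have "(sqrt (\<Sum>k\<in>A. (\<phi> (psi k) - \<zeta> (psi k))\<^sup>2 / gamma k ^ m))\<^sup>2
      = (\<Sum>k\<in>A. (\<phi> (psi k) - \<zeta> (psi k))\<^sup>2 / gamma k ^ m)"
      by (intro real_sqrt_pow2 sum_nonneg coeff_term_nonneg)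
    ultimately show "(\<Sum>k\<in>A. (\<phi> (psi k) - \<zeta> (psi k))\<^sup>2 / gamma k ^ m)
      \<le> (coeff_norm m (\<lambda>k. \<phi> (psi k) - \<xi> (psi k)) + coeff_norm m (\<lambda>k. \<xi> (psi k) - \<zeta> (psi k)))\<^sup>2"
      by (simp only:)
  qed (simp add: coeff_norm_nonneg)
qed

section \<open>Uniform smallness of high modes\<close>

lemma inverse_gamma_nonneg: "0 \<le> 1 / gamma k ^ m"
  by (intro divide_nonneg_nonneg zero_le_power) auto

lemma gamma_inverse_summable:
  assumes "m \<ge> 1" shows "(\<lambda>k. 1 / gamma k ^ m) summable_on UNIV"
proof -
  have sq: "(\<Sum>k\<in>A. 1 / gamma k) \<le> 1 + 2 * (\<Sum>n. 1 / (real n)\<^sup>2)" if A: "finite A" for A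
  proof -
    have le: "1 / gamma k \<le> 1 / (real (nat \<bar>k\<bar>))\<^sup>2" if "k \<noteq> 0" for k
    proof (rule divide_left_mono)
      have "1 * (of_int k)\<^sup>2 \<le> (4 * pi\<^sup>2) * (of_int k :: real)\<^sup>2"
      proof (rule mult_right_mono)
        have "1 \<le> pi\<^sup>2" using pi_gt3 by (intro one_le_power) linarith
        then show "1 \<le> 4 * pi\<^sup>2" by linarith
      qed simp
      then show "(real (nat \<bar>k\<bar>))\<^sup>2 \<le> gamma k" by (simp add: gamma_def)
      show "0 < gamma k * (real (nat \<bar>k\<bar>))\<^sup>2" using that gamma_pos by simp
    qed simp
    have s: "summable (\<lambda>n. 1 / (real n)\<^sup>2)" using inverse_power_summable[of 2, where 'a = real] by (simp add: field_simps)
    \<comment> \<open>Positive and negative indices are summed apart, since the absolute value is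
      injective only on each half. The term \<open>n = 0\<close> of the comparison series is
      \<open>1 / 0 = 0\<close>; the index 0 is paid for by the separate summand 1.\<close>
    have part: "(\<Sum>k\<in>B. 1 / gamma k) \<le> (\<Sum>n. 1 / (real n)\<^sup>2)"
      if "finite B" "0 \<notin> B" "inj_on (\<lambda>k. nat \<bar>k\<bar>) B" for B
    proof -
      have "(\<Sum>k\<in>B. 1 / gamma k) \<le> (\<Sum>k\<in>B. 1 / (real (nat \<bar>k\<bar>))\<^sup>2)"
        using that by (intro sum_mono le) metis
      also have "\<dots> = (\<Sum>n\<in>(\<lambda>k. nat \<bar>k\<bar>) ` B. 1 / (real n)\<^sup>2)" using that by (simp add: sum.reindex)
      also have "\<dots> \<le> (\<Sum>n. 1 / (real n)\<^sup>2)" using that s by (intro sum_le_suminf) auto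
      finally show ?thesis .
    qed
    have "(\<Sum>k\<in>A. 1 / gamma k) \<le> (\<Sum>k\<in>insert 0 (A \<inter> {1..} \<union> A \<inter> {..-1}). 1 / gamma k)"
    proof (rule sum_mono2)
      show "A \<subseteq> insert 0 (A \<inter> {1..} \<union> A \<inter> {..-1})" by auto
    qed (use A in auto)
    also have "\<dots> = 1 / gamma 0 + ((\<Sum>k\<in>A \<inter> {1..}. 1 / gamma k) + (\<Sum>k\<in>A \<inter> {..-1}. 1 / gamma k))"
      using A by (subst sum.insert) (auto intro!: sum.union_disjoint)
    also have "\<dots> \<le> 1 + ((\<Sum>n. 1 / (real n)\<^sup>2) + (\<Sum>n. 1 / (real n)\<^sup>2))"
      using A by (intro add_mono part) (auto simp: gamma_def inj_on_def)
    finally show ?thesis by simp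
  qed
  have "(\<Sum>k\<in>A. 1 / gamma k ^ m) \<le> 1 + 2 * (\<Sum>n. 1 / (real n)\<^sup>2)" if A: "finite A" for A
  proof -
    have "gamma k \<le> gamma k ^ m" for k using gamma_ge1[of k] assms by (simp add: self_le_power)
    then have "(\<Sum>k\<in>A. 1 / gamma k ^ m) \<le> (\<Sum>k\<in>A. 1 / gamma k)"
      using gamma_pos by (intro sum_mono divide_left_mono) auto
    then show ?thesis using sq[OF A] by linarith
  qed
  then show ?thesis
    by (rule nonneg_summable_onI[OF inverse_gamma_nonneg])
qed

text \<open>The weights are summable, so a sequence bounded by \<open>C\<close> has little norm
  outside a finite set \<open>K\<close> that depends only on \<open>m\<close>, \<open>C\<close> and
  \<open>e\<close>; inside \<open>K\<close> smallness of each coefficient is enough.\<close>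

lemma coeff_norm_small:
  assumes m: "m \<ge> 1" and e: "e > 0"
  shows "\<exists>K d. finite K \<and> d > 0 \<and>
    (\<forall>a. (\<forall>k. \<bar>a k\<bar> \<le> C) \<longrightarrow> (\<forall>k\<in>K. \<bar>a k\<bar> \<le> d) \<longrightarrow> coeff_norm m a \<le> e)"
proof -
  define S where "S = (\<Sum>\<^sub>\<infinity>k. 1 / gamma k ^ m)"
  \<comment> \<open>The budget \<open>e\<^sup>2\<close> is halved: \<open>C\<^sup>2 * e'\<close>
    bounds the part outside \<open>K\<close>, \<open>d\<^sup>2 * S\<close> the part inside. Adding 1
    to \<open>C\<^sup>2\<close> and to \<open>S\<close> avoids dividing by zero.\<close>
  define e' where "e' = e\<^sup>2 / (2 * (C\<^sup>2 + 1))"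
  define d where "d = e / sqrt (2 * (S + 1))"
  have C1: "C\<^sup>2 + 1 > 0" by (simp add: add_nonneg_pos)
  note nn = inverse_gamma_nonneg[of _ m]
  have sm: "(\<lambda>k. 1 / gamma k ^ m) summable_on UNIV" using m by (rule gamma_inverse_summable)
  have S0: "0 \<le> S" unfolding S_def by (intro infsum_nonneg nn)
  have e': "e' > 0" using e C1 by (simp add: e'_def)
  obtain K where K: "finite K" "S - e' \<le> (\<Sum>k\<in>K. 1 / gamma k ^ m)"
  proof -
    have "((\<lambda>K. \<Sum>k\<in>K. 1 / gamma k ^ m) \<longlongrightarrow> S) (finite_subsets_at_top UNIV)"
      unfolding S_def using infsum_tendsto[OF sm] .
    then have "eventually (\<lambda>K. S - e' < (\<Sum>k\<in>K. 1 / gamma k ^ m)) (finite_subsets_at_top UNIV)"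
      using e' by (intro order_tendstoD(1)) auto
    then have "\<exists>K. finite K \<and> S - e' < (\<Sum>k\<in>K. 1 / gamma k ^ m)"
      unfolding eventually_finite_subsets_at_top by blast
    then obtain K where "finite K" "S - e' < (\<Sum>k\<in>K. 1 / gamma k ^ m)" by blast
    then show ?thesis by (intro that[of K]) simp_all
  qed
  have d: "d > 0" using e S0 by (simp add: d_def)
  have small: "coeff_norm m a \<le> e" if aC: "\<And>k. \<bar>a k\<bar> \<le> C" and ad: "\<And>k. k \<in> K \<Longrightarrow> \<bar>a k\<bar> \<le> d" for a
  proof (rule coeff_norm_le)
    fix A :: "int set" assume A: "finite A"
    have sqC: "(a k)\<^sup>2 \<le> C\<^sup>2" for k using power_mono[OF aC[of k], of 2] by simp
    have sqd: "(a k)\<^sup>2 \<le> d\<^sup>2" if "k \<in> K" for k using power_mono[OF ad[OF that], of 2] by simp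
    have "(\<Sum>k\<in>A. (a k)\<^sup>2 / gamma k ^ m) = (\<Sum>k\<in>A \<inter> K. (a k)\<^sup>2 / gamma k ^ m) + (\<Sum>k\<in>A - K. (a k)\<^sup>2 / gamma k ^ m)"
      using A by (simp add: sum.Int_Diff)
    also have "(\<Sum>k\<in>A \<inter> K. (a k)\<^sup>2 / gamma k ^ m) \<le> (\<Sum>k\<in>A \<inter> K. d\<^sup>2 * (1 / gamma k ^ m))"
      by (rule sum_mono) (simp add: divide_right_mono sqd)
    also have "\<dots> \<le> d\<^sup>2 * S"
      unfolding sum_distrib_left[symmetric] S_def using A sm nn
      by (intro mult_left_mono finite_sum_le_infsum) auto
    also have "d\<^sup>2 * S \<le> e\<^sup>2 / 2"
    proof -
      have "d\<^sup>2 * S = e\<^sup>2 / 2 * (S / (S + 1))" using S0 by (simp add: d_def power_divide)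
      also have "\<dots> \<le> e\<^sup>2 / 2 * 1" using S0 by (intro mult_left_mono) auto
      finally show ?thesis by simp
    qed
    also have "(\<Sum>k\<in>A - K. (a k)\<^sup>2 / gamma k ^ m) \<le> (\<Sum>k\<in>A - K. C\<^sup>2 * (1 / gamma k ^ m))"
      by (rule sum_mono) (simp add: divide_right_mono sqC)
    also have "\<dots> \<le> C\<^sup>2 * e'"
    proof -
      have "(\<Sum>k\<in>A - K. 1 / gamma k ^ m) + (\<Sum>k\<in>K. 1 / gamma k ^ m) = (\<Sum>k\<in>(A - K) \<union> K. 1 / gamma k ^ m)"
        using A K by (intro sum.union_disjoint[symmetric]) auto
      also have "\<dots> \<le> S" unfolding S_def using A K sm nn by (intro finite_sum_le_infsum) auto
      finally have "(\<Sum>k\<in>A - K. 1 / gamma k ^ m) \<le> e'" using K(2) by linarith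
      then show ?thesis unfolding sum_distrib_left[symmetric] by (intro mult_left_mono) auto
    qed
    also have "C\<^sup>2 * e' \<le> e\<^sup>2 / 2"
    proof -
      have "C\<^sup>2 * e' = e\<^sup>2 / 2 * (C\<^sup>2 / (C\<^sup>2 + 1))" by (simp add: e'_def)
      also have "\<dots> \<le> e\<^sup>2 / 2 * 1" using C1 by (intro mult_left_mono) auto
      finally show ?thesis by simp
    qed
    finally show "(\<Sum>k\<in>A. (a k)\<^sup>2 / gamma k ^ m) \<le> e\<^sup>2" by simp
  qed (use e in simp)
  show ?thesis
  proof (intro exI[of _ K] exI[of _ d] conjI allI impI K(1) d)
    fix a assume "\<forall>k. \<bar>a k\<bar> \<le> C" "\<forall>k\<in>K. \<bar>a k\<bar> \<le> d"
    then show "coeff_norm m a \<le> e" by (intro small) simp_all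
  qed
qed

section \<open>The Skorokhod space\<close>

interpretation H: Metric_space "H_neg m" "H_neg_dist m" for m
  by (rule Metric_space_H_neg)

lemma cadlag_H_neg_right:
  assumes "cadlag (H_neg_topology m) I x" "t \<in> I" "e > 0"
  shows "\<exists>\<delta>>0. \<forall>s\<in>I. t \<le> s \<and> s < t + \<delta> \<longrightarrow> H_neg_dist m (x s) (x t) < e"
proof -
  have "limitin (H.mtopology m) x (x t) (at t within (I \<inter> {t<..}))"
    and xt: "x t \<in> H_neg m"
    using assms by (auto simp: cadlag_def H_neg_topology_def)
  then have "eventually (\<lambda>s. H_neg_dist m (x s) (x t) < e) (at t within (I \<inter> {t<..}))"
    using assms(3) unfolding H.limitin_metric by (auto elim: eventually_mono)
  then obtain \<delta> where d: "\<delta> > 0" "\<forall>s\<in>I \<inter> {t<..}. s \<noteq> t \<and> dist s t < \<delta> \<longrightarrow> H_neg_dist m (x s) (x t) < e"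
    unfolding eventually_at by blast
  show ?thesis
  proof (intro exI[of _ \<delta>] conjI d(1) ballI impI)
    fix s assume "s \<in> I" "t \<le> s \<and> s < t + \<delta>"
    then show "H_neg_dist m (x s) (x t) < e"
      using d(2) assms(3) xt by (cases "s = t") (auto simp: dist_real_def)
  qed
qed

lemma cadlag_H_neg_left:
  assumes "cadlag (H_neg_topology m) I x" "t \<in> I" "e > 0"
  shows "\<exists>\<delta>>0. \<exists>l\<in>H_neg m. \<forall>s\<in>I. s < t \<and> t - \<delta> < s \<longrightarrow> H_neg_dist m (x s) l < e"
proof -
  obtain l where "limitin (H.mtopology m) x l (at t within (I \<inter> {..<t}))"
    using assms by (auto simp: cadlag_def H_neg_topology_def)
  then have l: "l \<in> H_neg m" "eventually (\<lambda>s. H_neg_dist m (x s) l < e) (at t within (I \<inter> {..<t}))"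
    using assms(3) unfolding H.limitin_metric by (auto elim: eventually_mono)
  then obtain \<delta> where d: "\<delta> > 0" "\<forall>s\<in>I \<inter> {..<t}. s \<noteq> t \<and> dist s t < \<delta> \<longrightarrow> H_neg_dist m (x s) l < e"
    unfolding eventually_at by blast
  show ?thesis
    using d l(1) by (intro exI[of _ \<delta>] conjI bexI[of _ l]) (auto simp: dist_real_def)
qed

lemma cadlag_H_neg_in: "cadlag (H_neg_topology m) I x \<Longrightarrow> t \<in> I \<Longrightarrow> x t \<in> H_neg m"
  by (auto simp: cadlag_def H_neg_topology_def)

text \<open>Near each time the path stays within 1 of its value on the right and within 1 of its
  left limit on the left; bisection makes this local bound global. It is what keeps the set under
  the infimum in \<open>skorokhod_dist\<close> nonempty.\<close>

lemma cadlag_bounded: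
  assumes x: "cadlag (H_neg_topology m) {0..T} x" and T: "0 \<le> T" and z: "z \<in> H_neg m"
  shows "\<exists>C. \<forall>t\<in>{0..T}. H_neg_dist m z (x t) \<le> C"
proof -
  let ?P = "\<lambda>a b. \<exists>C. \<forall>t\<in>{a..b} \<inter> {0..T}. H_neg_dist m z (x t) \<le> C"
  have "?P 0 T"
  proof (rule Bolzano[of 0 T ?P])
    show "0 \<le> T" by (rule T)
  next
    fix a b c assume "?P a b" "?P b c" "a \<le> b" "b \<le> c"
    then obtain C D where CD: "\<forall>t\<in>{a..b} \<inter> {0..T}. H_neg_dist m z (x t) \<le> C"
      "\<forall>t\<in>{b..c} \<inter> {0..T}. H_neg_dist m z (x t) \<le> D" by blast
    have "H_neg_dist m z (x t) \<le> max C D" if "t \<in> {a..c} \<inter> {0..T}" for t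
    proof (cases "t \<le> b")
      case True
      then have "H_neg_dist m z (x t) \<le> C" using CD(1) that by auto
      then show ?thesis by simp
    next
      case False
      then have "H_neg_dist m z (x t) \<le> D" using CD(2) that by auto
      then show ?thesis by simp
    qed
    then show "?P a c" by blast
  next
    fix t assume "0 \<le> t" "t \<le> T"
    then have t: "t \<in> {0..T}" by simp
    obtain d1 where d1: "d1 > 0" "\<forall>s\<in>{0..T}. t \<le> s \<and> s < t + d1 \<longrightarrow> H_neg_dist m (x s) (x t) < 1"
      using cadlag_H_neg_right[OF x t zero_less_one] by blast
    obtain d2 l where d2: "d2 > 0" "l \<in> H_neg m" "\<forall>s\<in>{0..T}. s < t \<and> t - d2 < s \<longrightarrow> H_neg_dist m (x s) l < 1"
      using cadlag_H_neg_left[OF x t zero_less_one] by blast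
    define C where "C = max (H_neg_dist m z (x t)) (H_neg_dist m z l) + 1"
    have near: "H_neg_dist m z (x s) \<le> H_neg_dist m z y + 1"
      if "s \<in> {0..T}" "y \<in> H_neg m" "H_neg_dist m (x s) y < 1" for s y
      using H.triangle[OF z that(2) cadlag_H_neg_in[OF x that(1)]] that(3) H.commute[of m y "x s"] by linarith
    have "H_neg_dist m z (x s) \<le> C" if "s \<in> {0..T}" "t - d2 < s" "s < t + d1" for s
    proof (cases "t \<le> s")
      case True
      then have "H_neg_dist m z (x s) \<le> H_neg_dist m z (x t) + 1"
        using that d1(2) by (intro near cadlag_H_neg_in[OF x t]) auto
      then show ?thesis by (simp add: C_def)
    next
      case False
      then have "H_neg_dist m z (x s) \<le> H_neg_dist m z l + 1"
        using that d2(3) by (intro near d2(2)) auto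
      then show ?thesis by (simp add: C_def)
    qed
    note bound = this
    show "\<exists>d>0. \<forall>a b. a \<le> t \<and> t \<le> b \<and> b - a < d \<longrightarrow> ?P a b"
    proof (rule exI[of _ "min d1 d2"], intro conjI allI impI)
      show "0 < min d1 d2" using d1(1) d2(1) by simp
      fix a b assume "a \<le> t \<and> t \<le> b \<and> b - a < min d1 d2"
      then show "?P a b" by (intro exI[of _ C] ballI bound) auto
    qed
  qed
  then show ?thesis by simp
qed

section \<open>Time changes under composition and inversion\<close>

lemma time_change_range:
  assumes "l \<in> time_changes T" "t \<in> {0..T}" shows "l t \<in> {0..T}"
proof -
  have m: "strict_mono_on {0..T} l" "l 0 = 0" "l T = T" using assms by (auto simp: time_changes_def)
  have "l 0 \<le> l t" "l t \<le> l T" using assms(2) by (auto intro!: strict_mono_on_leD[OF m(1)])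
  then show ?thesis using m by simp
qed

lemma time_change_id: "(\<lambda>t. t) \<in> time_changes T"
  by (auto simp: time_changes_def strict_mono_on_def intro: monotone_onI)

lemma time_change_comp:
  assumes "l \<in> time_changes T" "l' \<in> time_changes T"
  shows "(\<lambda>t. l (l' t)) \<in> time_changes T"
proof -
  have l: "continuous_on {0..T} l" "strict_mono_on {0..T} l" "l 0 = 0" "l T = T"
    and l': "continuous_on {0..T} l'" "strict_mono_on {0..T} l'" "l' 0 = 0" "l' T = T"
    using assms by (auto simp: time_changes_def)
  have r: "l' t \<in> {0..T}" if "t \<in> {0..T}" for t using time_change_range[OF assms(2) that] .
  have "continuous_on {0..T} (\<lambda>t. l (l' t))"
    by (rule continuous_on_compose2[OF l(1) l'(1)]) (use r in auto)
  moreover have "strict_mono_on {0..T} (\<lambda>t. l (l' t))"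
    by (rule monotone_onI) (intro strict_mono_onD[OF l(2)] strict_mono_onD[OF l'(2)] r)
  ultimately show ?thesis using l l' by (simp add: time_changes_def)
qed

text \<open>Surjectivity is the intermediate value theorem, continuity of the inverse is compactness
  of the interval. The inverse is what makes Skorokhod's distance symmetric.\<close>

lemma time_change_inverse:
  assumes l: "l \<in> time_changes T" and T: "0 \<le> T"
  shows "\<exists>k\<in>time_changes T. \<forall>t\<in>{0..T}. l (k t) = t \<and> k t \<in> {0..T}"
proof -
  have c: "continuous_on {0..T} l" and sm: "strict_mono_on {0..T} l" and e: "l 0 = 0" "l T = T"
    using l by (auto simp: time_changes_def)
  have inj: "inj_on l {0..T}" using sm by (rule strict_mono_on_imp_inj_on)
  have img: "l ` {0..T} = {0..T}"
  proof
    show "l ` {0..T} \<subseteq> {0..T}" using time_change_range[OF l] by blast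
    show "{0..T} \<subseteq> l ` {0..T}"
    proof
      fix y assume "y \<in> {0..T}"
      then obtain x where "0 \<le> x" "x \<le> T" "l x = y"
        using IVT'[of l 0 y T] e T c by auto
      then show "y \<in> l ` {0..T}" by auto
    qed
  qed
  define k where "k = inv_into {0..T} l"
  have lk: "l (k t) = t" and kr: "k t \<in> {0..T}" if "t \<in> {0..T}" for t
    using that f_inv_into_f[of t l "{0..T}"] inv_into_into[of t l "{0..T}"] img by (auto simp: k_def)
  have kl: "k (l t) = t" if "t \<in> {0..T}" for t using inj that by (simp add: k_def)
  have "continuous_on (l ` {0..T}) k" by (rule continuous_on_inv[OF c]) (use kl in auto)
  moreover have "strict_mono_on {0..T} k"
  proof (rule monotone_onI)
    fix s t assume st: "s \<in> {0..T}" "t \<in> {0..T}" "s < t"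
    show "k s < k t"
    proof (rule ccontr)
      assume "\<not> k s < k t"
      then have "l (k t) \<le> l (k s)" using st by (intro strict_mono_on_leD[OF sm] kr) auto
      then show False using st lk by simp
    qed
  qed
  moreover have "k 0 = 0" "k T = T" using kl[of 0] kl[of T] T e by auto
  ultimately have "k \<in> time_changes T" unfolding img by (simp add: time_changes_def)
  then show ?thesis using lk kr by blast
qed

text \<open>Membership in the set whose infimum is \<open>skorokhod_dist\<close>. Arguing with
  members avoids asking whether the infimum is attained.\<close>

definition skor_close ::
  "real \<Rightarrow> nat \<Rightarrow> (real \<Rightarrow> (real \<Rightarrow> real) \<Rightarrow> real) \<Rightarrow> (real \<Rightarrow> (real \<Rightarrow> real) \<Rightarrow> real) \<Rightarrow> real \<Rightarrow> bool" where
  "skor_close T m x y e \<longleftrightarrow>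
     (\<exists>l\<in>time_changes T. \<forall>t\<in>{0..T}. \<bar>l t - t\<bar> \<le> e \<and> H_neg_dist m (x (l t)) (y t) \<le> e)"

lemma D_space_cadlag: "x \<in> D_space T m \<Longrightarrow> cadlag (H_neg_topology m) {0..T} x"
  by (simp add: D_space_def)

lemma D_space_in: "x \<in> D_space T m \<Longrightarrow> t \<in> {0..T} \<Longrightarrow> x t \<in> H_neg m"
  by (rule cadlag_H_neg_in[OF D_space_cadlag])

lemma skor_close_nonneg: "skor_close T m x y e \<Longrightarrow> 0 \<le> T \<Longrightarrow> 0 \<le> e"
  unfolding skor_close_def by (metis abs_ge_zero atLeastAtMost_iff order_refl order_trans)

lemma skor_close_exists:
  assumes "x \<in> D_space T m" "y \<in> D_space T m" "0 \<le> T"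
  shows "\<exists>e. skor_close T m x y e"
proof -
  have x0: "x 0 \<in> H_neg m" using assms by (intro D_space_in) auto
  obtain C where C: "\<forall>t\<in>{0..T}. H_neg_dist m (x 0) (x t) \<le> C"
    using cadlag_bounded[OF D_space_cadlag[OF assms(1)] assms(3) x0] by blast
  obtain D where D: "\<forall>t\<in>{0..T}. H_neg_dist m (x 0) (y t) \<le> D"
    using cadlag_bounded[OF D_space_cadlag[OF assms(2)] assms(3) x0] by blast
  have "H_neg_dist m (x t) (y t) \<le> C + D" if "t \<in> {0..T}" for t
    using H.triangle[OF D_space_in[OF assms(1) that] x0 D_space_in[OF assms(2) that]]
      H.commute[of m "x t" "x 0"] C D that by fastforce
  moreover have "0 \<le> C + D"
    using calculation[of 0] H.nonneg[of m "x 0" "y 0"] assms(3) by (intro order_trans[OF H.nonneg]) auto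
  ultimately have "skor_close T m x y (C + D)"
    unfolding skor_close_def by (intro bexI[OF _ time_change_id]) simp
  then show ?thesis by blast
qed

lemma skor_close_sym:
  assumes "skor_close T m x y e" "0 \<le> T" shows "skor_close T m y x e"
proof -
  obtain l where l: "l \<in> time_changes T" "\<And>t. t \<in> {0..T} \<Longrightarrow> \<bar>l t - t\<bar> \<le> e"
      "\<And>t. t \<in> {0..T} \<Longrightarrow> H_neg_dist m (x (l t)) (y t) \<le> e"
    using assms by (auto simp: skor_close_def)
  obtain k where k: "k \<in> time_changes T" "\<And>t. t \<in> {0..T} \<Longrightarrow> l (k t) = t" "\<And>t. t \<in> {0..T} \<Longrightarrow> k t \<in> {0..T}"
    using time_change_inverse[OF l(1) assms(2)] by blast
  have "\<bar>k t - t\<bar> \<le> e \<and> H_neg_dist m (y (k t)) (x t) \<le> e" if t: "t \<in> {0..T}" for t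
    using l(2)[OF k(3)[OF t]] l(3)[OF k(3)[OF t]] k(2)[OF t] H.commute[of m "y (k t)" "x t"]
    by (simp add: abs_minus_commute)
  then show ?thesis using k(1) unfolding skor_close_def by (intro bexI[of _ k]) auto
qed

lemma skor_close_trans:
  assumes "x \<in> D_space T m" "y \<in> D_space T m" "z \<in> D_space T m"
    and "skor_close T m x y e" "skor_close T m y z f"
  shows "skor_close T m x z (e + f)"
proof -
  obtain l where l: "l \<in> time_changes T" "\<And>t. t \<in> {0..T} \<Longrightarrow> \<bar>l t - t\<bar> \<le> e"
      "\<And>t. t \<in> {0..T} \<Longrightarrow> H_neg_dist m (x (l t)) (y t) \<le> e"
    using assms by (auto simp: skor_close_def)
  obtain k where k: "k \<in> time_changes T" "\<And>t. t \<in> {0..T} \<Longrightarrow> \<bar>k t - t\<bar> \<le> f"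
      "\<And>t. t \<in> {0..T} \<Longrightarrow> H_neg_dist m (y (k t)) (z t) \<le> f"
    using assms by (auto simp: skor_close_def)
  have "\<bar>l (k t) - t\<bar> \<le> e + f \<and> H_neg_dist m (x (l (k t))) (z t) \<le> e + f" if t: "t \<in> {0..T}" for t
  proof
    have kt: "k t \<in> {0..T}" by (rule time_change_range[OF k(1) t])
    have lkt: "l (k t) \<in> {0..T}" by (rule time_change_range[OF l(1) kt])
    show "\<bar>l (k t) - t\<bar> \<le> e + f" using l(2)[OF kt] k(2)[OF t] by linarith
    show "H_neg_dist m (x (l (k t))) (z t) \<le> e + f"
      using H.triangle[OF D_space_in[OF assms(1) lkt] D_space_in[OF assms(2) kt] D_space_in[OF assms(3) t]]
        l(3)[OF kt] k(3)[OF t] by linarith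
  qed
  then show ?thesis unfolding skor_close_def by (intro bexI[OF _ time_change_comp[OF l(1) k(1)]]) auto
qed

text \<open>A time change fixes \<open>T\<close>, which settles the right end point. At an earlier
  \<open>t\<close> the paths are compared at \<open>s = t + \<delta> / 2\<close>: a displacement of
  at most \<open>\<delta> / 4\<close> keeps \<open>l s\<close> to the right of \<open>t\<close>, so
  right continuity of both paths leads back to \<open>t\<close>.\<close>

lemma skor_close_eq:
  assumes x: "x \<in> D_space T m" and y: "y \<in> D_space T m" and close: "\<And>e. e > 0 \<Longrightarrow> skor_close T m x y e"
  shows "x = y"
proof (rule extensionalityI)
  show "x \<in> extensional {0..T}" "y \<in> extensional {0..T}" using x y by (auto simp: D_space_def)
  fix t assume t: "t \<in> {0..T}"
  show "x t = y t"
  proof (rule ccontr)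
    assume "x t \<noteq> y t"
    define \<eta> where "\<eta> = H_neg_dist m (x t) (y t)"
    have \<eta>: "\<eta> > 0" using \<open>x t \<noteq> y t\<close> D_space_in[OF x t] D_space_in[OF y t]
      unfolding \<eta>_def by (metis H.nonneg H.zero less_eq_real_def)
    show False
    proof (cases "t = T")
      case True
      obtain l where l: "l \<in> time_changes T" "\<And>t. t \<in> {0..T} \<Longrightarrow> H_neg_dist m (x (l t)) (y t) \<le> \<eta> / 2"
        using close[of "\<eta> / 2"] \<eta> by (auto simp: skor_close_def)
      have "l t = t" using l(1) True by (simp add: time_changes_def)
      then show False using l(2)[OF t] \<eta> by (simp add: \<eta>_def)
    next
      case False
      have \<eta>3: "\<eta> / 3 > 0" using \<eta> by simp
      obtain d1 where d1: "d1 > 0" "\<forall>s\<in>{0..T}. t \<le> s \<and> s < t + d1 \<longrightarrow> H_neg_dist m (x s) (x t) < \<eta> / 3"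
        using cadlag_H_neg_right[OF D_space_cadlag[OF x] t \<eta>3] by blast
      obtain d2 where d2: "d2 > 0" "\<forall>s\<in>{0..T}. t \<le> s \<and> s < t + d2 \<longrightarrow> H_neg_dist m (y s) (y t) < \<eta> / 3"
        using cadlag_H_neg_right[OF D_space_cadlag[OF y] t \<eta>3] by blast
      define \<delta> where "\<delta> = min (min d1 d2) (T - t)"
      have \<delta>: "\<delta> > 0" "\<delta> \<le> d1" "\<delta> \<le> d2" "t + \<delta> \<le> T" using d1 d2 False t by (auto simp: \<delta>_def)
      define s where "s = t + \<delta> / 2"
      have s: "s \<in> {0..T}" using \<delta> t by (auto simp: s_def)
      define e where "e = min (\<delta> / 4) (\<eta> / 3)"
      obtain l where l: "l \<in> time_changes T" "\<bar>l s - s\<bar> \<le> e" "H_neg_dist m (x (l s)) (y s) \<le> e"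
        using close[of e] \<eta> \<delta> s by (auto simp: skor_close_def e_def)
      have e: "e \<le> \<delta> / 4" "e \<le> \<eta> / 3" by (auto simp: e_def)
      have ls: "l s \<in> {0..T}" by (rule time_change_range[OF l(1) s])
      have "t \<le> l s" "l s < t + d1" using l(2) e \<delta> by (auto simp: s_def)
      then have 1: "H_neg_dist m (x (l s)) (x t) < \<eta> / 3" using d1(2) ls by blast
      have 2: "H_neg_dist m (y s) (y t) < \<eta> / 3"
      proof -
        have "t \<le> s" "s < t + d2" using \<delta> by (auto simp: s_def)
        then show ?thesis using d2(2) s by blast
      qed
      have "\<eta> \<le> H_neg_dist m (x t) (x (l s)) + H_neg_dist m (x (l s)) (y t)"
        unfolding \<eta>_def by (intro H.triangle D_space_in[OF x] D_space_in[OF y] t ls)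
      also have "H_neg_dist m (x (l s)) (y t) \<le> H_neg_dist m (x (l s)) (y s) + H_neg_dist m (y s) (y t)"
        by (intro H.triangle D_space_in[OF x] D_space_in[OF y] t s ls)
      finally show False using 1 2 l(3) e(2) H.commute[of m "x t" "x (l s)"] by linarith
    qed
  qed
qed

lemma skorokhod_dist_le:
  assumes "x \<in> D_space T m" "y \<in> D_space T m" "0 \<le> T" "skor_close T m x y e"
  shows "skorokhod_dist T m x y \<le> e"
  using assms(1,2,4) unfolding skorokhod_dist_def skor_close_def[symmetric]
  by (auto intro!: cInf_lower bdd_belowI[of _ 0] dest: skor_close_nonneg[OF _ assms(3)])

lemma skorokhod_dist_less:
  assumes "x \<in> D_space T m" "y \<in> D_space T m" "0 \<le> T" "skorokhod_dist T m x y < r"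
  obtains e where "skor_close T m x y e" "e < r"
proof -
  have "\<exists>e\<in>{e. skor_close T m x y e}. e < r"
    using assms skor_close_exists[OF assms(1-3)]
    by (intro cInf_lessD) (auto simp: skorokhod_dist_def skor_close_def)
  then show ?thesis using that by blast
qed

lemma skorokhod_dist_nonneg: "0 \<le> T \<Longrightarrow> 0 \<le> skorokhod_dist T m x y"
proof (cases "x \<in> D_space T m \<and> y \<in> D_space T m")
  case True
  assume T: "0 \<le> T"
  have "0 \<le> Inf {e. skor_close T m x y e}"
    using skor_close_exists[of x T m y] True T by (intro cInf_greatest) (auto dest: skor_close_nonneg)
  then show ?thesis using True unfolding skorokhod_dist_def skor_close_def[symmetric] by simp
qed (auto simp: skorokhod_dist_def)

lemma Metric_space_skorokhod:
  assumes T: "0 \<le> T" shows "Metric_space (D_space T m) (skorokhod_dist T m)"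
proof
  show "0 \<le> skorokhod_dist T m x y" for x y by (rule skorokhod_dist_nonneg[OF T])
  show "skorokhod_dist T m x y = skorokhod_dist T m y x" for x y
  proof -
    have "skor_close T m x y = skor_close T m y x"
      by (intro ext iffI) (rule skor_close_sym[OF _ T], assumption)+
    then show ?thesis unfolding skorokhod_dist_def skor_close_def[symmetric] by simp
  qed
next
  fix x y assume x: "x \<in> D_space T m" and y: "y \<in> D_space T m"
  show "skorokhod_dist T m x y = 0 \<longleftrightarrow> x = y"
  proof
    assume 0: "skorokhod_dist T m x y = 0"
    show "x = y"
    proof (rule skor_close_eq[OF x y])
      fix e :: real assume "e > 0"
      then obtain f where f: "skor_close T m x y f" "f < e"
        using skorokhod_dist_less[OF x y T, of e] 0 by auto
      then show "skor_close T m x y e" unfolding skor_close_def by (meson less_imp_le order_trans)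
    qed
  next
    assume "x = y"
    have "skor_close T m x x 0"
      unfolding skor_close_def using D_space_in[OF x] by (intro bexI[OF _ time_change_id]) auto
    then have "skorokhod_dist T m x x \<le> 0" by (rule skorokhod_dist_le[OF x x T])
    then show "skorokhod_dist T m x y = 0" using skorokhod_dist_nonneg[OF T, of m x x] \<open>x = y\<close> by simp
  qed
next
  fix x y z assume x: "x \<in> D_space T m" and y: "y \<in> D_space T m" and z: "z \<in> D_space T m"
  show "skorokhod_dist T m x z \<le> skorokhod_dist T m x y + skorokhod_dist T m y z"
  proof (rule field_le_epsilon)
    fix e :: real assume e: "e > 0"
    obtain f where f: "skor_close T m x y f" "f < skorokhod_dist T m x y + e / 2"
      using skorokhod_dist_less[OF x y T, of "skorokhod_dist T m x y + e / 2"] e by auto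
    obtain g where g: "skor_close T m y z g" "g < skorokhod_dist T m y z + e / 2"
      using skorokhod_dist_less[OF y z T, of "skorokhod_dist T m y z + e / 2"] e by auto
    have "skorokhod_dist T m x z \<le> f + g"
      by (intro skorokhod_dist_le x z T skor_close_trans[OF x y z f(1) g(1)])
    then show "skorokhod_dist T m x z \<le> skorokhod_dist T m x y + skorokhod_dist T m y z + e"
      using f g by linarith
  qed
qed

lemma skorokhod_dist_le_sup:
  assumes "x \<in> D_space T m" "y \<in> D_space T m" "0 \<le> T" "0 \<le> e"
    and "\<And>t. t \<in> {0..T} \<Longrightarrow> H_neg_dist m (x t) (y t) \<le> e"
  shows "skorokhod_dist T m x y \<le> e"
  using assms by (intro skorokhod_dist_le) (auto simp: skor_close_def intro!: bexI[OF _ time_change_id])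

section \<open>Measurability of finite-state paths\<close>

lemma cadlag_discrete_right:
  assumes "cadlag (discrete_topology S) I y" "t \<in> I"
  shows "\<exists>\<delta>>0. \<forall>s\<in>I. t \<le> s \<and> s < t + \<delta> \<longrightarrow> y s = y t"
proof -
  have "limitin (discrete_topology S) y (y t) (at t within (I \<inter> {t<..}))" "y t \<in> S"
    using assms by (auto simp: cadlag_def)
  then have "eventually (\<lambda>s. y s \<in> {y t}) (at t within (I \<inter> {t<..}))"
    unfolding limitin_def by (metis empty_subsetI insert_subset openin_discrete_topology singletonI)
  then obtain \<delta> where d: "\<delta> > 0" "\<forall>s\<in>I \<inter> {t<..}. s \<noteq> t \<and> dist s t < \<delta> \<longrightarrow> y s \<in> {y t}"
    unfolding eventually_at by blast
  show ?thesis
  proof (intro exI[of _ \<delta>] conjI d(1) ballI impI)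
    fix s assume "s \<in> I" "t \<le> s \<and> s < t + \<delta>"
    then show "y s = y t" using d(2) by (cases "s = t") (auto simp: dist_real_def)
  qed
qed

lemma cadlag_discrete_left:
  assumes "cadlag (discrete_topology S) I y" "t \<in> I"
  shows "\<exists>\<delta>>0. \<exists>l. \<forall>s\<in>I. s < t \<and> t - \<delta> < s \<longrightarrow> y s = l"
proof -
  obtain l where "limitin (discrete_topology S) y l (at t within (I \<inter> {..<t}))"
    using assms by (auto simp: cadlag_def)
  then have "eventually (\<lambda>s. y s \<in> {l}) (at t within (I \<inter> {..<t}))"
    unfolding limitin_def topspace_discrete_topology
    by (metis empty_subsetI insert_subset openin_discrete_topology singletonI)
  then obtain \<delta> where d: "\<delta> > 0" "\<forall>s\<in>I \<inter> {..<t}. s \<noteq> t \<and> dist s t < \<delta> \<longrightarrow> y s \<in> {l}"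
    unfolding eventually_at by blast
  show ?thesis
    using d by (intro exI[of _ \<delta>] conjI exI[of _ l]) (auto simp: dist_real_def)
qed

lemma cadlag_discreteI:
  assumes "\<And>t. t \<in> I \<Longrightarrow> y t \<in> S"
    and right: "\<And>t. t \<in> I \<Longrightarrow> \<exists>\<delta>>0. \<forall>s\<in>I. t < s \<and> s < t + \<delta> \<longrightarrow> y s = y t"
    and left: "\<And>t. t \<in> I \<Longrightarrow> \<exists>\<delta>>0. \<exists>l\<in>S. \<forall>s\<in>I. t - \<delta> < s \<and> s < t \<longrightarrow> y s = l"
  shows "cadlag (discrete_topology S) I y"
proof -
  have lim: "limitin (discrete_topology S) y l F" if "l \<in> S" "eventually (\<lambda>s. y s = l) F" for l F
    unfolding limitin_def using that by (auto elim: eventually_mono)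
  show ?thesis unfolding cadlag_def topspace_discrete_topology
  proof (intro ballI conjI)
    fix t assume t: "t \<in> I"
    obtain \<delta> where "\<delta> > 0" "\<forall>s\<in>I. t < s \<and> s < t + \<delta> \<longrightarrow> y s = y t" using right[OF t] by blast
    then have "eventually (\<lambda>s. y s = y t) (at t within (I \<inter> {t<..}))"
      unfolding eventually_at by (intro exI[of _ \<delta>]) (auto simp: dist_real_def)
    then show "limitin (discrete_topology S) y (y t) (at t within (I \<inter> {t<..}))"
      by (intro lim assms(1) t)
    obtain \<delta> l where l: "\<delta> > 0" "l \<in> S" "\<forall>s\<in>I. t - \<delta> < s \<and> s < t \<longrightarrow> y s = l" using left[OF t] by blast
    then have "eventually (\<lambda>s. y s = l) (at t within (I \<inter> {..<t}))"
      unfolding eventually_at by (intro exI[of _ \<delta>]) (auto simp: dist_real_def)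
    then show "\<exists>l. limitin (discrete_topology S) y l (at t within (I \<inter> {..<t}))"
      using lim[OF l(2)] by blast
    show "y t \<in> S" by (rule assms(1)[OF t])
  qed
qed

text \<open>A left value in \<open>S\<close> is wanted even when no time of \<open>I\<close>
  precedes \<open>t\<close> nearby; then any state serves and \<open>y t\<close> is taken.\<close>

lemma cadlag_discrete_left_in:
  assumes "cadlag (discrete_topology S) I y" "t \<in> I"
  shows "\<exists>\<delta>>0. \<exists>l\<in>S. \<forall>s\<in>I. t - \<delta> < s \<and> s < t \<longrightarrow> y s = l"
proof -
  obtain \<delta> l where l: "\<delta> > 0" "\<And>s. s \<in> I \<Longrightarrow> s < t \<Longrightarrow> t - \<delta> < s \<Longrightarrow> y s = l"
    using cadlag_discrete_left[OF assms] by blast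
  have yS: "y s \<in> S" if "s \<in> I" for s using assms that by (simp add: cadlag_def)
  show ?thesis
  proof (cases "\<exists>s\<in>I. t - \<delta> < s \<and> s < t")
    case True
    then have "l \<in> S" using l(2) yS by blast
    then show ?thesis using l by blast
  next
    case False
    then show ?thesis using l(1) yS[OF assms(2)] by blast
  qed
qed

lemma cadlag_discrete_map:
  assumes y: "cadlag (discrete_topology S) I y" and e: "\<And>s. s \<in> S \<Longrightarrow> e s \<in> R"
  shows "cadlag (discrete_topology R) I (\<lambda>t. e (y t))"
proof (rule cadlag_discreteI)
  fix t assume t: "t \<in> I"
  show "e (y t) \<in> R" using y t e by (simp add: cadlag_def)
  obtain \<delta> where "\<delta> > 0" "\<And>s. s \<in> I \<Longrightarrow> t \<le> s \<Longrightarrow> s < t + \<delta> \<Longrightarrow> y s = y t"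
    using cadlag_discrete_right[OF y t] by blast
  then show "\<exists>\<delta>>0. \<forall>s\<in>I. t < s \<and> s < t + \<delta> \<longrightarrow> e (y s) = e (y t)"
    by (intro exI[of _ \<delta>]) auto
  obtain \<delta> l where l: "\<delta> > 0" "l \<in> S" "\<forall>s\<in>I. t - \<delta> < s \<and> s < t \<longrightarrow> y s = l"
    using cadlag_discrete_left_in[OF y t] by blast
  show "\<exists>\<delta>>0. \<exists>l\<in>R. \<forall>s\<in>I. t - \<delta> < s \<and> s < t \<longrightarrow> e (y s) = l"
    by (rule exI[of _ \<delta>], intro conjI l(1) bexI[of _ "e l"] e l(2)) (use l(3) in auto)
qed

text \<open>A limit in the discrete topology means that the path is eventually constant, and this
  gives a limit in any topology on the same set.\<close>

lemma cadlag_discrete_H_neg: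
  assumes y: "cadlag (discrete_topology (H_neg m)) {0..T} y"
  shows "restrict y {0..T} \<in> D_space T m"
proof -
  have lim: "limitin (H_neg_topology m) (restrict y {0..T}) l (at t within ({0..T} \<inter> A))"
    if "limitin (discrete_topology (H_neg m)) y l (at t within ({0..T} \<inter> A))" for l t A
  proof -
    have ev: "eventually (\<lambda>s. s \<in> {0..T} \<inter> A) (at t within ({0..T} \<inter> A))"
      by (simp add: eventually_at_filter)
    have "eventually (\<lambda>s. y s \<in> {l}) (at t within ({0..T} \<inter> A))" "l \<in> H_neg m"
      using that unfolding limitin_def topspace_discrete_topology
      by (metis empty_subsetI insert_subset openin_discrete_topology singletonI)+
    then have "eventually (\<lambda>s. restrict y {0..T} s = l) (at t within ({0..T} \<inter> A))"
      using ev by (auto elim: eventually_elim2)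
    with \<open>l \<in> H_neg m\<close> show ?thesis
      unfolding limitin_def H_neg_topology_def H.topspace_mtopology by (auto elim: eventually_mono)
  qed
  show ?thesis
    using y unfolding D_space_def cadlag_def
    by (auto simp: H_neg_topology_def H.topspace_mtopology intro!: lim[unfolded H_neg_topology_def])
qed

section \<open>Approximating a finite-state path by its values on a grid\<close>

definition grid_floor :: "real \<Rightarrow> real \<Rightarrow> real" where
  "grid_floor c t = of_int \<lfloor>t * c\<rfloor> / c"

definition grid_ceil :: "real \<Rightarrow> real \<Rightarrow> real" where
  "grid_ceil c t = of_int \<lceil>t * c\<rceil> / c"

lemma grid_ceil_bounds: "c > 0 \<Longrightarrow> t \<le> grid_ceil c t" "c > 0 \<Longrightarrow> grid_ceil c t < t + 1 / c"
  unfolding grid_ceil_def by (simp_all add: field_simps) linarith+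

text \<open>The discretised path shows at time \<open>s\<close> the value at
  \<open>grid_floor c s\<close>. Between the two rounded-up end points it therefore shows only
  values taken in \<open>{a..<b}\<close>.\<close>

lemma grid_floor_between:
  assumes c: "c > 0" and s: "grid_ceil c a \<le> s" "s < grid_ceil c b"
  shows "a \<le> grid_floor c s" "grid_floor c s < b"
proof -
  have "of_int \<lceil>a * c\<rceil> \<le> s * c" "s * c < of_int \<lceil>b * c\<rceil>"
    using s c by (simp_all add: grid_ceil_def field_simps)
  then have "\<lceil>a * c\<rceil> \<le> \<lfloor>s * c\<rfloor>" "\<lfloor>s * c\<rfloor> < \<lceil>b * c\<rceil>" by linarith+
  then have "a * c \<le> of_int \<lfloor>s * c\<rfloor>" "of_int \<lfloor>s * c\<rfloor> < b * c" by linarith+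
  then show "a \<le> grid_floor c s" "grid_floor c s < b" using c by (simp_all add: grid_floor_def field_simps)
qed

text \<open>A jump of \<open>y\<close> at time \<open>s\<close> shows up at time \<open>grid_ceil c s\<close> in the discretised path.  A time change
  between the two paths is glued from affine pieces that send \<open>[a, b]\<close> to \<open>[grid_ceil c a, grid_ceil c b]\<close>.\<close>

definition grid_matched :: "(real \<Rightarrow> 's) \<Rightarrow> real \<Rightarrow> real \<Rightarrow> real \<Rightarrow> bool" where
  "grid_matched y c a b \<longleftrightarrow> (\<exists>l. continuous_on {a..b} l \<and> strict_mono_on {a..b} l \<and>
     l a = grid_ceil c a \<and> l b = grid_ceil c b \<and> (\<forall>t\<in>{a..b}. \<bar>l t - t\<bar> \<le> 1 / c) \<and>
     (\<forall>t\<in>{a..<b}. y (grid_floor c (l t)) = y t))"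

text \<open>The mesh \<open>1 / c\<close> is below the length of the interval, so the rounded end
  points keep their order and the affine map is increasing. Its displacement is a convex combination
  of those at the two ends, hence at most \<open>1 / c\<close>.\<close>

lemma grid_matched_const:
  assumes c: "c > 0" and ab: "1 / c < b - a" and const: "\<And>t. t \<in> {a..<b} \<Longrightarrow> y t = v"
  shows "grid_matched y c a b"
proof -
  have ab': "a < b" using c ab by (smt (verit) divide_nonneg_pos)
  define A B where "A = grid_ceil c a" and "B = grid_ceil c b"
  have A: "a \<le> A" "A < a + 1 / c" and B: "b \<le> B" "B < b + 1 / c"
    unfolding A_def B_def using grid_ceil_bounds[OF c] by auto
  have AB: "A < B" using A B ab by linarith
  define l where "l t = A + (t - a) / (b - a) * (B - A)" for t
  have sm: "l s < l t" if "s < t" for s t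
    unfolding l_def using that ab' AB by (intro add_strict_left_mono mult_strict_right_mono divide_strict_right_mono) auto
  have la: "l a = A" and lb: "l b = B" using ab' by (auto simp: l_def)
  have near: "\<bar>l t - t\<bar> \<le> 1 / c" if t: "t \<in> {a..b}" for t
  proof -
    define q where "q = (t - a) / (b - a)"
    have q: "0 \<le> q" "q \<le> 1" using t ab' by (auto simp: q_def)
    have "t = a + q * (b - a)" using ab' by (simp add: q_def)
    moreover have "l t = A + q * (B - A)" by (simp add: l_def q_def)
    ultimately have "l t - t = (1 - q) * (A - a) + q * (B - b)" by (simp add: algebra_simps)
    moreover have "(1 - q) * (A - a) + q * (B - b) \<le> (1 - q) * (1 / c) + q * (1 / c)"
      using q A B by (intro add_mono mult_left_mono) auto
    moreover have "0 \<le> (1 - q) * (A - a) + q * (B - b)" using q A B by simp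
    moreover have "(1 - q) * (1 / c) + q * (1 / c) = 1 / c" by (simp flip: add_divide_distrib)
    ultimately show ?thesis by linarith
  qed
  have match: "y (grid_floor c (l t)) = y t" if t: "t \<in> {a..<b}" for t
  proof -
    have "A \<le> l t" using sm[of a t] la t by (cases "a = t") auto
    moreover have "l t < B" using sm[of t b] lb t by auto
    ultimately have "grid_floor c (l t) \<in> {a..<b}"
      using grid_floor_between[OF c, of a "l t" b] by (auto simp: A_def B_def)
    then show ?thesis using const t by simp
  qed
  have "continuous_on {a..b} l" unfolding l_def using ab' by (intro continuous_intros) auto
  moreover have "strict_mono_on {a..b} l" using sm by (intro monotone_onI)
  ultimately show ?thesis
    unfolding grid_matched_def using la lb near match by (intro exI[of _ l]) (auto simp: A_def B_def)
qed

lemma grid_matched_trans: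
  assumes ab: "a < b" "grid_matched y c a b" and bc: "b < d" "grid_matched y c b d"
  shows "grid_matched y c a d"
proof -
  obtain l where l: "continuous_on {a..b} l" "strict_mono_on {a..b} l" "l a = grid_ceil c a" "l b = grid_ceil c b"
    "\<And>t. t \<in> {a..b} \<Longrightarrow> \<bar>l t - t\<bar> \<le> 1 / c" "\<And>t. t \<in> {a..<b} \<Longrightarrow> y (grid_floor c (l t)) = y t"
    using ab(2) unfolding grid_matched_def by blast
  obtain k where k: "continuous_on {b..d} k" "strict_mono_on {b..d} k" "k b = grid_ceil c b" "k d = grid_ceil c d"
    "\<And>t. t \<in> {b..d} \<Longrightarrow> \<bar>k t - t\<bar> \<le> 1 / c" "\<And>t. t \<in> {b..<d} \<Longrightarrow> y (grid_floor c (k t)) = y t"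
    using bc(2) unfolding grid_matched_def by blast
  define h where "h t = (if t \<le> b then l t else k t)" for t
  have "continuous_on ({a..b} \<union> {b..d}) h"
    unfolding h_def using l k by (intro continuous_on_If) auto
  moreover have "{a..b} \<union> {b..d} = {a..d}" using ab bc by auto
  ultimately have cont: "continuous_on {a..d} h" by simp
  have sm: "strict_mono_on {a..d} h"
  proof (rule monotone_onI)
    fix s t assume st: "s \<in> {a..d}" "t \<in> {a..d}" "s < t"
    consider "t \<le> b" | "s \<le> b" "b < t" | "b < s" using st by linarith
    then show "h s < h t"
    proof cases
      case 1
      then show ?thesis using st strict_mono_onD[OF l(2), of s t] by (simp add: h_def)
    next
      case 2
      have "l s \<le> l b" using 2 st by (intro strict_mono_on_leD[OF l(2)]) auto
      moreover have "k b < k t" using 2 st by (intro strict_mono_onD[OF k(2)]) auto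
      ultimately show ?thesis using 2 l k by (simp add: h_def)
    next
      case 3
      then show ?thesis using st strict_mono_onD[OF k(2), of s t] by (simp add: h_def)
    qed
  qed
  have "h a = grid_ceil c a" "h d = grid_ceil c d" using ab bc l k by (auto simp: h_def)
  moreover have "\<bar>h t - t\<bar> \<le> 1 / c" if "t \<in> {a..d}" for t
    using that l(5)[of t] k(5)[of t] by (auto simp: h_def)
  moreover have "y (grid_floor c (h t)) = y t" if "t \<in> {a..<d}" for t
    using that l(6)[of t] k(6)[of t] l(4) k(3) bc(1) k(6)[of b] by (cases "t < b") (auto simp: h_def)
  ultimately show ?thesis unfolding grid_matched_def using cont sm by (intro exI[of _ h]) blast
qed

text \<open>Each time has a neighbourhood on which the path takes one value before it and one value
  from it on. At most two affine pieces match such a neighbourhood, and bisection assembles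
  \<open>{0..T}\<close>.\<close>

lemma grid_matched_eventually:
  assumes y: "cadlag (discrete_topology S) {0..T} y" and T: "T > 0"
  shows "eventually (\<lambda>c. grid_matched y c 0 T) at_top"
proof -
  let ?P = "\<lambda>a b. 0 \<le> a \<and> a < b \<and> b \<le> T \<longrightarrow> eventually (\<lambda>c. grid_matched y c a b) at_top"
  have const: "eventually (\<lambda>c. grid_matched y c a b) at_top"
    if "a < b" "\<And>t. t \<in> {a..<b} \<Longrightarrow> y t = v" for a b v
    using eventually_gt_at_top[of "max 0 (1 / (b - a))"]
  proof eventually_elim
    case (elim c)
    then have "c > 0" "1 / (b - a) < c" by auto
    then have "1 / c < b - a" using that(1) by (simp add: field_simps)
    with \<open>c > 0\<close> show ?case using that(2) by (rule grid_matched_const)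
  qed
  have "?P 0 T"
  proof (rule Bolzano[of 0 T ?P])
    show "0 \<le> T" using T by simp
  next
    fix a b c assume trans: "?P a b" "?P b c" "a \<le> b" "b \<le> c"
    show "?P a c"
    proof (intro impI)
      assume abc: "0 \<le> a \<and> a < c \<and> c \<le> T"
      consider "a = b" | "b = c" | "a < b" "b < c" using trans(3,4) by linarith
      then show "eventually (\<lambda>r. grid_matched y r a c) at_top"
      proof cases
        case 3
        then have "eventually (\<lambda>r. grid_matched y r a b) at_top" "eventually (\<lambda>r. grid_matched y r b c) at_top"
          using trans abc by auto
        then show ?thesis by eventually_elim (rule grid_matched_trans[OF 3(1) _ 3(2)])
      qed (use trans abc in auto)
    qed
  next
    fix x assume "0 \<le> x" "x \<le> T"
    then have x: "x \<in> {0..T}" by simp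
    obtain d1 where d1: "d1 > 0" "\<And>s. s \<in> {0..T} \<Longrightarrow> x \<le> s \<Longrightarrow> s < x + d1 \<Longrightarrow> y s = y x"
      using cadlag_discrete_right[OF y x] by blast
    obtain d2 v where d2: "d2 > 0" "\<And>s. s \<in> {0..T} \<Longrightarrow> s < x \<Longrightarrow> x - d2 < s \<Longrightarrow> y s = v"
      using cadlag_discrete_left[OF y x] by blast
    show "\<exists>d>0. \<forall>a b. a \<le> x \<and> x \<le> b \<and> b - a < d \<longrightarrow> ?P a b"
    proof (intro exI[of _ "min d1 d2"] conjI allI impI)
      show "0 < min d1 d2" using d1 d2 by simp
      fix a b assume ab: "a \<le> x \<and> x \<le> b \<and> b - a < min d1 d2" and 0: "0 \<le> a \<and> a < b \<and> b \<le> T"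
      have L: "eventually (\<lambda>c. grid_matched y c a x) at_top" if "a < x"
        using ab 0 by (intro const[OF that, of v] d2(2)) auto
      have R: "eventually (\<lambda>c. grid_matched y c x b) at_top" if "x < b"
        using ab 0 by (intro const[OF that, of "y x"] d1(2)) auto
      show "eventually (\<lambda>c. grid_matched y c a b) at_top"
      proof (cases "a < x \<and> x < b")
        case True
        then show ?thesis using L R by (auto intro: grid_matched_trans elim: eventually_elim2)
      next
        case False
        then show ?thesis using L R ab 0 by (cases "a = x") auto
      qed
    qed
  qed
  then show ?thesis using T by simp
qed

text \<open>With \<open>N / T\<close> grid points per unit time both 0 and \<open>T\<close> lie on
  the grid, so the glued map fixes the end points and is a time change.\<close>

lemma grid_ends:
  assumes "N > 0" "T > 0"
  shows "grid_ceil (real N / T) 0 = 0" "grid_ceil (real N / T) T = T" "grid_floor (real N / T) T = T"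
  using assms by (simp_all add: grid_ceil_def grid_floor_def)

lemma grid_floor_range:
  assumes "N > 0" "T > 0" "t \<in> {0..T}"
  shows "grid_floor (real N / T) t = real (nat \<lfloor>t * (real N / T)\<rfloor>) * T / real N"
    "nat \<lfloor>t * (real N / T)\<rfloor> \<le> N"
proof -
  have "0 \<le> t * (real N / T)" using assms by simp
  then show "grid_floor (real N / T) t = real (nat \<lfloor>t * (real N / T)\<rfloor>) * T / real N"
    by (simp add: grid_floor_def)
  have "t * (real N / T) \<le> T * (real N / T)" using assms by (intro mult_right_mono) auto
  also have "\<dots> = real N" using assms by simp
  finally have "t * (real N / T) \<le> real N" .
  then show "nat \<lfloor>t * (real N / T)\<rfloor> \<le> N" by linarith
qed

lemma grid_path_cadlag:
  assumes v: "\<And>i. i \<le> N \<Longrightarrow> v i \<in> S" and N: "N > 0" and T: "T > 0"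
  shows "cadlag (discrete_topology S) {0..T} (\<lambda>t. v (nat \<lfloor>t * (real N / T)\<rfloor>))"
proof (rule cadlag_discreteI)
  define c where "c = real N / T"
  have c: "c > 0" using N T by (simp add: c_def)
  fix t assume t: "t \<in> {0..T}"
  show "v (nat \<lfloor>t * (real N / T)\<rfloor>) \<in> S" using grid_floor_range[OF N T t] by (intro v)
  have "\<lfloor>s * c\<rfloor> = \<lfloor>t * c\<rfloor>" if "t < s" "s < t + ((of_int \<lfloor>t * c\<rfloor> + 1) / c - t)" for s
  proof -
    have "t * c < s * c" "s * c < of_int \<lfloor>t * c\<rfloor> + 1" using that c by (simp_all add: field_simps)
    then show ?thesis by linarith
  qed
  moreover have "(of_int \<lfloor>t * c\<rfloor> + 1) / c - t > 0"
  proof -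
    have "t * c < of_int \<lfloor>t * c\<rfloor> + 1" by linarith
    then show ?thesis using c by (simp add: field_simps)
  qed
  ultimately show "\<exists>\<delta>>0. \<forall>s\<in>{0..T}. t < s \<and> s < t + \<delta> \<longrightarrow>
      v (nat \<lfloor>s * (real N / T)\<rfloor>) = v (nat \<lfloor>t * (real N / T)\<rfloor>)"
    unfolding c_def[symmetric] by (intro exI[of _ "(of_int \<lfloor>t * c\<rfloor> + 1) / c - t"]) auto
  \<comment> \<open>Distance back to the last grid point strictly before \<open>t\<close>; as
    \<open>t\<close> may itself be a grid point, this is ceiling minus one instead of floor. At
    \<open>t = 0\<close> the index is -1, which \<open>nat\<close> sends to 0, and no time of the
    interval falls into the window.\<close>
  define w where "w = t - (of_int \<lceil>t * c\<rceil> - 1) / c"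
  have w: "w > 0"
  proof -
    have "of_int \<lceil>t * c\<rceil> - 1 < t * c" by linarith
    then show ?thesis using c by (simp add: w_def field_simps)
  qed
  have left: "\<lfloor>s * c\<rfloor> = \<lceil>t * c\<rceil> - 1" if "t - w < s" "s < t" for s
  proof -
    have "s * c < t * c" "of_int \<lceil>t * c\<rceil> - 1 < s * c" using that c by (simp_all add: w_def field_simps)
    then show ?thesis by linarith
  qed
  have "nat (\<lceil>t * c\<rceil> - 1) \<le> N"
  proof -
    have "t * c \<le> T * c" using t c by (intro mult_right_mono) auto
    also have "\<dots> = real N" using T by (simp add: c_def)
    finally show ?thesis by linarith
  qed
  then show "\<exists>\<delta>>0. \<exists>l\<in>S. \<forall>s\<in>{0..T}. t - \<delta> < s \<and> s < t \<longrightarrow> v (nat \<lfloor>s * (real N / T)\<rfloor>) = l"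
    unfolding c_def[symmetric] using w left v
    by (intro exI[of _ w] conjI bexI[of _ "v (nat (\<lceil>t * c\<rceil> - 1))"]) auto
qed

text \<open>An element \<open>x\<close> of an open set \<open>U\<close> is characterised by balls around the discretised paths \<open>x\<^sub>N\<close>, which
  converge to \<open>x\<close> and take finitely many values.\<close>

lemma finite_state_path_measurable:
  fixes X :: "real \<Rightarrow> 'w \<Rightarrow> 's"
  assumes T: "T > 0" and S: "finite S"
    and X: "\<And>t. t \<in> {0..T} \<Longrightarrow> X t \<in> measurable M (count_space S)"
    and cad: "\<And>w. w \<in> space M \<Longrightarrow> cadlag (discrete_topology S) {0..T} (\<lambda>t. X t w)"
    and e: "\<And>s. s \<in> S \<Longrightarrow> e s \<in> H_neg m"
  shows "(\<lambda>w. restrict (\<lambda>t. e (X t w)) {0..T}) \<in> measurable M (borel_of (skorokhod_topology T m))"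
proof -
  have T0: "0 \<le> T" using T by simp
  interpret K: Metric_space "D_space T m" "skorokhod_dist T m" by (rule Metric_space_skorokhod[OF T0])
  \<comment> \<open>\<open>V N\<close> records the chain at the grid times and has finitely many
    values, so every event about it is measurable; \<open>q N\<close> rebuilds from it the step path
    that approximates \<open>p\<close>.\<close>
  define p where "p w = restrict (\<lambda>t. e (X t w)) {0..T}" for w
  define q where "q N v = restrict (\<lambda>t. e (v (nat \<lfloor>t * (real N / T)\<rfloor>))) {0..T}" for N :: nat and v :: "nat \<Rightarrow> 's"
  define V where "V N w = restrict (\<lambda>i. X (real i * T / real N) w) {..N}" for N w
  have pD: "p w \<in> D_space T m" if "w \<in> space M" for w
    unfolding p_def by (intro cadlag_discrete_H_neg cadlag_discrete_map[OF cad[OF that]] e)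
  have grid_in: "real i * T / real N \<in> {0..T}" if "i \<le> N" "N > 0" for i N
    using that T by (auto simp: field_simps)
  have V_in: "V N w \<in> PiE {..N} (\<lambda>_. S)" if "w \<in> space M" "N > 0" for N w
    unfolding V_def
  proof (intro restrict_PiE_iff[THEN iffD2] ballI)
    fix i assume "i \<in> {..N}"
    then show "X (real i * T / real N) w \<in> S"
      using measurable_space[OF X[OF grid_in] that(1), of i N] that(2) by simp
  qed
  have qD: "q N v \<in> D_space T m" if "v \<in> PiE {..N} (\<lambda>_. S)" "N > 0" for N v
    unfolding q_def using that T
    by (intro cadlag_discrete_H_neg grid_path_cadlag[of N "\<lambda>i. e (v i)"]) (auto intro: e)
  have Vm: "V N \<in> measurable M (count_space (PiE {..N} (\<lambda>_. S)))" if N: "N > 0" for N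
  proof (subst measurable_count_space_eq2)
    show "finite (PiE {..N} (\<lambda>_. S))" by (intro finite_PiE) (use S in auto)
    have "V N -` {a} \<inter> space M = (\<Inter>i\<in>{..N}. (X (real i * T / real N) -` {a i} \<inter> space M))"
      if "a \<in> PiE {..N} (\<lambda>_. S)" for a
      using that by (auto simp: V_def PiE_def intro!: extensionalityI[of _ "{..N}"])
    moreover have "(\<Inter>i\<in>{..N}. (X (real i * T / real N) -` {a i} \<inter> space M)) \<in> sets M"
      if "a \<in> PiE {..N} (\<lambda>_. S)" for a
      using that N by (intro sets.finite_INT measurable_sets[OF X[OF grid_in]]) auto
    ultimately show "V N \<in> space M \<rightarrow> PiE {..N} (\<lambda>_. S) \<and> (\<forall>a\<in>PiE {..N} (\<lambda>_. S). V N -` {a} \<inter> space M \<in> sets M)"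
      using V_in N by auto
  qed
  have approx: "eventually (\<lambda>N. skorokhod_dist T m (q N (V N w)) (p w) < r) sequentially"
    if w: "w \<in> space M" and r: "r > 0" for w r
  proof -
    have "filterlim (\<lambda>N. 1 / T * real N) at_top sequentially"
      using T by (intro filterlim_tendsto_pos_mult_at_top[OF tendsto_const] filterlim_real_sequentially) auto
    then have "filterlim (\<lambda>N. real N / T) at_top sequentially" by simp
    then have "eventually (\<lambda>N. grid_matched (\<lambda>t. X t w) (real N / T) 0 T) sequentially"
      using grid_matched_eventually[OF cad[OF w] T] by (auto simp: filterlim_iff)
    moreover have "eventually (\<lambda>N. N > 0 \<and> T / real N < r) sequentially"
    proof -
      have "(\<lambda>N. T / real N) \<longlonglongrightarrow> 0" by (rule lim_const_over_n)
      then have "eventually (\<lambda>N. T / real N < r) sequentially" using r by (auto dest: order_tendstoD)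
      then show ?thesis using eventually_gt_at_top[of 0] by eventually_elim auto
    qed
    ultimately show ?thesis
    proof eventually_elim
      case (elim N)
      then have N: "N > 0" by simp
      obtain l where l: "continuous_on {0..T} l" "strict_mono_on {0..T} l" "l 0 = 0" "l T = T"
        "\<And>t. t \<in> {0..T} \<Longrightarrow> \<bar>l t - t\<bar> \<le> T / real N"
        "\<And>t. t \<in> {0..<T} \<Longrightarrow> X (grid_floor (real N / T) (l t)) w = X t w"
        using elim(1) unfolding grid_matched_def grid_ends[OF N T] by auto
      have lt: "l \<in> time_changes T" using l by (simp add: time_changes_def)
      have "q N (V N w) (l t) = p w t" if t: "t \<in> {0..T}" for t
      proof -
        have lr: "l t \<in> {0..T}" by (rule time_change_range[OF lt t])
        have "q N (V N w) (l t) = e (X (grid_floor (real N / T) (l t)) w)"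
          using lr grid_floor_range[OF N T lr] by (simp add: q_def V_def)
        moreover have "X (grid_floor (real N / T) (l t)) w = X t w"
          using l(6)[of t] l(4) t grid_ends(3)[OF N T] by (cases "t = T") auto
        ultimately show ?thesis using t by (simp add: p_def)
      qed
      then have "skor_close T m (q N (V N w)) (p w) (T / real N)"
        unfolding skor_close_def using l(5) D_space_in[OF pD[OF w]] T
        by (intro bexI[OF _ lt]) auto
      then have "skorokhod_dist T m (q N (V N w)) (p w) \<le> T / real N"
        by (rule skorokhod_dist_le[OF qD[OF V_in[OF w N] N] pD[OF w] T0])
      then show ?case using elim by simp
    qed
  qed
  have "p -` U \<inter> space M \<in> sets M" if U: "openin K.mtopology U" for U
  proof -
    \<comment> \<open>Whether the ball around the discretised path lies in \<open>U\<close> depends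
      on \<open>V N w\<close> alone, so \<open>A k N\<close> is measurable whatever the ball looks
      like; separability of the path space does not enter.\<close>
    define A where "A k N = {w \<in> space M. K.mball (q N (V N w)) (1 / real (Suc k)) \<subseteq> U}" for k N
    have Asets: "A k N \<in> sets M" if "N > 0" for k N
    proof -
      have "A k N = V N -` {v \<in> PiE {..N} (\<lambda>_. S). K.mball (q N v) (1 / real (Suc k)) \<subseteq> U} \<inter> space M"
        using V_in[OF _ that] by (auto simp: A_def)
      also have "\<dots> \<in> sets M" by (rule measurable_sets[OF Vm[OF that]]) auto
      finally show ?thesis .
    qed
    \<comment> \<open>One radius must work for all large \<open>N\<close>, so that the distance to
      \<open>p w\<close> eventually falls below it. The index starts at \<open>Suc n\<close> to
      avoid \<open>N = 0\<close>, where the grid degenerates.\<close>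
    have "p -` U \<inter> space M = (\<Union>k. \<Union>n. \<Inter>N\<in>{Suc n..}. A k N)"
    proof (intro set_eqI iffI)
      fix w assume "w \<in> p -` U \<inter> space M"
      then have w: "w \<in> space M" "p w \<in> U" by auto
      obtain r where r: "r > 0" "K.mball (p w) r \<subseteq> U"
        using U w unfolding K.openin_mtopology by blast
      obtain k where k: "1 / real (Suc k) < r / 2" using nat_approx_posE[of "r / 2"] r by auto
      obtain n where n: "\<And>N. N \<ge> n \<Longrightarrow> skorokhod_dist T m (q N (V N w)) (p w) < r / 2"
        using approx[OF w(1), of "r / 2"] r unfolding eventually_sequentially by auto
      have "w \<in> A k N" if N: "N \<in> {Suc n..}" for N
      proof -
        have qq: "q N (V N w) \<in> D_space T m" using N by (intro qD V_in w) auto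
        have "x \<in> K.mball (p w) r" if x: "x \<in> K.mball (q N (V N w)) (1 / real (Suc k))" for x
        proof -
          have "skorokhod_dist T m (p w) x \<le> skorokhod_dist T m (p w) (q N (V N w)) + skorokhod_dist T m (q N (V N w)) x"
            using x by (intro K.triangle pD w qq) auto
          also have "\<dots> < r / 2 + r / 2"
            using x k n[of N] N K.commute[of "p w" "q N (V N w)"] by (intro add_strict_mono) auto
          finally show ?thesis using x pD[OF w(1)] by auto
        qed
        then have "K.mball (q N (V N w)) (1 / real (Suc k)) \<subseteq> U" using r(2) by (meson order_trans subsetI)
        then show ?thesis using w(1) by (simp add: A_def)
      qed
      then show "w \<in> (\<Union>k. \<Union>n. \<Inter>N\<in>{Suc n..}. A k N)" by blast
    next
      fix w assume "w \<in> (\<Union>k. \<Union>n. \<Inter>N\<in>{Suc n..}. A k N)"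
      then obtain k n where kn: "\<And>N. N \<in> {Suc n..} \<Longrightarrow> w \<in> A k N" by blast
      then have w: "w \<in> space M" unfolding A_def by auto
      obtain n' where n': "\<And>N. N \<ge> n' \<Longrightarrow> skorokhod_dist T m (q N (V N w)) (p w) < 1 / real (Suc k)"
        using approx[OF w, of "1 / real (Suc k)"] unfolding eventually_sequentially by auto
      define N where "N = max (Suc n) n'"
      have "q N (V N w) \<in> D_space T m" by (intro qD V_in w) (auto simp: N_def)
      then have "p w \<in> K.mball (q N (V N w)) (1 / real (Suc k))"
        using n'[of N] pD[OF w] by (auto simp: N_def)
      moreover have "w \<in> A k N" by (rule kn) (simp add: N_def)
      ultimately show "w \<in> p -` U \<inter> space M" using w by (auto simp: A_def)
    qed
    also have "\<dots> \<in> sets M"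
    proof -
      have "(\<Inter>N\<in>{Suc n..}. A k N) \<in> sets M" for k n
        by (rule sets.countable_INT') (auto intro: Asets)
      then show ?thesis by (intro sets.countable_UN') auto
    qed
    finally show ?thesis .
  qed
  then have "p \<in> measurable M (borel_of (skorokhod_topology T m))"
    unfolding borel_of_def skorokhod_topology_def K.topspace_mtopology
    by (intro measurable_measure_of) (use pD K.openin_mtopology in auto)
  then show ?thesis unfolding p_def[abs_def] .
qed

section \<open>A maximal inequality for Markov chains\<close>

definition stochastic_on :: "'s set \<Rightarrow> ('s \<Rightarrow> 's \<Rightarrow> real) \<Rightarrow> bool" where
  "stochastic_on S K \<longleftrightarrow> (\<forall>x\<in>S. (\<forall>y\<in>S. 0 \<le> K x y) \<and> (\<Sum>y\<in>S. K x y) = 1)"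

text \<open>The expectation of \<open>f\<close> after \<open>j\<close> steps from \<open>x\<close>,
  as an iterated finite sum: the maximal inequality is proved on kernels, before any path measure
  appears.\<close>

primrec kernel_iter :: "'s set \<Rightarrow> ('s \<Rightarrow> 's \<Rightarrow> real) \<Rightarrow> nat \<Rightarrow> ('s \<Rightarrow> real) \<Rightarrow> 's \<Rightarrow> real" where
  "kernel_iter S K 0 f x = f x"
| "kernel_iter S K (Suc j) f x = (\<Sum>y\<in>S. K x y * kernel_iter S K j f y)"

lemma kernel_avg_mono:
  assumes "stochastic_on S K" "x \<in> S" "\<And>y. y \<in> S \<Longrightarrow> f y \<le> g y"
  shows "(\<Sum>y\<in>S. K x y * f y) \<le> (\<Sum>y\<in>S. K x y * g y)"
  using assms by (intro sum_mono mult_left_mono) (auto simp: stochastic_on_def)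

lemma kernel_avg_const: "stochastic_on S K \<Longrightarrow> x \<in> S \<Longrightarrow> (\<Sum>y\<in>S. K x y * c) = c"
  by (simp add: stochastic_on_def flip: sum_distrib_right)

lemma kernel_iter_mono:
  assumes "stochastic_on S K" "\<And>y. y \<in> S \<Longrightarrow> f y \<le> g y"
  shows "x \<in> S \<Longrightarrow> kernel_iter S K j f x \<le> kernel_iter S K j g x"
  by (induction j arbitrary: x) (use assms in \<open>auto intro: kernel_avg_mono\<close>)

lemma kernel_iter_affine:
  assumes "stochastic_on S K"
  shows "x \<in> S \<Longrightarrow> kernel_iter S K j (\<lambda>y. a + b * f y) x = a + b * kernel_iter S K j f x"
proof (induction j arbitrary: x)
  case (Suc j)
  have "kernel_iter S K (Suc j) (\<lambda>y. a + b * f y) x = (\<Sum>y\<in>S. K x y * a + b * (K x y * kernel_iter S K j f y))"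
    by (auto simp: Suc.IH algebra_simps intro!: sum.cong)
  also have "\<dots> = a + b * kernel_iter S K (Suc j) f x"
    using kernel_avg_const[OF assms Suc.prems, of a] by (simp add: sum.distrib sum_distrib_left)
  finally show ?case .
qed simp

text \<open>One step of a skeleton seen through a Fourier mode: \<open>z\<close> turns by
  \<open>\<theta>\<close> up to an error \<open>B\<close> in mean and \<open>V\<close> in mean
  square. All three will be proportional to the time step.\<close>

locale rotating_kernel =
  fixes S :: "'s set" and K :: "'s \<Rightarrow> 's \<Rightarrow> real" and z :: "'s \<Rightarrow> complex" and \<theta> B V :: real
  assumes stochastic: "stochastic_on S K"
    and z_bound: "\<And>x. x \<in> S \<Longrightarrow> cmod (z x) \<le> 1"
    and bias: "\<And>x. x \<in> S \<Longrightarrow> cmod ((\<Sum>y\<in>S. K x y *\<^sub>R z y) - cis \<theta> * z x) \<le> B"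
    and spread: "\<And>x. x \<in> S \<Longrightarrow> (\<Sum>y\<in>S. K x y * (cmod (z y - cis \<theta> * z x))\<^sup>2) \<le> V"
begin

text \<open>Expand the square around \<open>A = cis \<theta> * (z x - c)\<close>, which has the
  modulus of \<open>z x - c\<close>. The cross term sees only the mean error and is at most
  \<open>2 * 2 * B\<close>, because \<open>z x\<close> and \<open>c\<close> lie in the unit
  disc.\<close>

lemma one_step:
  assumes x: "x \<in> S" and c: "cmod c \<le> 1"
  shows "(\<Sum>y\<in>S. K x y * (cmod (z y - cis \<theta> * c))\<^sup>2) \<le> (cmod (z x - c))\<^sup>2 + (4 * B + V)"
proof -
  define A where "A = cis \<theta> * (z x - c)"
  have A: "cmod A = cmod (z x - c)" by (simp add: A_def norm_mult)
  have A2: "cmod A \<le> 2" unfolding A using norm_triangle_ineq4[of "z x" c] z_bound[OF x] c by linarith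
  have expand: "(cmod (z y - cis \<theta> * c))\<^sup>2 = (cmod A)\<^sup>2 + 2 * Re (cnj A * (z y - cis \<theta> * z x)) + (cmod (z y - cis \<theta> * z x))\<^sup>2" for y
  proof -
    have "z y - cis \<theta> * c = A + (z y - cis \<theta> * z x)" by (simp add: A_def algebra_simps)
    then show ?thesis by (simp only: cmod_power2) (simp add: power2_eq_square algebra_simps)
  qed
  have "(\<Sum>y\<in>S. K x y * (cmod (z y - cis \<theta> * c))\<^sup>2)
    = (\<Sum>y\<in>S. K x y * (cmod A)\<^sup>2) + 2 * (\<Sum>y\<in>S. K x y * Re (cnj A * (z y - cis \<theta> * z x)))
      + (\<Sum>y\<in>S. K x y * (cmod (z y - cis \<theta> * z x))\<^sup>2)"
    unfolding expand by (simp add: distrib_left sum.distrib sum_distrib_left mult_ac)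
  also have "(\<Sum>y\<in>S. K x y * (cmod A)\<^sup>2) = (cmod (z x - c))\<^sup>2"
    using kernel_avg_const[OF stochastic x] by (simp add: A)
  also have "(\<Sum>y\<in>S. K x y * Re (cnj A * (z y - cis \<theta> * z x)))
      = Re (cnj A * ((\<Sum>y\<in>S. K x y *\<^sub>R z y) - cis \<theta> * z x))"
  proof -
    have "(\<Sum>y\<in>S. K x y *\<^sub>R z y) - cis \<theta> * z x = (\<Sum>y\<in>S. K x y *\<^sub>R (z y - cis \<theta> * z x))"
      using stochastic x by (simp add: stochastic_on_def scaleR_diff_right sum_subtractf flip: scaleR_sum_left)
    then show ?thesis by (simp add: sum_distrib_left Re_sum mult_scaleR_right)
  qed
  also have "\<dots> \<le> cmod A * cmod ((\<Sum>y\<in>S. K x y *\<^sub>R z y) - cis \<theta> * z x)"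
    using complex_Re_le_cmod by (metis complex_mod_cnj norm_mult)
  also have "\<dots> \<le> 2 * B" using A2 bias[OF x] by (intro mult_mono) auto
  finally show ?thesis using spread[OF x] by linarith
qed

lemma second_moment:
  "x \<in> S \<Longrightarrow> cmod c \<le> 1 \<Longrightarrow>
    kernel_iter S K j (\<lambda>y. (cmod (z y - cis (real j * \<theta>) * c))\<^sup>2) x \<le> (cmod (z x - c))\<^sup>2 + real j * (4 * B + V)"
proof (induction j arbitrary: x c)
  case (Suc j)
  have cis_eq: "cis (real (Suc j) * \<theta>) * c = cis (real j * \<theta>) * (cis \<theta> * c)"
    by (simp add: distrib_right cis_mult[symmetric])
  have "kernel_iter S K (Suc j) (\<lambda>y. (cmod (z y - cis (real (Suc j) * \<theta>) * c))\<^sup>2) x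
    \<le> (\<Sum>y\<in>S. K x y * ((cmod (z y - cis \<theta> * c))\<^sup>2 + real j * (4 * B + V)))"
    unfolding kernel_iter.simps cis_eq using Suc.prems
    by (intro kernel_avg_mono[OF stochastic] Suc.IH) (auto simp: norm_mult)
  also have "\<dots> = (\<Sum>y\<in>S. K x y * (cmod (z y - cis \<theta> * c))\<^sup>2) + real j * (4 * B + V)"
    using kernel_avg_const[OF stochastic Suc.prems(1)] by (simp add: distrib_left sum.distrib)
  also have "\<dots> \<le> (cmod (z x - c))\<^sup>2 + (4 * B + V) + real j * (4 * B + V)"
    using one_step[OF Suc.prems] by simp
  finally show ?case by (simp add: algebra_simps)
qed simp

definition tail :: "real \<Rightarrow> nat \<Rightarrow> complex \<Rightarrow> 's \<Rightarrow> real" where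
  "tail e j c = kernel_iter S K j (\<lambda>y. of_bool (cmod (z y - cis (real j * \<theta>) * c) > e))"

lemma tail_le:
  assumes "x \<in> S" "e > 0" shows "tail e j (z x) x \<le> real j * (4 * B + V) / e\<^sup>2"
proof -
  let ?D = "\<lambda>y. cmod (z y - cis (real j * \<theta>) * z x)"
  have "tail e j (z x) x \<le> kernel_iter S K j (\<lambda>y. 0 + (1 / e\<^sup>2) * (?D y)\<^sup>2) x"
    unfolding tail_def
  proof (rule kernel_iter_mono[OF stochastic _ assms(1)])
    fix y
    show "of_bool (e < ?D y) \<le> 0 + 1 / e\<^sup>2 * (?D y)\<^sup>2"
      using assms(2) power_mono[of e "?D y" 2] by (auto simp: field_simps)
  qed
  also have "\<dots> = (1 / e\<^sup>2) * kernel_iter S K j (\<lambda>y. (?D y)\<^sup>2) x"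
    by (subst kernel_iter_affine[OF stochastic assms(1)]) simp
  also have "\<dots> \<le> (1 / e\<^sup>2) * (real j * (4 * B + V))"
    using second_moment[OF assms(1) z_bound[OF assms(1)], of j] by (intro mult_left_mono) auto
  finally show ?thesis by simp
qed

text \<open>First-passage form of the probability that the mode leaves the tube of radius
  \<open>2 * e\<close> around the rotating reference within \<open>j\<close> steps. Stopping the
  recursion at the first exit takes the place of the strong Markov property.\<close>

primrec escape :: "real \<Rightarrow> nat \<Rightarrow> complex \<Rightarrow> 's \<Rightarrow> real" where
  "escape e 0 c x = of_bool (cmod (z x - c) > 2 * e)"
| "escape e (Suc j) c x = (if cmod (z x - c) > 2 * e then 1 else (\<Sum>y\<in>S. K x y * escape e j (cis \<theta> * c) y))"

lemma escape_le_1: "x \<in> S \<Longrightarrow> escape e j c x \<le> 1"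
proof (induction j arbitrary: c x)
  case (Suc j)
  have "(\<Sum>y\<in>S. K x y * escape e j (cis \<theta> * c) y) \<le> (\<Sum>y\<in>S. K x y * 1)"
    by (rule kernel_avg_mono[OF stochastic Suc.prems Suc.IH])
  then show ?case using kernel_avg_const[OF stochastic Suc.prems, of 1] by simp
qed simp

text \<open>The rotation preserves distances, so a start more than \<open>2 * e\<close> away from
  \<open>c\<close> leaves, at the final step, a distance above \<open>e\<close> to the rotated
  \<open>c\<close> or to the rotated start.\<close>

lemma tail_far:
  assumes x: "x \<in> S" and far: "cmod (z x - c) > 2 * e"
  shows "tail e j c x \<ge> 1 - tail e j (z x) x"
proof -
  let ?r = "cis (real j * \<theta>)"
  have "1 - tail e j (z x) x = kernel_iter S K j (\<lambda>y. 1 + (-1) * of_bool (cmod (z y - ?r * z x) > e)) x"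
    unfolding tail_def by (subst kernel_iter_affine[OF stochastic x]) simp
  also have "\<dots> \<le> tail e j c x"
    unfolding tail_def
  proof (rule kernel_iter_mono[OF stochastic _ x])
    fix y
    have "cmod (z x - c) = cmod ((z y - ?r * c) - (z y - ?r * z x))"
      by (simp add: norm_mult flip: right_diff_distrib)
    also have "\<dots> \<le> cmod (z y - ?r * c) + cmod (z y - ?r * z x)" by (rule norm_triangle_ineq4)
    finally have "cmod (z y - ?r * c) > e \<or> cmod (z y - ?r * z x) > e" using far by linarith
    then show "1 + (-1) * of_bool (cmod (z y - ?r * z x) > e) \<le> (of_bool (cmod (z y - ?r * c) > e) :: real)"
      by auto
  qed
  finally show ?thesis .
qed

text \<open>Ottaviani's inequality: the rotation is an isometry, so once the chain has escaped by \<open>2e\<close> it is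
  still off by \<open>e\<close> at the final time with probability at least one half.\<close>

lemma escape_le_tail:
  assumes half: "\<And>i x. i \<le> N \<Longrightarrow> x \<in> S \<Longrightarrow> tail e i (z x) x \<le> 1 / 2" and e: "e > 0"
  shows "j \<le> N \<Longrightarrow> x \<in> S \<Longrightarrow> escape e j c x \<le> 2 * tail e j c x"
proof (induction j arbitrary: c x)
  case 0
  then show ?case using e by (auto simp: tail_def)
next
  case (Suc j)
  show ?case
  proof (cases "cmod (z x - c) > 2 * e")
    case True
    then show ?thesis using tail_far[OF Suc.prems(2) True, of "Suc j"] half[OF Suc.prems] by simp
  next
    case False
    have "escape e (Suc j) c x \<le> (\<Sum>y\<in>S. K x y * (2 * tail e j (cis \<theta> * c) y))"
      using False Suc by (auto intro!: kernel_avg_mono[OF stochastic])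
    also have "\<dots> = 2 * tail e (Suc j) c x"
      by (simp add: tail_def sum_distrib_left mult_ac distrib_left cis_mult[symmetric])
    finally show ?thesis .
  qed
qed

text \<open>If the Chebyshev bound is at most one half for \<open>N\<close> steps it is so for
  fewer, and Ottaviani's inequality applies. If it exceeds one half, its double exceeds 1 and the
  claim is trivial.\<close>

lemma escape_bound:
  assumes x: "x \<in> S" and e: "e > 0"
  shows "escape e N (z x) x \<le> 2 * (real N * (4 * B + V) / e\<^sup>2)"
proof (cases "real N * (4 * B + V) / e\<^sup>2 \<le> 1 / 2")
  case True
  have B0: "0 \<le> B" using order_trans[OF norm_ge_zero bias[OF x]] .
  have V0: "0 \<le> V"
    using stochastic x by (intro order_trans[OF sum_nonneg spread[OF x]]) (auto simp: stochastic_on_def)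
  have half: "tail e i (z y) y \<le> 1 / 2" if "i \<le> N" "y \<in> S" for i y
  proof -
    have "tail e i (z y) y \<le> real i * (4 * B + V) / e\<^sup>2" by (rule tail_le[OF that(2) e])
    also have "\<dots> \<le> real N * (4 * B + V) / e\<^sup>2"
      using that B0 V0 by (intro divide_right_mono mult_right_mono) auto
    finally show ?thesis using True by linarith
  qed
  have "escape e N (z x) x \<le> 2 * tail e N (z x) x" by (rule escape_le_tail[OF half e order_refl x])
  then show ?thesis using tail_le[OF x e, of N] by linarith
next
  case False
  then show ?thesis using escape_le_1[OF x, of e N "z x"] by linarith
qed

end

section \<open>From the generator to one step of the semigroup\<close>

lemma cis_approx: "cmod (cis a - 1) \<le> \<bar>a\<bar>" "cmod (cis a - 1 - \<i> * of_real a) \<le> a\<^sup>2 / 2"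
  using iexp_approx1[of a 0] iexp_approx1[of a 1] by (simp_all add: cis_conv_exp power2_eq_square algebra_simps)

text \<open>Difference quotients of the semigroup converge to the generator, so strict bounds at the
  generator give bounds for all small \<open>h\<close>, uniformly because \<open>S\<close> is
  finite. The factor 2 in the spread pays for separating the jump from the rotation; the latter
  contributes only order \<open>h\<^sup>2\<close>.\<close>

lemma generator_one_step:
  assumes S: "finite S" and gen: "has_generator S P L" and P: "markov_semigroup S P"
    and z: "\<And>x. x \<in> S \<Longrightarrow> cmod (z x) \<le> 1"
    and bias: "\<And>x. x \<in> S \<Longrightarrow> cmod (Complex (L (\<lambda>y. Re (z y)) x) (L (\<lambda>y. Im (z y)) x) - \<i> * of_real \<theta> * z x) < B"
    and spread: "\<And>x. x \<in> S \<Longrightarrow> 2 * L (\<lambda>y. (cmod (z y - z x))\<^sup>2) x < V"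
  shows "eventually (\<lambda>h. rotating_kernel S (P h) z (h * \<theta>) (h * B) (h * V)) (at_right 0)"
proof -
  have pos: "eventually (\<lambda>h::real. h > 0) (at_right 0)" by (simp add: eventually_at_right_less)
  have cis0: "((\<lambda>h. (cis (h * \<theta>) - 1) / of_real h) \<longlongrightarrow> \<i> * of_real \<theta>) (at_right 0)"
  proof (rule LIM_zero_cancel, rule Lim_null_comparison)
    show "eventually (\<lambda>h. norm ((cis (h * \<theta>) - 1) / of_real h - \<i> * of_real \<theta>) \<le> \<bar>h\<bar> * \<theta>\<^sup>2 / 2) (at_right 0)"
      using pos
    proof eventually_elim
      case (elim h)
      have "(cis (h * \<theta>) - 1) / of_real h - \<i> * of_real \<theta> = (cis (h * \<theta>) - 1 - \<i> * of_real (h * \<theta>)) / of_real h"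
        using elim by (simp add: field_simps)
      then have "norm ((cis (h * \<theta>) - 1) / of_real h - \<i> * of_real \<theta>) = cmod (cis (h * \<theta>) - 1 - \<i> * of_real (h * \<theta>)) / h"
        using elim by (simp add: norm_divide)
      also have "\<dots> \<le> ((h * \<theta>)\<^sup>2 / 2) / h" using elim by (intro divide_right_mono cis_approx) auto
      finally show ?case using elim by (simp add: power2_eq_square field_simps)
    qed
    show "((\<lambda>h. \<bar>h\<bar> * \<theta>\<^sup>2 / 2) \<longlongrightarrow> 0) (at_right 0)"
      by (auto intro!: tendsto_eq_intros)
  qed
  have b: "eventually (\<lambda>h. cmod ((\<Sum>y\<in>S. P h x y *\<^sub>R z y) - cis (h * \<theta>) * z x) \<le> h * B) (at_right 0)" if x: "x \<in> S" for x
  proof -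
    let ?D = "\<lambda>f h. ((\<Sum>y\<in>S. P h x y * f y) - f x) / h"
    have "((\<lambda>h. Complex (?D (\<lambda>y. Re (z y)) h) (?D (\<lambda>y. Im (z y)) h) - (cis (h * \<theta>) - 1) / of_real h * z x)
      \<longlongrightarrow> Complex (L (\<lambda>y. Re (z y)) x) (L (\<lambda>y. Im (z y)) x) - \<i> * of_real \<theta> * z x) (at_right 0)"
      using gen x unfolding has_generator_def by (intro tendsto_intros tendsto_Complex cis0) auto
    then have "eventually (\<lambda>h. cmod (Complex (?D (\<lambda>y. Re (z y)) h) (?D (\<lambda>y. Im (z y)) h) - (cis (h * \<theta>) - 1) / of_real h * z x) < B) (at_right 0)"
      using bias[OF x] by (intro order_tendstoD(2)[OF tendsto_norm])
    then show ?thesis using pos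
    proof eventually_elim
      case (elim h)
      have "Complex (?D (\<lambda>y. Re (z y)) h) (?D (\<lambda>y. Im (z y)) h) - (cis (h * \<theta>) - 1) / of_real h * z x
        = ((\<Sum>y\<in>S. P h x y *\<^sub>R z y) - cis (h * \<theta>) * z x) / of_real h"
      proof -
        have "Complex (?D (\<lambda>y. Re (z y)) h) (?D (\<lambda>y. Im (z y)) h) = ((\<Sum>y\<in>S. P h x y *\<^sub>R z y) - z x) / of_real h"
          by (simp add: complex_eq_iff Re_sum Im_sum)
        then show ?thesis by (simp add: diff_divide_distrib algebra_simps)
      qed
      then have "cmod ((\<Sum>y\<in>S. P h x y *\<^sub>R z y) - cis (h * \<theta>) * z x) / h < B"
        using elim by (simp add: norm_divide)
      then show ?case using elim by (simp add: field_simps)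
    qed
  qed
  have s: "eventually (\<lambda>h. (\<Sum>y\<in>S. P h x y * (cmod (z y - cis (h * \<theta>) * z x))\<^sup>2) \<le> h * V) (at_right 0)" if x: "x \<in> S" for x
  proof -
    let ?f = "\<lambda>y. (cmod (z y - z x))\<^sup>2"
    have "((\<lambda>h. ((\<Sum>y\<in>S. P h x y * ?f y) - ?f x) / h) \<longlongrightarrow> L ?f x) (at_right 0)"
      using gen[unfolded has_generator_def, rule_format, OF x, of ?f] .
    then have "((\<lambda>h. 2 * (((\<Sum>y\<in>S. P h x y * ?f y) - ?f x) / h) + 2 * h * \<theta>\<^sup>2) \<longlongrightarrow> 2 * L ?f x + 2 * 0 * \<theta>\<^sup>2) (at_right 0)"
      by (intro tendsto_intros)
    then have "eventually (\<lambda>h. 2 * (((\<Sum>y\<in>S. P h x y * ?f y) - ?f x) / h) + 2 * h * \<theta>\<^sup>2 < V) (at_right 0)"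
      using spread[OF x] by (intro order_tendstoD(2)) auto
    then show ?thesis using pos
    proof eventually_elim
      case (elim h)
      have st: "stochastic_on S (P h)" using P elim by (simp add: markov_semigroup_def stochastic_on_def)
      have pt: "(cmod (z y - cis (h * \<theta>) * z x))\<^sup>2 \<le> 2 * ?f y + 2 * (h * \<theta>)\<^sup>2" for y
      proof -
        have "cmod (z y - cis (h * \<theta>) * z x) = cmod ((z y - z x) - (cis (h * \<theta>) - 1) * z x)" by (simp add: algebra_simps)
        also have "\<dots> \<le> cmod (z y - z x) + cmod (cis (h * \<theta>) - 1) * cmod (z x)"
          using norm_triangle_ineq4 by (metis norm_mult)
        also have "\<dots> \<le> cmod (z y - z x) + \<bar>h * \<theta>\<bar> * 1"
          by (intro add_left_mono mult_mono cis_approx z x) auto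
        finally have "(cmod (z y - cis (h * \<theta>) * z x))\<^sup>2 \<le> (cmod (z y - z x) + \<bar>h * \<theta>\<bar>)\<^sup>2"
          by (intro power_mono) auto
        also have "\<dots> \<le> 2 * ?f y + 2 * (h * \<theta>)\<^sup>2"
          using sum_squares_bound[of "cmod (z y - z x)" "\<bar>h * \<theta>\<bar>"] by (simp add: power2_sum)
        finally show ?thesis .
      qed
      have "(\<Sum>y\<in>S. P h x y * (cmod (z y - cis (h * \<theta>) * z x))\<^sup>2) \<le> (\<Sum>y\<in>S. P h x y * (2 * ?f y + 2 * (h * \<theta>)\<^sup>2))"
        by (rule kernel_avg_mono[OF st x pt])
      also have "\<dots> = 2 * (\<Sum>y\<in>S. P h x y * ?f y) + 2 * (h * \<theta>)\<^sup>2"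
        using kernel_avg_const[OF st x, of "2 * (h * \<theta>)\<^sup>2"]
        by (simp add: distrib_left sum.distrib sum_distrib_left mult_ac)
      also have "\<dots> = h * (2 * (((\<Sum>y\<in>S. P h x y * ?f y) - ?f x) / h) + 2 * h * \<theta>\<^sup>2)"
        using elim by (simp add: power2_eq_square field_simps)
      also have "\<dots> \<le> h * V" using elim by (intro mult_left_mono) auto
      finally show ?case .
    qed
  qed
  have "eventually (\<lambda>h. \<forall>x\<in>S. cmod ((\<Sum>y\<in>S. P h x y *\<^sub>R z y) - cis (h * \<theta>) * z x) \<le> h * B) (at_right 0)"
    "eventually (\<lambda>h. \<forall>x\<in>S. (\<Sum>y\<in>S. P h x y * (cmod (z y - cis (h * \<theta>) * z x))\<^sup>2) \<le> h * V) (at_right 0)"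
    using b s S by (auto intro: eventually_ball_finite)
  then show ?thesis using pos
  proof eventually_elim
    case (elim h)
    have "stochastic_on S (P h)" using P elim by (simp add: markov_semigroup_def stochastic_on_def)
    then show ?case using elim z by (intro rotating_kernel.intro) blast+
  qed
qed

section \<open>Deviation of a chain from a rotation\<close>

text \<open>Fixes one of the semigroups that \<open>markov_chain\<close> provides. The Markov
  property is used in no other form than this product formula for visits at finitely many
  times.\<close>

locale chain_fdd = prob_space M for M :: "'w measure" +
  fixes X :: "real \<Rightarrow> 'w \<Rightarrow> 's" and S :: "'s set" and \<mu> :: "'s pmf" and P :: "real \<Rightarrow> 's \<Rightarrow> 's \<Rightarrow> real"
  assumes S: "finite S" and X: "\<And>t. t \<ge> 0 \<Longrightarrow> X t \<in> measurable M (count_space S)"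
    and fdd: "\<And>(k::nat) t x. t 0 = 0 \<Longrightarrow> (\<And>i. i < k \<Longrightarrow> t i \<le> t (Suc i)) \<Longrightarrow> (\<And>i. i \<le> k \<Longrightarrow> x i \<in> S) \<Longrightarrow>
       measure M {w \<in> space M. \<forall>i\<le>k. X (t i) w = x i} =
         pmf \<mu> (x 0) * (\<Prod>i<k. P (t (Suc i) - t i) (x i) (x (Suc i)))"
begin

lemma X_in: "t \<ge> 0 \<Longrightarrow> w \<in> space M \<Longrightarrow> X t w \<in> S"
  using measurable_space[OF X] by simp

lemma X_set: assumes "t \<ge> 0" shows "{w \<in> space M. Q (X t w)} \<in> sets M"
proof -
  have "{w \<in> space M. Q (X t w)} = X t -` {s \<in> S. Q s} \<inter> space M"
    using X_in[OF assms] by auto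
  also have "\<dots> \<in> sets M" by (rule measurable_sets[OF X[OF assms]]) auto
  finally show ?thesis .
qed

lemma cylinder_sets:
  assumes "h \<ge> 0"
  shows "{w \<in> space M. (\<forall>i\<le>k. X (real i * h) w = x i) \<and> (\<exists>i\<le>j. Q i (X (real (l + i) * h) w))} \<in> sets M"
proof -
  have "{w \<in> space M. (\<forall>i\<le>k. X (real i * h) w = x i) \<and> (\<exists>i\<le>j. Q i (X (real (l + i) * h) w))}
    = (\<Inter>i\<in>{..k}. {w \<in> space M. X (real i * h) w = x i}) \<inter> (\<Union>i\<in>{..j}. {w \<in> space M. Q i (X (real (l + i) * h) w)})"
    by auto
  also have "\<dots> \<in> sets M"
    using assms by (intro sets.Int sets.finite_INT sets.finite_UN X_set) auto
  finally show ?thesis .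
qed

text \<open>Links the recursion \<open>escape\<close> with actual probabilities. A whole prefix
  \<open>x 0\<close>, ..., \<open>x k\<close> is carried along since the product formula starts at
  time 0; the induction on \<open>j\<close> sums over the next state.\<close>

lemma escape_prob:
  assumes rot: "rotating_kernel S (P h) z \<theta> B V" and h: "h > 0"
  shows "(\<And>i. i \<le> k \<Longrightarrow> x i \<in> S) \<Longrightarrow>
    measure M {w \<in> space M. (\<forall>i\<le>k. X (real i * h) w = x i) \<and>
        (\<exists>i\<le>j. cmod (z (X (real (k + i) * h) w) - cis (real (k + i) * \<theta>) * c) > 2 * e)}
    = pmf \<mu> (x 0) * (\<Prod>i<k. P h (x i) (x (Suc i))) * rotating_kernel.escape S (P h) z \<theta> e j (cis (real k * \<theta>) * c) (x k)"
proof (induction j arbitrary: k x)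
  interpret rotating_kernel S "P h" z \<theta> B V by (rule rot)
  have cyl: "measure M {w \<in> space M. \<forall>i\<le>k. X (real i * h) w = x i} = pmf \<mu> (x 0) * (\<Prod>i<k. P h (x i) (x (Suc i)))"
    if "\<And>i. i \<le> k \<Longrightarrow> x i \<in> S" for k x
    using fdd[of "\<lambda>i. real i * h" k x] that h by (simp add: algebra_simps)
  case 0
  show ?case
  proof (cases "cmod (z (x k) - cis (real k * \<theta>) * c) > 2 * e")
    case True
    then have "{w \<in> space M. (\<forall>i\<le>k. X (real i * h) w = x i) \<and> (\<exists>i\<le>0. cmod (z (X (real (k + i) * h) w) - cis (real (k + i) * \<theta>) * c) > 2 * e)}
      = {w \<in> space M. \<forall>i\<le>k. X (real i * h) w = x i}" by auto
    then show ?thesis using cyl[of k x] 0 True by simp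
  next
    case False
    then have "{w \<in> space M. (\<forall>i\<le>k. X (real i * h) w = x i) \<and> (\<exists>i\<le>0. cmod (z (X (real (k + i) * h) w) - cis (real (k + i) * \<theta>) * c) > 2 * e)} = {}"
      by auto
    then show ?thesis using False by (simp only: measure_empty) simp
  qed
next
  interpret rotating_kernel S "P h" z \<theta> B V by (rule rot)
  have cyl: "measure M {w \<in> space M. \<forall>i\<le>k. X (real i * h) w = x i} = pmf \<mu> (x 0) * (\<Prod>i<k. P h (x i) (x (Suc i)))"
    if "\<And>i. i \<le> k \<Longrightarrow> x i \<in> S" for k x
    using fdd[of "\<lambda>i. real i * h" k x] that h by (simp add: algebra_simps)
  case (Suc j)
  let ?bad = "\<lambda>i w. cmod (z (X (real i * h) w) - cis (real i * \<theta>) * c) > 2 * e"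
  let ?E = "{w \<in> space M. (\<forall>i\<le>k. X (real i * h) w = x i) \<and> (\<exists>i\<le>Suc j. ?bad (k + i) w)}"
  show ?case
  proof (cases "cmod (z (x k) - cis (real k * \<theta>) * c) > 2 * e")
    case True
    have "?E = {w \<in> space M. \<forall>i\<le>k. X (real i * h) w = x i}"
      using True by (auto intro!: exI[of _ 0])
    then show ?thesis using cyl[of k x] Suc.prems True by simp
  next
    case False
    \<comment> \<open>Step \<open>k\<close> is inside the tube, so an exit happens at step
      \<open>k + 1\<close> or later; \<open>A s\<close> adds the state \<open>s\<close> at step
      \<open>k + 1\<close> to the prefix.\<close>
    define A where "A s = {w \<in> space M. (\<forall>i\<le>Suc k. X (real i * h) w = (x(Suc k := s)) i) \<and> (\<exists>i\<le>j. ?bad (Suc k + i) w)}" for s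
    have "?E = (\<Union>s\<in>S. A s)"
    proof (intro set_eqI iffI)
      fix w assume "w \<in> ?E"
      then obtain i where w: "w \<in> space M" "\<forall>i\<le>k. X (real i * h) w = x i" and i: "i \<le> Suc j" "?bad (k + i) w" by blast
      have "i \<noteq> 0"
      proof
        assume "i = 0"
        then show False using i(2) False w(2)[rule_format, of k] by simp
      qed
      then obtain i' where i': "i = Suc i'" by (cases i) auto
      have "w \<in> A (X (real (Suc k) * h) w)"
        unfolding A_def using w i i' by (auto simp: le_Suc_eq intro!: exI[of _ i'])
      then show "w \<in> (\<Union>s\<in>S. A s)" using X_in[of "real (Suc k) * h" w] h w by auto
    next
      fix w assume "w \<in> (\<Union>s\<in>S. A s)"
      then obtain s where "w \<in> A s" by blast
      then obtain i where w: "w \<in> space M" "\<forall>i\<le>Suc k. X (real i * h) w = (x(Suc k := s)) i" and i: "i \<le> j" "?bad (Suc k + i) w"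
        unfolding A_def by blast
      have "X (real i * h) w = x i" if "i \<le> k" for i using w(2)[rule_format, of i] that by auto
      moreover have "k + Suc i = Suc k + i" by simp
      then have "?bad (k + Suc i) w" using i(2) by (simp only:)
      then have "\<exists>i\<le>Suc j. ?bad (k + i) w" using i(1) by (intro exI[of _ "Suc i"]) auto
      ultimately show "w \<in> ?E" using w(1) by blast
    qed
    moreover have "measure M (\<Union>s\<in>S. A s) = (\<Sum>s\<in>S. measure M (A s))"
    proof (rule finite_measure_finite_Union[OF S])
      have "A s \<in> sets M" for s :: 's unfolding A_def by (rule cylinder_sets) (use h in simp)
      then show "A ` S \<subseteq> sets M" by auto
      show "disjoint_family_on A S"
        unfolding disjoint_family_on_def
      proof (intro ballI impI)
        fix s s' :: 's assume "s \<noteq> s'"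
        have "X (real (Suc k) * h) w = s" if "w \<in> A s" for w and s :: 's
          using that unfolding A_def by (auto dest!: spec[of _ "Suc k"])
        then show "A s \<inter> A s' = {}" using \<open>s \<noteq> s'\<close> by blast
      qed
    qed
    moreover have "measure M (A s) = pmf \<mu> (x 0) * (\<Prod>i<k. P h (x i) (x (Suc i))) *
        (P h (x k) s * escape e j (cis \<theta> * (cis (real k * \<theta>) * c)) s)" if s: "s \<in> S" for s
    proof -
      have "measure M (A s) = pmf \<mu> ((x(Suc k := s)) 0) * (\<Prod>i<Suc k. P h ((x(Suc k := s)) i) ((x(Suc k := s)) (Suc i)))
        * escape e j (cis (real (Suc k) * \<theta>) * c) ((x(Suc k := s)) (Suc k))"
        unfolding A_def using Suc.prems s by (intro Suc.IH) (auto simp: le_Suc_eq)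
      moreover have "(\<Prod>i<Suc k. P h ((x(Suc k := s)) i) ((x(Suc k := s)) (Suc i))) = (\<Prod>i<k. P h (x i) (x (Suc i))) * P h (x k) s"
      proof -
        have "(\<Prod>i<k. P h ((x(Suc k := s)) i) ((x(Suc k := s)) (Suc i))) = (\<Prod>i<k. P h (x i) (x (Suc i)))"
          by (intro prod.cong) auto
        then show ?thesis by simp
      qed
      moreover have "cis (real (Suc k) * \<theta>) * c = cis \<theta> * (cis (real k * \<theta>) * c)"
        by (simp add: distrib_right cis_mult[symmetric])
      ultimately show ?thesis by (simp only: fun_upd_same fun_upd_other[of 0 "Suc k"] nat.distinct not_False_eq_True mult.assoc)
    qed
    ultimately show ?thesis using False by (simp add: sum_distrib_left)
  qed
qed

text \<open>The reference is the random value \<open>z (X 0 w)\<close>; on each initial state it is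
  constant and \<open>escape_bound\<close> applies, with the weights of \<open>\<mu>\<close> adding
  up to 1.\<close>

lemma grid_deviation:
  assumes rot: "rotating_kernel S (P h) z \<theta> B V" and h: "h > 0" and \<mu>: "set_pmf \<mu> \<subseteq> S" and e: "e > 0"
  shows "measure M {w \<in> space M. \<exists>i\<le>N. cmod (z (X (real i * h) w) - cis (real i * \<theta>) * z (X 0 w)) > 2 * e}
    \<le> 2 * (real N * (4 * B + V) / e\<^sup>2)"
proof -
  interpret rotating_kernel S "P h" z \<theta> B V by (rule rot)
  define A where "A s = {w \<in> space M. (\<forall>i\<le>0. X (real i * h) w = s) \<and>
        (\<exists>i\<le>N. cmod (z (X (real (0 + i) * h) w) - cis (real (0 + i) * \<theta>) * z s) > 2 * e)}" for s
  have A_sets: "A s \<in> sets M" for s :: 's unfolding A_def by (rule cylinder_sets) (use h in simp)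
  have "{w \<in> space M. \<exists>i\<le>N. cmod (z (X (real i * h) w) - cis (real i * \<theta>) * z (X 0 w)) > 2 * e} \<subseteq> (\<Union>s\<in>S. A s)"
    using X_in[of 0] by (auto simp: A_def)
  then have "measure M {w \<in> space M. \<exists>i\<le>N. cmod (z (X (real i * h) w) - cis (real i * \<theta>) * z (X 0 w)) > 2 * e}
    \<le> measure M (\<Union>s\<in>S. A s)"
    using A_sets S by (intro finite_measure_mono) auto
  also have "\<dots> \<le> (\<Sum>s\<in>S. measure M (A s))"
    using A_sets S by (intro finite_measure_subadditive_finite) auto
  also have "\<dots> \<le> (\<Sum>s\<in>S. pmf \<mu> s * (2 * (real N * (4 * B + V) / e\<^sup>2)))"
  proof (rule sum_mono)
    fix s assume s: "s \<in> S"
    have eq: "measure M (A s) = pmf \<mu> s * escape e N (z s) s"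
      using escape_prob[OF rot h, where k = 0 and x = "\<lambda>_. s" and j = N and c = "z s" and e = e] s by (simp add: A_def)
    then show "measure M (A s) \<le> pmf \<mu> s * (2 * (real N * (4 * B + V) / e\<^sup>2))"
      unfolding eq by (intro mult_left_mono escape_bound s e pmf_nonneg)
  qed
  also have "\<dots> = 2 * (real N * (4 * B + V) / e\<^sup>2)"
    unfolding sum_distrib_right[symmetric] using sum_pmf_eq_1[OF S \<mu>] by simp
  finally show ?thesis .
qed

end

lemma markov_chain_fdd:
  assumes "markov_chain M X S L \<mu>" "finite S"
  obtains P where "chain_fdd M X S \<mu> P" "markov_semigroup S P" "has_generator S P L"
proof -
  from assms(1) obtain P where P: "markov_semigroup S P" "has_generator S P L"
    "\<forall>(k::nat) t x. t 0 = 0 \<and> (\<forall>i<k. t i \<le> t (Suc i)) \<and> (\<forall>i\<le>k. x i \<in> S) \<longrightarrow>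
       measure M {w \<in> space M. \<forall>i\<le>k. X (t i) w = x i} =
         pmf \<mu> (x 0) * (\<Prod>i<k. P (t (Suc i) - t i) (x i) (x (Suc i)))"
    unfolding markov_chain_def by blast
  have "chain_fdd M X S \<mu> P"
    unfolding chain_fdd_def chain_fdd_axioms_def
    using assms P(3) by (auto simp: markov_chain_def)
  then show ?thesis using that P by blast
qed

text \<open>Dyadic grids are nested, so the bad events increase and their union inherits the bound,
  which does not depend on the mesh. The exceptional set is this countable union, measurable by
  construction; right continuity shows that off it no time in \<open>{0..H}\<close> is bad.\<close>

lemma chain_deviation:
  fixes X :: "real \<Rightarrow> 'w \<Rightarrow> 's"
  assumes chain: "markov_chain M X S L \<mu>" and S: "finite S" and \<mu>: "set_pmf \<mu> \<subseteq> S"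
    and z: "\<And>x. x \<in> S \<Longrightarrow> cmod (z x) \<le> 1"
    and bias: "\<And>x. x \<in> S \<Longrightarrow> cmod (Complex (L (\<lambda>y. Re (z y)) x) (L (\<lambda>y. Im (z y)) x) - \<i> * of_real \<theta> * z x) < B"
    and spread: "\<And>x. x \<in> S \<Longrightarrow> 2 * L (\<lambda>y. (cmod (z y - z x))\<^sup>2) x < V"
    and H: "H > 0" and e: "e > 0"
  shows "\<exists>A\<in>sets M. measure M A \<le> 2 * (H * (4 * B + V) / e\<^sup>2) \<and>
    (\<forall>w\<in>space M - A. \<forall>s\<in>{0..H}. cmod (z (X s w) - cis (s * \<theta>) * z (X 0 w)) \<le> 2 * e)"
proof -
  obtain P where P: "chain_fdd M X S \<mu> P" "markov_semigroup S P" "has_generator S P L"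
    using markov_chain_fdd[OF chain S] by blast
  interpret chain_fdd M X S \<mu> P by (rule P(1))
  define h where "h j = H / 2 ^ j" for j :: nat
  define A where "A j = {w \<in> space M. \<exists>i\<le>2 ^ j. cmod (z (X (real i * h j) w) - cis (real i * (h j * \<theta>)) * z (X 0 w)) > 2 * e}" for j
  have h: "h j > 0" for j using H by (simp add: h_def)
  have A_sets: "A j \<in> sets M" for j
  proof -
    have "A j = (\<Union>s\<in>S. {w \<in> space M. (\<forall>i\<le>0. X (real i * h j) w = s) \<and>
      (\<exists>i\<le>2 ^ j. cmod (z (X (real (0 + i) * h j) w) - cis (real i * (h j * \<theta>)) * z s) > 2 * e)})"
      using X_in[of 0] by (auto simp: A_def)
    also have "\<dots> \<in> sets M"
      by (intro sets.finite_UN S cylinder_sets less_imp_le h)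
    finally show ?thesis .
  qed
  have "incseq A"
  proof (rule incseq_SucI)
    fix j
    show "A j \<subseteq> A (Suc j)"
      unfolding A_def
    proof (intro subsetI CollectI conjI, goal_cases)
      case (2 w)
      then obtain i where i: "i \<le> 2 ^ j" "cmod (z (X (real i * h j) w) - cis (real i * (h j * \<theta>)) * z (X 0 w)) > 2 * e" by blast
      have eq: "real (2 * i) * h (Suc j) = real i * h j" "real (2 * i) * (h (Suc j) * \<theta>) = real i * (h j * \<theta>)"
        by (simp_all add: h_def)
      show ?case using i unfolding eq[symmetric] by (intro exI[of _ "2 * i"]) simp
    qed simp
  qed
  have "filterlim h (at_right 0) sequentially"
    unfolding filterlim_at h_def using H
    by (auto intro!: tendsto_eq_intros LIMSEQ_divide_realpow_zero)
  then have "eventually (\<lambda>j. rotating_kernel S (P (h j)) z (h j * \<theta>) (h j * B) (h j * V)) sequentially"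
    using generator_one_step[OF S P(3,2) z bias spread] by (auto simp: filterlim_iff)
  then have "eventually (\<lambda>j. measure M (A j) \<le> 2 * (H * (4 * B + V) / e\<^sup>2)) sequentially"
  proof eventually_elim
    case (elim j)
    have "measure M (A j) \<le> 2 * (real (2 ^ j) * (4 * (h j * B) + h j * V) / e\<^sup>2)"
      unfolding A_def by (rule grid_deviation[OF elim h \<mu> e])
    also have "real (2 ^ j) * (4 * (h j * B) + h j * V) = H * (4 * B + V)"
      by (simp add: h_def field_simps)
    finally show ?case .
  qed
  moreover have "(\<lambda>j. measure M (A j)) \<longlonglongrightarrow> measure M (\<Union>j. A j)"
    using A_sets \<open>incseq A\<close> by (intro finite_Lim_measure_incseq) auto
  ultimately have m: "measure M (\<Union>j. A j) \<le> 2 * (H * (4 * B + V) / e\<^sup>2)"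
    by (intro tendsto_upperbound) auto
  have "cmod (z (X s w) - cis (s * \<theta>) * z (X 0 w)) \<le> 2 * e"
    if w: "w \<in> space M" "w \<notin> (\<Union>j. A j)" and s: "s \<in> {0..H}" for w s
  proof (rule ccontr)
    assume "\<not> ?thesis"
    then have bad: "cmod (z (X s w) - cis (s * \<theta>) * z (X 0 w)) > 2 * e" by simp
    have grid: "cmod (z (X (real i * h j) w) - cis (real i * h j * \<theta>) * z (X 0 w)) \<le> 2 * e" if "i \<le> 2 ^ j" for i j
      using w that by (auto simp: A_def not_less mult.assoc)
    show False
    proof (cases "s = H")
      case True
      \<comment> \<open>No time to the right of \<open>H\<close> is available, but \<open>H\<close>
        is the last point of the coarsest grid.\<close>
      then show False using grid[of 1 0] bad by (simp add: h_def)
    next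
      case False
      have cad: "cadlag (discrete_topology S) {0..} (\<lambda>t. X t w)" using chain w by (simp add: markov_chain_def)
      have "s \<in> {0..}" using s by simp
      then obtain d where d: "d > 0" "\<forall>t\<in>{0..}. s \<le> t \<and> t < s + d \<longrightarrow> X t w = X s w"
        using cadlag_discrete_right[OF cad] by blast
      have "continuous (at s) (\<lambda>t. cmod (z (X s w) - cis (t * \<theta>) * z (X 0 w)))"
        by (simp add: cis_conv_exp)
      then have "eventually (\<lambda>t. cmod (z (X s w) - cis (t * \<theta>) * z (X 0 w)) > 2 * e) (at s)"
        using bad unfolding continuous_at by (rule order_tendstoD(1))
      then obtain d' where d': "d' > 0" "\<forall>t. t \<noteq> s \<and> dist t s < d' \<longrightarrow> cmod (z (X s w) - cis (t * \<theta>) * z (X 0 w)) > 2 * e"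
        unfolding eventually_at by blast
      \<comment> \<open>Within \<open>r\<close> to the right of \<open>s\<close> the state is
        constant, the rotated reference still misses it by more than \<open>2 * e\<close>, and
        \<open>H\<close> is not reached; a mesh below \<open>r\<close> puts a grid point
        there.\<close>
      define r where "r = min (min d d') (H - s)"
      have r: "r > 0" "r \<le> d" "r \<le> d'" "r \<le> H - s" using d(1) d'(1) False s by (auto simp: r_def)
      have "h \<longlonglongrightarrow> 0" unfolding h_def by (rule LIMSEQ_divide_realpow_zero) simp
      then have "eventually (\<lambda>j. h j < r) sequentially" using r by (auto dest: order_tendstoD)
      then obtain j where j: "h j < r" by (auto simp: eventually_sequentially)
      define i where "i = nat \<lceil>s / h j\<rceil>"
      have i0: "real i = of_int \<lceil>s / h j\<rceil>" using s h[of j] by (simp add: i_def)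
      have "s / h j \<le> real i" "real i < s / h j + 1" unfolding i0 by linarith+
      then have i: "s \<le> real i * h j" "real i * h j < s + h j" using h[of j] by (simp_all add: field_simps)
      have "real i * h j < H" using i(2) j r by linarith
      then have "real i < 2 ^ j" using H by (simp add: h_def field_simps)
      then have "i \<le> 2 ^ j" by (metis less_imp_le of_nat_less_iff of_nat_numeral of_nat_power)
      then have "cmod (z (X (real i * h j) w) - cis (real i * h j * \<theta>) * z (X 0 w)) \<le> 2 * e" by (rule grid)
      moreover have "X (real i * h j) w = X s w" using d(2)[rule_format, of "real i * h j"] i j r(2) s by simp
      moreover have "cmod (z (X s w) - cis (real i * h j * \<theta>) * z (X 0 w)) > 2 * e"
        using d'(2)[rule_format, of "real i * h j"] bad i j r(3) by (cases "real i * h j = s") (auto simp: dist_real_def)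
      ultimately show False by simp
    qed
  qed
  note dev = this
  show ?thesis
  proof (intro bexI[of _ "\<Union>j. A j"] conjI ballI m)
    show "cmod (z (X s w) - cis (s * \<theta>) * z (X 0 w)) \<le> 2 * e"
      if "w \<in> space M - (\<Union>j. A j)" "s \<in> {0..H}" for w s
      using that by (intro dev) blast+
    show "(\<Union>j. A j) \<in> sets M" using A_sets by (intro sets.countable_UN) blast
  qed
qed

section \<open>Fourier modes of the particle system\<close>

definition wave_sum :: "real \<Rightarrow> nat \<Rightarrow> (nat \<Rightarrow> nat) \<Rightarrow> complex" where
  "wave_sum \<alpha> n \<eta> = (\<Sum>x\<in>{1..n}. of_nat (\<eta> x) * cis (\<alpha> * real x))"

text \<open>The pairing of the empirical measure with \<open>cis (2 * pi * k * u)\<close>. With this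
  sign a left shift of the configuration multiplies the mode by
  \<open>cis (- 2 * pi * k / n)\<close>.\<close>

definition mode :: "nat \<Rightarrow> int \<Rightarrow> (nat \<Rightarrow> nat) \<Rightarrow> complex" where
  "mode n k \<eta> = wave_sum (2 * pi * of_int k / real n) n \<eta> / of_nat n"

lemma wave_sum_lessThan: "wave_sum \<alpha> n \<eta> = (\<Sum>x<n. of_nat (\<eta> (Suc x)) * cis (\<alpha> * real (Suc x)))"
  unfolding wave_sum_def One_nat_def by (rule sum.atLeast1_atMost_eq)

text \<open>A rotation shifts the summation index; the entry that wraps around gets the right phase
  because \<open>cis (\<alpha> * n) = 1\<close>.\<close>

lemma wave_sum_move_1_to_n:
  assumes "n \<ge> 1" "cis (\<alpha> * real n) = 1"
  shows "wave_sum \<alpha> n (move_1_to_n n \<eta>) = cis (- \<alpha>) * wave_sum \<alpha> n \<eta>"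
proof -
  obtain m where n: "n = Suc m" using assms(1) by (cases n) auto
  have rot: "cis (- \<alpha>) * cis (\<alpha> * real (Suc x)) = cis (\<alpha> * real x)" for x
    by (simp add: cis_mult algebra_simps)
  have "wave_sum \<alpha> n (move_1_to_n n \<eta>) = (\<Sum>x<m. of_nat (\<eta> (Suc (Suc x))) * cis (\<alpha> * real (Suc x))) + of_nat (\<eta> 1)"
    using assms(2) unfolding wave_sum_lessThan n by (simp add: move_1_to_n_def)
  moreover have "cis (- \<alpha>) * wave_sum \<alpha> n \<eta> = (\<Sum>x<Suc m. of_nat (\<eta> (Suc x)) * cis (\<alpha> * real x))"
    unfolding wave_sum_lessThan n sum_distrib_left
    by (simp only: mult.left_commute[of "cis (- \<alpha>)"] rot)
  moreover have "\<dots> = of_nat (\<eta> 1) + (\<Sum>x<m. of_nat (\<eta> (Suc (Suc x))) * cis (\<alpha> * real (Suc x)))"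
    unfolding sum.lessThan_Suc_shift by simp
  ultimately show ?thesis by (simp add: add.commute)
qed

lemma wave_sum_move_n_to_1:
  assumes "n \<ge> 1" "cis (\<alpha> * real n) = 1"
  shows "wave_sum \<alpha> n (move_n_to_1 n \<eta>) = cis \<alpha> * wave_sum \<alpha> n \<eta>"
proof -
  obtain m where n: "n = Suc m" using assms(1) by (cases n) auto
  have rot: "cis \<alpha> * cis (\<alpha> * real x) = cis (\<alpha> * real (Suc x))" for x
    by (simp add: cis_mult algebra_simps)
  have "wave_sum \<alpha> n (move_n_to_1 n \<eta>) = of_nat (\<eta> n) * cis \<alpha> + (\<Sum>x<m. of_nat (\<eta> (Suc x)) * cis (\<alpha> * real (Suc (Suc x))))"
    unfolding wave_sum_lessThan n sum.lessThan_Suc_shift by (simp add: move_n_to_1_def)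
  moreover have "cis \<alpha> * wave_sum \<alpha> n \<eta> = (\<Sum>x<Suc m. of_nat (\<eta> (Suc x)) * cis (\<alpha> * real (Suc (Suc x))))"
    unfolding wave_sum_lessThan n sum_distrib_left
    by (simp only: mult.left_commute[of "cis \<alpha>"] rot)
  moreover have "cis (\<alpha> * real (Suc (Suc m))) = cis \<alpha>"
    using rot[of "Suc m"] assms(2) n by simp
  ultimately show ?thesis by (simp add: n)
qed

text \<open>Only two summands change, and neighbouring phases differ by at most
  \<open>\<bar>\<alpha>\<bar>\<close>. The general position serves two comparisons:
  \<open>swap_1_2\<close> with the identity, and \<open>move_1_to_pred_n\<close> with
  \<open>move_1_to_n\<close>.\<close>

lemma wave_sum_adjacent_swap:
  assumes x: "1 \<le> x" "x < n" and \<eta>: "\<And>y. y \<in> {1..n} \<Longrightarrow> \<eta> y \<le> 1"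
    and swap: "\<eta>' x = \<eta> (Suc x)" "\<eta>' (Suc x) = \<eta> x" "\<And>y. y \<in> {1..n} \<Longrightarrow> y \<noteq> x \<Longrightarrow> y \<noteq> Suc x \<Longrightarrow> \<eta>' y = \<eta> y"
  shows "cmod (wave_sum \<alpha> n \<eta>' - wave_sum \<alpha> n \<eta>) \<le> \<bar>\<alpha>\<bar>"
proof -
  let ?c = "of_nat (\<eta> (Suc x)) - of_nat (\<eta> x) :: complex"
  have "wave_sum \<alpha> n \<eta>' - wave_sum \<alpha> n \<eta> = (\<Sum>y\<in>{1..n}. (of_nat (\<eta>' y) - of_nat (\<eta> y)) * cis (\<alpha> * real y))"
    by (simp add: wave_sum_def sum_subtractf left_diff_distrib)
  also have "\<dots> = (\<Sum>y\<in>{x, Suc x}. (of_nat (\<eta>' y) - of_nat (\<eta> y)) * cis (\<alpha> * real y))"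
    using x swap(3) by (intro sum.mono_neutral_right) auto
  also have "\<dots> = ?c * (cis (\<alpha> * real x) - cis (\<alpha> * real (Suc x)))"
    using swap(1,2) by (simp add: algebra_simps)
  also have "cis (\<alpha> * real x) - cis (\<alpha> * real (Suc x)) = - (cis (\<alpha> * real x) * (cis \<alpha> - 1))"
    by (simp add: cis_mult[symmetric] algebra_simps)
  finally have "cmod (wave_sum \<alpha> n \<eta>' - wave_sum \<alpha> n \<eta>) = cmod ?c * cmod (cis \<alpha> - 1)"
    by (simp add: norm_mult)
  also have "\<dots> \<le> 1 * \<bar>\<alpha>\<bar>"
  proof (intro mult_mono cis_approx)
    have "\<eta> x \<le> 1" "\<eta> (Suc x) \<le> 1" using \<eta> x by auto
    then have "\<eta> x = 0 \<or> \<eta> x = 1" "\<eta> (Suc x) = 0 \<or> \<eta> (Suc x) = 1" by auto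
    then show "cmod ?c \<le> 1" by auto
  qed auto
  finally show ?thesis by simp
qed

lemma Omega_le_1: "\<eta> \<in> Omega n \<Longrightarrow> y \<in> {1..n} \<Longrightarrow> \<eta> y \<le> 1"
  unfolding Omega_def by (drule (1) PiE_mem) auto

lemma finite_Omega: "finite (Omega n)"
  unfolding Omega_def by (intro finite_PiE) auto

lemma mode_bound: assumes "\<eta> \<in> Omega n" shows "cmod (mode n k \<eta>) \<le> 1"
proof -
  have "cmod (wave_sum \<alpha> n \<eta>) \<le> (\<Sum>x\<in>{1..n}. 1)" for \<alpha>
    unfolding wave_sum_def
  proof (rule sum_norm_le)
    fix x assume "x \<in> {1..n}"
    then have "\<eta> x \<le> 1" by (rule Omega_le_1[OF assms])
    then show "cmod (of_nat (\<eta> x) * cis (\<alpha> * real x)) \<le> 1" by (simp add: norm_mult)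
  qed
  then have "cmod (wave_sum \<alpha> n \<eta>) \<le> real n" for \<alpha> by simp
  then show ?thesis unfolding mode_def norm_divide norm_of_nat
    by (cases "n = 0") (simp_all add: divide_le_eq)
qed

section \<open>Generator estimates for one Fourier mode\<close>

context
  fixes n :: nat and k :: int and a b c d :: real and \<alpha> :: real
  assumes n: "n \<ge> 2" and rates: "a \<in> {0..1}" "b \<in> {0..1}" "c \<in> {0..1}" "d \<in> {0..1}"
  defines "\<alpha> \<equiv> 2 * pi * of_int k / real n"
begin

private lemma cis_n: "cis (\<alpha> * real n) = 1"
  using n by (simp add: \<alpha>_def)

private lemma n1: "n \<ge> 1" using n by simp

private lemma mode_eq: "mode n k \<eta> = wave_sum \<alpha> n \<eta> / of_nat n"
  by (simp add: mode_def \<alpha>_def)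

private lemma mode_left: "mode n k (move_1_to_n n \<eta>) = cis (- \<alpha>) * mode n k \<eta>"
  by (simp add: mode_eq wave_sum_move_1_to_n[OF n1 cis_n])

private lemma mode_right: "mode n k (move_n_to_1 n \<eta>) = cis \<alpha> * mode n k \<eta>"
  by (simp add: mode_eq wave_sum_move_n_to_1[OF n1 cis_n])

private lemma mode_swap:
  assumes "\<eta> \<in> Omega n" shows "cmod (mode n k (swap_1_2 \<eta>) - mode n k \<eta>) \<le> \<bar>\<alpha>\<bar> / real n"
proof -
  have "cmod (wave_sum \<alpha> n (swap_1_2 \<eta>) - wave_sum \<alpha> n \<eta>) \<le> \<bar>\<alpha>\<bar>"
    using n by (intro wave_sum_adjacent_swap[of 1] Omega_le_1[OF assms]) (auto simp: swap_1_2_def numeral_2_eq_2)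
  then show ?thesis
    by (simp add: mode_eq norm_divide divide_right_mono flip: diff_divide_distrib)
qed

text \<open>Moving the first entry to position \<open>n - 1\<close> amounts to moving it to position
  \<open>n\<close> and then swapping the last two positions.\<close>

private lemma mode_pred:
  assumes \<eta>: "\<eta> \<in> Omega n"
  shows "cmod (mode n k (move_1_to_pred_n n \<eta>) - cis (- \<alpha>) * mode n k \<eta>) \<le> \<bar>\<alpha>\<bar> / real n"
proof -
  have "move_1_to_n n \<eta> y \<le> 1" if "y \<in> {1..n}" for y
    using that Omega_le_1[OF \<eta>, of "y + 1"] Omega_le_1[OF \<eta>, of 1] n by (auto simp: move_1_to_n_def)
  then have "cmod (wave_sum \<alpha> n (move_1_to_pred_n n \<eta>) - wave_sum \<alpha> n (move_1_to_n n \<eta>)) \<le> \<bar>\<alpha>\<bar>"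
    using n by (intro wave_sum_adjacent_swap[of "n - 1"]) (auto simp: move_1_to_pred_n_def move_1_to_n_def)
  then show ?thesis unfolding mode_left[symmetric]
    by (simp add: mode_eq norm_divide divide_right_mono flip: diff_divide_distrib)
qed

text \<open>The two moves involving a swap have rate at most 1 and cost
  \<open>\<bar>\<alpha>\<bar> / n\<close> each. Linearising the rotations costs
  \<open>\<alpha>\<^sup>2 / 2\<close> per unit of rate, and the total rate \<open>a + b + c\<close>
  is at most 3.\<close>

lemma mode_generator_bias:
  assumes \<eta>: "\<eta> \<in> Omega n"
  shows "cmod (Complex (gen n a b c d (\<lambda>\<xi>. Re (mode n k \<xi>)) \<eta>) (gen n a b c d (\<lambda>\<xi>. Im (mode n k \<xi>)) \<eta>)
      - \<i> * of_real (- (2 * pi * of_int k / real n) * (a + b - c)) * mode n k \<eta>)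
    \<le> 2 * \<bar>2 * pi * of_int k / real n\<bar> / real n + 3 * (2 * pi * of_int k / real n)\<^sup>2 / 2"
proof -
  let ?Z = "mode n k \<eta>"
  \<comment> \<open>\<open>?e1\<close> and \<open>?e2\<close> are the errors of the two swaps,
    \<open>?l\<close> and \<open>?r\<close> the second-order remainders of the left and right
    rotation; the first-order parts add up to the drift
    \<open>- \<alpha> * (a + b - c)\<close>.\<close>
  let ?e1 = "mode n k (move_1_to_pred_n n \<eta>) - cis (- \<alpha>) * ?Z"
  let ?e2 = "mode n k (swap_1_2 \<eta>) - ?Z"
  let ?l = "cis (- \<alpha>) - 1 - \<i> * of_real (- \<alpha>)" and ?r = "cis \<alpha> - 1 - \<i> * of_real \<alpha>"
  have "Complex (gen n a b c d (\<lambda>\<xi>. Re (mode n k \<xi>)) \<eta>) (gen n a b c d (\<lambda>\<xi>. Im (mode n k \<xi>)) \<eta>)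
    = a * (mode n k (move_1_to_pred_n n \<eta>) - ?Z) + b * (cis (- \<alpha>) * ?Z - ?Z) + c * (cis \<alpha> * ?Z - ?Z) + d * ?e2"
    unfolding mode_left[symmetric] mode_right[symmetric] by (simp add: gen_def complex_eq_iff)
  then have eq: "Complex (gen n a b c d (\<lambda>\<xi>. Re (mode n k \<xi>)) \<eta>) (gen n a b c d (\<lambda>\<xi>. Im (mode n k \<xi>)) \<eta>)
      - \<i> * of_real (- \<alpha> * (a + b - c)) * ?Z = a * ?e1 + d * ?e2 + (a + b) * (?l * ?Z) + c * (?r * ?Z)"
    by (simp add: algebra_simps)
  have "cmod (a * ?e1 + d * ?e2 + (a + b) * (?l * ?Z) + c * (?r * ?Z)) \<le> cmod (a * ?e1) + cmod (d * ?e2) + cmod ((a + b) * (?l * ?Z)) + cmod (c * (?r * ?Z))"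
    by (rule order_trans[OF norm_triangle_ineq add_mono[OF order_trans[OF norm_triangle_ineq
            add_mono[OF norm_triangle_ineq order_refl]] order_refl]])
  moreover have "cmod (a * ?e1) \<le> 1 * (\<bar>\<alpha>\<bar> / real n)"
    unfolding norm_mult using rates mode_pred[OF \<eta>] by (intro mult_mono) auto
  moreover have "cmod (d * ?e2) \<le> 1 * (\<bar>\<alpha>\<bar> / real n)"
    unfolding norm_mult using rates mode_swap[OF \<eta>] by (intro mult_mono) auto
  moreover have "cmod ((a + b) * (?l * ?Z)) \<le> 2 * (\<alpha>\<^sup>2 / 2 * 1)"
  proof -
    have "cmod ?l \<le> \<alpha>\<^sup>2 / 2" using cis_approx(2)[of "- \<alpha>"] by simp
    moreover have "cmod (complex_of_real a + of_real b) \<le> 2"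
      using rates unfolding of_real_add[symmetric] norm_of_real by auto
    ultimately show ?thesis unfolding norm_mult using mode_bound[OF \<eta>, of k]
      by (intro mult_mono) auto
  qed
  moreover have "cmod (c * (?r * ?Z)) \<le> 1 * (\<alpha>\<^sup>2 / 2 * 1)"
    unfolding norm_mult using rates mode_bound[OF \<eta>, of k] cis_approx(2)[of \<alpha>] by (intro mult_mono) auto
  ultimately have "cmod (Complex (gen n a b c d (\<lambda>\<xi>. Re (mode n k \<xi>)) \<eta>) (gen n a b c d (\<lambda>\<xi>. Im (mode n k \<xi>)) \<eta>)
      - \<i> * of_real (- \<alpha> * (a + b - c)) * ?Z) \<le> 1 * (\<bar>\<alpha>\<bar> / real n) + 1 * (\<bar>\<alpha>\<bar> / real n) + 2 * (\<alpha>\<^sup>2 / 2 * 1) + 1 * (\<alpha>\<^sup>2 / 2 * 1)"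
    unfolding eq by linarith
  then show ?thesis unfolding \<alpha>_def by simp
qed

text \<open>A rotation moves the mode by at most \<open>\<bar>\<alpha>\<bar>\<close>, a swap by at
  most \<open>\<bar>\<alpha>\<bar> / n\<close>, and the move to position \<open>n - 1\<close> by
  their sum, bounded by \<open>2 * \<bar>\<alpha>\<bar>\<close>. Hence
  \<open>2 * (4 + 1 + 1 + 1) = 14\<close>.\<close>

lemma mode_generator_spread:
  assumes \<eta>: "\<eta> \<in> Omega n"
  shows "2 * gen n a b c d (\<lambda>\<xi>. (cmod (mode n k \<xi> - mode n k \<eta>))\<^sup>2) \<eta> \<le> 14 * (2 * pi * of_int k / real n)\<^sup>2"
proof -
  let ?Z = "mode n k \<eta>"
  have rot: "cmod (cis (- \<alpha>) * ?Z - ?Z) \<le> \<bar>\<alpha>\<bar>" "cmod (cis \<alpha> * ?Z - ?Z) \<le> \<bar>\<alpha>\<bar>"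
  proof -
    have "cmod (cis \<beta> * ?Z - ?Z) \<le> \<bar>\<beta>\<bar> * 1" for \<beta>
    proof -
      have "cis \<beta> * ?Z - ?Z = (cis \<beta> - 1) * ?Z" by (simp add: algebra_simps)
      then show ?thesis using cis_approx(1)[of \<beta>] mode_bound[OF \<eta>, of k]
        by (simp only: norm_mult) (intro mult_mono, auto)
    qed
    from this[of "- \<alpha>"] this[of \<alpha>] show "cmod (cis (- \<alpha>) * ?Z - ?Z) \<le> \<bar>\<alpha>\<bar>" "cmod (cis \<alpha> * ?Z - ?Z) \<le> \<bar>\<alpha>\<bar>" by simp_all
  qed
  have small: "\<bar>\<alpha>\<bar> / real n \<le> \<bar>\<alpha>\<bar>" using n by (simp add: divide_le_eq mult_le_cancel_left1)
  have 1: "cmod (mode n k (move_1_to_pred_n n \<eta>) - ?Z) \<le> 2 * \<bar>\<alpha>\<bar>"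
    using norm_triangle_ineq[of "mode n k (move_1_to_pred_n n \<eta>) - cis (- \<alpha>) * ?Z" "cis (- \<alpha>) * ?Z - ?Z"]
      mode_pred[OF \<eta>] rot(1) small by simp
  have 2: "cmod (mode n k (swap_1_2 \<eta>) - ?Z) \<le> \<bar>\<alpha>\<bar>" using mode_swap[OF \<eta>] small by linarith
  have quad: "r * (cmod w)\<^sup>2 \<le> 1 * C\<^sup>2" if "r \<in> {0..1}" "cmod w \<le> C" for r w C
    using that by (intro mult_mono power_mono) auto
  have "gen n a b c d (\<lambda>\<xi>. (cmod (mode n k \<xi> - ?Z))\<^sup>2) \<eta>
    = a * (cmod (mode n k (move_1_to_pred_n n \<eta>) - ?Z))\<^sup>2 + b * (cmod (cis (- \<alpha>) * ?Z - ?Z))\<^sup>2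
      + c * (cmod (cis \<alpha> * ?Z - ?Z))\<^sup>2 + d * (cmod (mode n k (swap_1_2 \<eta>) - ?Z))\<^sup>2"
    by (simp add: gen_def mode_left mode_right)
  also have "\<dots> \<le> 1 * (2 * \<bar>\<alpha>\<bar>)\<^sup>2 + 1 * \<bar>\<alpha>\<bar>\<^sup>2 + 1 * \<bar>\<alpha>\<bar>\<^sup>2 + 1 * \<bar>\<alpha>\<bar>\<^sup>2"
    by (intro add_mono quad rates 1 2 rot)
  finally show ?thesis unfolding \<alpha>_def[symmetric] by (simp add: power_mult_distrib)
qed

end

text \<open>\<open>n\<^sup>2 (4 B + V)\<close> for bounds \<open>B\<close> and \<open>V\<close> slightly above those of the two preceding lemmas.\<close>

definition mode_const :: "int \<Rightarrow> real" where
  "mode_const k = 4 * (4 * pi * \<bar>of_int k\<bar> + 6 * pi\<^sup>2 * (of_int k)\<^sup>2 + 1) + (56 * pi\<^sup>2 * (of_int k)\<^sup>2 + 1)"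

text \<open>In the time of the original chain the horizon is \<open>T * n\<close>, while
  \<open>B\<close> and \<open>V\<close> are of order \<open>1 / n\<^sup>2\<close>; the product
  leaves \<open>1 / n\<close>.\<close>

lemma mode_deviation:
  assumes n: "n \<ge> 2" and rates: "a \<in> {0..1}" "b \<in> {0..1}" "c \<in> {0..1}" "d \<in> {0..1}"
    and chain: "markov_chain M X (Omega n) (gen n a b c d) \<mu>" and \<mu>: "set_pmf \<mu> \<subseteq> Omega n"
    and T: "T > 0" and e: "e > 0"
  shows "\<exists>A\<in>sets M. measure M A \<le> 2 * T * mode_const k / (real n * e\<^sup>2) \<and>
    (\<forall>w\<in>space M - A. \<forall>t\<in>{0..T}.
       cmod (mode n k (X (t * real n) w) - cis (- (2 * pi * of_int k * (a + b - c) * t)) * mode n k (X 0 w)) \<le> 2 * e)"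
proof -
  define \<alpha> where "\<alpha> = 2 * pi * of_int k / real n"
  \<comment> \<open>The extra \<open>+ 1\<close> in \<open>B\<close> and \<open>V\<close> makes the
    bounds strict, even for \<open>k = 0\<close>, where the estimates themselves vanish.\<close>
  define B where "B = (4 * pi * \<bar>of_int k\<bar> + 6 * pi\<^sup>2 * (of_int k)\<^sup>2 + 1) / (real n)\<^sup>2"
  define V where "V = (56 * pi\<^sup>2 * (of_int k)\<^sup>2 + 1) / (real n)\<^sup>2"
  have n0: "real n > 0" using n by simp
  have B: "2 * \<bar>\<alpha>\<bar> / real n + 3 * \<alpha>\<^sup>2 / 2 < B"
  proof -
    have "2 * \<bar>\<alpha>\<bar> / real n + 3 * \<alpha>\<^sup>2 / 2 = (4 * pi * \<bar>of_int k\<bar> + 6 * pi\<^sup>2 * (of_int k)\<^sup>2) / (real n)\<^sup>2"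
      using n0 by (simp add: \<alpha>_def abs_mult power_divide power_mult_distrib power2_eq_square add_divide_distrib)
    also have "\<dots> < B" unfolding B_def using n0 by (intro divide_strict_right_mono) auto
    finally show ?thesis .
  qed
  have V: "14 * \<alpha>\<^sup>2 < V"
  proof -
    have "14 * \<alpha>\<^sup>2 = (56 * pi\<^sup>2 * (of_int k)\<^sup>2) / (real n)\<^sup>2"
      by (simp add: \<alpha>_def power_divide power_mult_distrib)
    also have "\<dots> < V" unfolding V_def using n0 by (intro divide_strict_right_mono) auto
    finally show ?thesis .
  qed
  have "\<exists>A\<in>sets M. measure M A \<le> 2 * ((T * real n) * (4 * B + V) / e\<^sup>2) \<and>
      (\<forall>w\<in>space M - A. \<forall>s\<in>{0..T * real n}. cmod (mode n k (X s w) - cis (s * (- \<alpha> * (a + b - c))) * mode n k (X 0 w)) \<le> 2 * e)"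
    proof (rule chain_deviation[OF chain finite_Omega \<mu> mode_bound])
      show "cmod (Complex (gen n a b c d (\<lambda>\<xi>. Re (mode n k \<xi>)) \<eta>) (gen n a b c d (\<lambda>\<xi>. Im (mode n k \<xi>)) \<eta>)
          - \<i> * of_real (- \<alpha> * (a + b - c)) * mode n k \<eta>) < B" if "\<eta> \<in> Omega n" for \<eta>
        using mode_generator_bias[OF n rates that, of k] B unfolding \<alpha>_def by linarith
      show "2 * gen n a b c d (\<lambda>\<xi>. (cmod (mode n k \<xi> - mode n k \<eta>))\<^sup>2) \<eta> < V" if "\<eta> \<in> Omega n" for \<eta>
        using mode_generator_spread[OF n rates that, of k] V unfolding \<alpha>_def by linarith
    qed (use T n0 e in auto)
  then obtain A where A: "A \<in> sets M" "measure M A \<le> 2 * ((T * real n) * (4 * B + V) / e\<^sup>2)"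
    "\<forall>w\<in>space M - A. \<forall>s\<in>{0..T * real n}. cmod (mode n k (X s w) - cis (s * (- \<alpha> * (a + b - c))) * mode n k (X 0 w)) \<le> 2 * e"
    by blast
  have "2 * ((T * real n) * (4 * B + V) / e\<^sup>2) = 2 * T * mode_const k / (real n * e\<^sup>2)"
  proof -
    have "4 * B + V = mode_const k / (real n)\<^sup>2" by (simp add: B_def V_def mode_const_def add_divide_distrib)
    then show ?thesis using n0 by (simp add: power2_eq_square)
  qed
  moreover have "cmod (mode n k (X (t * real n) w) - cis (- (2 * pi * of_int k * (a + b - c) * t)) * mode n k (X 0 w)) \<le> 2 * e"
    if w: "w \<in> space M - A" and t: "t \<in> {0..T}" for w t
  proof -
    have eq: "t * real n * (- \<alpha> * (a + b - c)) = - (2 * pi * of_int k * (a + b - c) * t)"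
      using n0 by (simp add: \<alpha>_def)
    have "t * real n \<in> {0..T * real n}" using t by (auto intro: mult_right_mono)
    then show ?thesis using A(3)[rule_format, OF w, of "t * real n"] unfolding eq by blast
  qed
  ultimately show ?thesis using A(1,2) by (intro bexI[of _ A] conjI ballI) simp_all
qed

section \<open>The transport equation\<close>

lemma profileD:
  assumes "profile h" shows "h \<in> bdd_fun" "periodic h" "\<And>u. 0 \<le> h u" "\<And>u. h u \<le> 1"
proof -
  show "h \<in> bdd_fun" using assms by (intro bdd_funI[of _ 1]) (auto simp: profile_def)
qed (use assms in \<open>auto simp: profile_def\<close>)

lemma C1_torusD:
  assumes "f \<in> C1_torus"
  shows "periodic f" "(f has_real_derivative deriv f u) (at u)" "continuous_on UNIV (deriv f)"
    "periodic (deriv f)" "f \<in> bdd_fun" "deriv f \<in> bdd_fun"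
proof -
  show per: "periodic f" and cont': "continuous_on UNIV (deriv f)" using assms by (auto simp: C1_torus_def)
  show d: "(f has_real_derivative deriv f u) (at u)" for u
    using assms by (auto simp: C1_torus_def field_differentiable_derivI)
  then have "continuous_on UNIV f" by (meson DERIV_isCont continuous_at_imp_continuous_on)
  then show "f \<in> bdd_fun" by (rule continuous_periodic_bdd_fun[OF per])
  show per': "periodic (deriv f)"
    unfolding periodic_def
  proof
    fix u
    have "((\<lambda>x. f (x + 1)) has_real_derivative deriv f (u + 1)) (at u)"
      using d[of "u + 1"] by (simp add: DERIV_shift)
    then have "(f has_real_derivative deriv f (u + 1)) (at u)"
      using per by (simp add: periodic_def)
    then show "deriv f (u + 1) = deriv f u" by (simp add: DERIV_imp_deriv)
  qed
  then show "deriv f \<in> bdd_fun" by (rule continuous_periodic_bdd_fun[OF _ cont'])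
qed

lemma periodic_shift: "periodic f \<Longrightarrow> periodic (\<lambda>u. f (u + s))"
  unfolding periodic_def by (metis add.assoc add.commute)

lemma bdd_fun_shift: "f \<in> bdd_fun \<Longrightarrow> (\<lambda>u. f (u + s)) \<in> bdd_fun"
  unfolding bdd_fun_def by auto

lemma tinner_shift:
  assumes f: "f \<in> bdd_fun" "periodic f" and g: "g \<in> bdd_fun" "periodic g"
  shows "tinner (\<lambda>u. f (u + s)) g = tinner f (\<lambda>u. g (u + - s))"
proof -
  have b: "(\<lambda>u. f u * g (u + - s)) \<in> bdd_fun" by (intro bdd_fun_mult f bdd_fun_shift g)
  have "periodic (\<lambda>u. g (u + - s))" by (rule periodic_shift[OF g(2)])
  then have p: "periodic (\<lambda>u. f u * g (u + - s))" using f(2) unfolding periodic_def by simp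
  show ?thesis unfolding tinner_def using torus_integral_shift[OF b p, of s] by simp
qed

lemma id_torus_measurable [measurable]: "(\<lambda>u. u) \<in> measurable torus borel"
  by (simp add: torus_def measurable_restrict_space1)

lemma interval_integral_eq:
  fixes f :: "real \<Rightarrow> real"
  shows "(LINT s:{0..t}|lborel. f s) = (\<integral>s. f s \<partial>restrict_space lborel {0..t})"
  unfolding set_lebesgue_integral_def by (subst integral_restrict_space) auto

lemma interval_integral_indicator:
  fixes f :: "real \<Rightarrow> real"
  shows "(\<integral>s. f s \<partial>restrict_space lborel {0..t}) = (\<integral>s. indicator {0..t} s *\<^sub>R f s \<partial>lborel)"
  by (subst integral_restrict_space) auto

lemma finite_interval: "finite_measure (restrict_space lborel {0..t::real})"
  by (rule finite_measureI) (simp add: emeasure_restrict_space space_restrict_space emeasure_lborel_Icc_eq)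

text \<open>The profile is only measurable, so the translation is moved to the test function. After
  exchanging the integrals, the time integral of \<open>deriv f\<close> along
  \<open>v - \<theta> * s\<close> is computed for each \<open>v\<close> by the fundamental
  theorem.\<close>

lemma weak_solution_exists:
  assumes g: "profile g"
  shows "weak_solution T \<theta> g (\<lambda>t u. g (u + \<theta> * t))"
  unfolding weak_solution_def
proof (intro conjI ballI)
  note g' = profileD[OF g]
  have gm[measurable]: "g \<in> borel_measurable borel" using g by (simp add: profile_def)
  show "periodic (\<lambda>u. g (u + \<theta> * t))" for t by (rule periodic_shift[OF g'(2)])
  show "\<forall>u. g (u + \<theta> * t) \<in> {0..1}" for t using g by (auto simp: profile_def)
  have "(\<lambda>x. g (snd x + \<theta> * fst x)) \<in> borel_measurable (borel \<Otimes>\<^sub>M borel)" by measurable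
  then have "(\<lambda>x::real \<times> real. g (snd x + \<theta> * fst x)) \<in> borel_measurable borel" by (simp add: borel_prod)
  then show "(\<lambda>(t, u). g (u + \<theta> * t)) \<in> borel_measurable (restrict_space borel ({0..T} \<times> UNIV))"
    unfolding split_beta by (rule measurable_restrict_space1)
next
  note g' = profileD[OF g]
  have gm[measurable]: "g \<in> borel_measurable borel" using g by (simp add: profile_def)
  fix f t assume f: "f \<in> C1_torus" and t: "t \<in> {0..T}"
  note f' = C1_torusD[OF f]
  have [measurable]: "deriv f \<in> borel_measurable borel" by (rule bdd_fun_measurable[OF f'(6)])
  obtain C where C: "\<And>u. \<bar>deriv f u\<bar> \<le> C" using f'(6) by (auto simp: bdd_fun_def)
  let ?I = "restrict_space lborel {0..t}"
  interpret I: finite_measure ?I by (rule finite_interval)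
  interpret IT: pair_sigma_finite ?I torus ..
  interpret IT': finite_measure "?I \<Otimes>\<^sub>M torus"
    by (rule finite_measure_pair_measure[OF torus.finite_measure_axioms I.finite_measure_axioms])
  have [measurable]: "(\<lambda>s. s) \<in> measurable ?I borel" by (simp add: measurable_restrict_space1)
  have "(\<lambda>x. g (snd x) * deriv f (snd x + - (\<theta> * fst x))) \<in> borel_measurable (?I \<Otimes>\<^sub>M torus)"
    by measurable
  then have int: "integrable (?I \<Otimes>\<^sub>M torus) (\<lambda>(s, v). g v * deriv f (v + - (\<theta> * s)))"
  proof (intro IT'.integrable_const_bound[of _ "1 * C"] AE_I2)
    fix x
    have "\<bar>g (snd x)\<bar> * \<bar>deriv f (snd x + - (\<theta> * fst x))\<bar> \<le> 1 * C"
      using g'(3,4) C by (intro mult_mono) auto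
    then show "norm (case x of (s, v) \<Rightarrow> g v * deriv f (v + - (\<theta> * s))) \<le> 1 * C"
      by (simp add: split_beta abs_mult)
  qed (simp add: split_beta)
  have inner: "\<theta> * (\<integral>s. g v * deriv f (v + - (\<theta> * s)) \<partial>?I) = g v * (f v - f (v + - (\<theta> * t)))" for v
  proof -
    have "\<theta> * (\<integral>s. g v * deriv f (v + - (\<theta> * s)) \<partial>?I) = (\<integral>s. indicator {0..t} s *\<^sub>R (g v * (\<theta> * deriv f (v + - (\<theta> * s)))) \<partial>lborel)"
      unfolding interval_integral_indicator[symmetric]
      by (subst integral_mult_right_zero[symmetric]) (simp add: mult_ac)
    also have "\<dots> = - (g v * f (v + - (\<theta> * t))) - - (g v * f (v + - (\<theta> * 0)))"
    proof (rule integral_FTC_atLeastAtMost)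
      fix s
      have "((\<lambda>s. - (g v * f (v + - (\<theta> * s)))) has_real_derivative g v * (\<theta> * deriv f (v + - (\<theta> * s)))) (at s)"
        by (rule derivative_eq_intros DERIV_chain2[OF f'(2)] refl | simp)+
      then show "((\<lambda>s. - (g v * f (v + - (\<theta> * s)))) has_vector_derivative g v * (\<theta> * deriv f (v + - (\<theta> * s)))) (at s within {0..t})"
        by (simp add: has_field_derivative_at_within flip: has_real_derivative_iff_has_vector_derivative)
    next
      show "continuous_on {0..t} (\<lambda>s. g v * (\<theta> * deriv f (v + - (\<theta> * s))))"
        by (intro continuous_intros continuous_on_compose2[OF f'(3)]) auto
    qed (use t in auto)
    finally show ?thesis by (simp add: algebra_simps)
  qed
  have "(\<integral>s. tinner (\<lambda>u. g (u + \<theta> * s)) (deriv f) \<partial>?I) = (\<integral>s. (\<integral>v. g v * deriv f (v + - (\<theta> * s)) \<partial>torus) \<partial>?I)"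
    unfolding tinner_shift[OF g'(1,2) f'(6,4)] unfolding tinner_def ..
  also have "\<dots> = (\<integral>v. (\<integral>s. g v * deriv f (v + - (\<theta> * s)) \<partial>?I) \<partial>torus)"
    by (rule IT.Fubini_integral[symmetric, OF int])
  finally have "\<theta> * (LINT s:{0..t}|lborel. tinner (\<lambda>u. g (u + \<theta> * s)) (deriv f))
      = (\<integral>v. \<theta> * (\<integral>s. g v * deriv f (v + - (\<theta> * s)) \<partial>?I) \<partial>torus)"
    unfolding interval_integral_eq by simp
  also have "\<dots> = tinner g (\<lambda>v. f v - f (v + - (\<theta> * t)))"
    unfolding inner tinner_def ..
  also have "\<dots> = tinner g f - tinner g (\<lambda>v. f (v + - (\<theta> * t)))"
    by (intro tinner_diff_right f' bdd_fun_shift g')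
  also have "tinner g (\<lambda>v. f (v + - (\<theta> * t))) = tinner (\<lambda>u. g (u + \<theta> * t)) f"
    by (rule tinner_shift[symmetric, OF g'(1,2) f'(5,1)])
  finally show "0 = tinner (\<lambda>u. g (u + \<theta> * t) - g u) f + \<theta> * (LINT s:{0..t}|lborel. tinner (\<lambda>u. g (u + \<theta> * s)) (deriv f))"
    by (simp add: tinner_diff_left g' f' bdd_fun_shift)
qed

section \<open>Uniqueness of weak solutions\<close>

lemma weak_solutionD:
  assumes "weak_solution T \<theta> g \<rho>" and t: "t \<in> {0..T}"
  shows "\<rho> t \<in> bdd_fun" "periodic (\<rho> t)" "\<And>u. 0 \<le> \<rho> t u" "\<And>u. \<rho> t u \<le> 1"
proof -
  have "(\<lambda>(t, u). \<rho> t u) \<in> borel_measurable (restrict_space borel ({0..T} \<times> UNIV))"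
    using assms by (simp add: weak_solution_def)
  moreover have "(\<lambda>u::real. (t, u)) \<in> measurable borel (restrict_space borel ({0..T} \<times> UNIV))"
  proof (rule measurable_restrict_space2)
    show "(\<lambda>u::real. (t, u)) \<in> measurable borel borel"
      by (intro borel_measurable_continuous_onI continuous_intros)
  qed (use t in auto)
  ultimately have "(\<lambda>u. (\<lambda>(t, u). \<rho> t u) (t, u)) \<in> borel_measurable borel"
    by (rule measurable_compose[rotated])
  then have m: "\<rho> t \<in> borel_measurable borel" by simp
  show "periodic (\<rho> t)" "\<And>u. 0 \<le> \<rho> t u" "\<And>u. \<rho> t u \<le> 1" using assms by (auto simp: weak_solution_def)
  then show "\<rho> t \<in> bdd_fun" using m by (intro bdd_funI[of _ 1]) auto
qed

lemma weak_solution_tinner_integrable: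
  assumes w: "weak_solution T \<theta> g \<rho>" and t: "t \<in> {0..T}" and h: "h \<in> bdd_fun"
  shows "integrable (restrict_space lborel {0..t}) (\<lambda>s. tinner (\<rho> s) h)"
proof -
  let ?I = "restrict_space lborel {0..t}"
  interpret I: finite_measure ?I by (rule finite_interval)
  \<comment> \<open>Extending by 0 outside \<open>{0..T}\<close> makes the solution measurable on
    the whole plane, where measurability of parameter integrals applies.\<close>
  define R where "R = (\<lambda>x. indicator ({0..T} \<times> UNIV) x *\<^sub>R (case x of (s, u) \<Rightarrow> \<rho> s u))"
  have "({0..T} \<times> UNIV) \<in> sets (borel :: (real \<times> real) measure)"
    unfolding borel_prod[symmetric] by (intro pair_measureI) auto
  then have "R \<in> borel_measurable borel"
    using w unfolding weak_solution_def R_def by (subst (asm) borel_measurable_restrict_space_iff) auto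
  then have [measurable]: "R \<in> borel_measurable (borel \<Otimes>\<^sub>M borel)" by (simp add: borel_prod)
  have [measurable]: "h \<in> borel_measurable borel" by (rule bdd_fun_measurable[OF h])
  have [measurable]: "(\<lambda>s. s) \<in> measurable ?I borel" by (simp add: measurable_restrict_space1)
  have "(\<lambda>s. \<integral>u. R (s, u) * h u \<partial>torus) \<in> borel_measurable ?I" by measurable
  moreover have eq: "(\<integral>u. R (s, u) * h u \<partial>torus) = tinner (\<rho> s) h" if "s \<in> space ?I" for s
    using that t by (simp add: R_def tinner_def space_restrict_space)
  ultimately have "(\<lambda>s. tinner (\<rho> s) h) \<in> borel_measurable ?I"
    by (subst measurable_cong[OF eq[symmetric]])
  moreover obtain C where C: "\<And>u. \<bar>h u\<bar> \<le> C" using h by (auto simp: bdd_fun_def)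
  have "\<bar>tinner (\<rho> s) h\<bar> \<le> 1 * C" if "s \<in> space ?I" for s
  proof -
    have "s \<in> {0..T}" using that t by (simp add: space_restrict_space)
    note D = weak_solutionD[OF w this]
    show ?thesis using D(3,4) by (intro tinner_bound D(1) h C) auto
  qed
  ultimately show ?thesis by (intro I.integrable_const_bound[of _ "1 * C"] AE_I2) auto
qed

lemma cos_sin_C1:
  "(\<lambda>u. c * cos (2 * pi * of_int k * u + p)) \<in> C1_torus"
  "deriv (\<lambda>u. c * cos (2 * pi * of_int k * u + p)) = (\<lambda>u. (2 * pi * of_int k) * (c * cos (2 * pi * of_int k * u + (p + pi / 2))))"
proof -
  show d: "deriv (\<lambda>u. c * cos (2 * pi * of_int k * u + p)) = (\<lambda>u. (2 * pi * of_int k) * (c * cos (2 * pi * of_int k * u + (p + pi / 2))))" for p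
    by (intro ext DERIV_imp_deriv) (auto intro!: derivative_eq_intros simp: cos_add sin_add algebra_simps)
  have "(\<lambda>u. c * cos (2 * pi * of_int k * u + p)) \<in> Cinf_torus" by (rule Cinf_wave)
  then show "(\<lambda>u. c * cos (2 * pi * of_int k * u + p)) \<in> C1_torus"
    unfolding C1_torus_def using Cinf_torusD(1,2) Cinf_torusD(3)[OF Cinf_deriv]
    by (auto simp: field_differentiable_def)
qed

lemma interval_integral_power:
  fixes L t :: real
  assumes "0 \<le> t"
  shows "(\<integral>s. L * ((L * s) ^ j / fact j) \<partial>restrict_space lborel {0..t}) = (L * t) ^ Suc j / fact (Suc j)"
proof -
  have "(\<integral>s. L * ((L * s) ^ j / fact j) \<partial>restrict_space lborel {0..t}) = (\<integral>s. indicator {0..t} s *\<^sub>R (L * ((L * s) ^ j / fact j)) \<partial>lborel)"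
    by (rule interval_integral_indicator)
  also have "\<dots> = (L * t) ^ Suc j / fact (Suc j) - (L * 0) ^ Suc j / fact (Suc j)"
  proof (rule integral_FTC_atLeastAtMost[OF assms])
    fix s
    have "((\<lambda>s. (L * s) ^ Suc j / fact (Suc j)) has_real_derivative ((1 + real j) * (L * (L * s) ^ j)) / fact (Suc j)) (at s)"
      by (intro DERIV_cdivide DERIV_power_Suc DERIV_cmult_Id)
    moreover have "((1 + real j) * (L * (L * s) ^ j)) / fact (Suc j) = L * ((L * s) ^ j / fact j)"
    proof -
      have "fact (Suc j) = (1 + real j) * fact j" by simp
      then show ?thesis by (simp del: fact_Suc)
    qed
    ultimately show "((\<lambda>s. (L * s) ^ Suc j / fact (Suc j)) has_vector_derivative L * ((L * s) ^ j / fact j)) (at s within {0..t})"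
      by (simp add: has_field_derivative_at_within flip: has_real_derivative_iff_has_vector_derivative)
  qed (intro continuous_intros, simp)
  finally show ?thesis by simp
qed

text \<open>Every Fourier mode of the difference of two solutions solves a homogeneous linear integral equation;
  iterating it gives the bounds \<open>(L t)\<^sup>j / j!\<close>.\<close>

lemma weak_solution_unique:
  assumes g: "profile g" and w: "weak_solution T \<theta> g \<rho>" and w': "weak_solution T \<theta> g \<rho>'" and t: "t \<in> {0..T}"
  shows "AE u in torus. \<rho>' t u = \<rho> t u"
proof -
  define W where "W s = (\<lambda>u. \<rho>' s u - \<rho> s u)" for s
  have Wb: "W s \<in> bdd_fun" "\<And>u. \<bar>W s u\<bar> \<le> 1" if "s \<in> {0..T}" for s
  proof -
    note D = weak_solutionD[OF w that] and D' = weak_solutionD[OF w' that]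
    show "W s \<in> bdd_fun" unfolding W_def by (intro bdd_fun_diff D D')
    show "\<bar>W s u\<bar> \<le> 1" for u unfolding W_def using D(3,4)[of u] D'(3,4)[of u] by (simp add: abs_le_iff)
  qed
  have eqn: "tinner (W t) f = - \<theta> * (\<integral>s. tinner (W s) (deriv f) \<partial>restrict_space lborel {0..t})"
    if t: "t \<in> {0..T}" and f: "f \<in> C1_torus" for f t
  proof -
    note f' = C1_torusD[OF f] and D = weak_solutionD[OF w] and D' = weak_solutionD[OF w']
    let ?I = "restrict_space lborel {0..t}"
    have "0 = tinner (\<lambda>u. \<rho> t u - g u) f + \<theta> * (\<integral>s. tinner (\<rho> s) (deriv f) \<partial>?I)"
      "0 = tinner (\<lambda>u. \<rho>' t u - g u) f + \<theta> * (\<integral>s. tinner (\<rho>' s) (deriv f) \<partial>?I)"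
      using w w' t f unfolding weak_solution_def interval_integral_eq by blast+
    then have "tinner (\<rho>' t) f - tinner (\<rho> t) f = - \<theta> * ((\<integral>s. tinner (\<rho>' s) (deriv f) \<partial>?I) - (\<integral>s. tinner (\<rho> s) (deriv f) \<partial>?I))"
      by (simp add: tinner_diff_left D[OF t] D'[OF t] profileD[OF g] f' algebra_simps)
    also have "(\<integral>s. tinner (\<rho>' s) (deriv f) \<partial>?I) - (\<integral>s. tinner (\<rho> s) (deriv f) \<partial>?I)
      = (\<integral>s. tinner (\<rho>' s) (deriv f) - tinner (\<rho> s) (deriv f) \<partial>?I)"
      by (intro Bochner_Integration.integral_diff[symmetric] weak_solution_tinner_integrable[OF w t f'(6)]
          weak_solution_tinner_integrable[OF w' t f'(6)])
    also have "\<dots> = (\<integral>s. tinner (W s) (deriv f) \<partial>?I)"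
    proof (rule Bochner_Integration.integral_cong[OF refl])
      fix s assume "s \<in> space ?I"
      then have s: "s \<in> {0..T}" using t by (simp add: space_restrict_space)
      show "tinner (\<rho>' s) (deriv f) - tinner (\<rho> s) (deriv f) = tinner (W s) (deriv f)"
        unfolding W_def by (intro tinner_diff_left[symmetric] D[OF s] D'[OF s] f')
    qed
    also have "tinner (\<rho>' t) f - tinner (\<rho> t) f = tinner (W t) f"
      unfolding W_def by (intro tinner_diff_left[symmetric] D[OF t] D'[OF t] f')
    finally show ?thesis .
  qed
  have zero: "tinner (W t) (\<lambda>u. 1 * cos (2 * pi * of_int k * u + p)) = 0" if t: "t \<in> {0..T}" for k p t
  proof -
    define L where "L = \<bar>\<theta>\<bar> * \<bar>2 * pi * of_int k\<bar>"
    have L0: "0 \<le> L" by (simp add: L_def)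
    let ?c = "\<lambda>p u. 1 * cos (2 * pi * of_int k * u + p)"
    \<comment> \<open>The phase \<open>p\<close> is generalised because every use of the integral
      equation differentiates the wave and so advances its phase by \<open>pi / 2\<close>, at the
      cost of the factor \<open>L\<close>: speed times frequency.\<close>
    have bnd: "\<bar>tinner (W t) (?c p)\<bar> \<le> (L * t) ^ j / fact j" if "t \<in> {0..T}" for j t p
      using that
    proof (induction j arbitrary: t p)
      case 0
      have "?c p \<in> bdd_fun" by (rule C1_torusD(5)[OF cos_sin_C1(1)])
      then have "\<bar>tinner (W t) (?c p)\<bar> \<le> 1 * 1"
        using Wb[OF 0] by (intro tinner_bound) auto
      then show ?case by simp
    next
      case (Suc j)
      let ?I = "restrict_space lborel {0..t}"
      interpret I: finite_measure ?I by (rule finite_interval)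
      have [measurable]: "(\<lambda>s. s) \<in> measurable ?I borel" by (simp add: measurable_restrict_space1)
      have "tinner (W t) (?c p) = - \<theta> * (2 * pi * of_int k) * (\<integral>s. tinner (W s) (?c (p + pi / 2)) \<partial>?I)"
      proof -
        have "tinner (W t) (?c p) = - \<theta> * (\<integral>s. tinner (W s) (deriv (?c p)) \<partial>?I)"
          by (rule eqn[OF Suc.prems cos_sin_C1(1)])
        also have "deriv (?c p) = (\<lambda>u. (2 * pi * of_int k) * ?c (p + pi / 2) u)"
          by (rule cos_sin_C1(2))
        also have "(\<lambda>s. tinner (W s) (\<lambda>u. (2 * pi * of_int k) * ?c (p + pi / 2) u)) = (\<lambda>s. (2 * pi * of_int k) * tinner (W s) (?c (p + pi / 2)))"
          by (intro ext tinner_cmult_right)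
        finally show ?thesis by simp
      qed
      then have "\<bar>tinner (W t) (?c p)\<bar> = L * \<bar>\<integral>s. tinner (W s) (?c (p + pi / 2)) \<partial>?I\<bar>"
        by (simp add: L_def abs_mult)
      also have "\<dots> \<le> L * (\<integral>s. (L * s) ^ j / fact j \<partial>?I)"
      proof (rule mult_left_mono[OF _ L0])
        have "integrable ?I (\<lambda>s. (L * s) ^ j / fact j)"
        proof (rule I.integrable_const_bound[of _ "(L * t) ^ j / fact j"])
          show "AE s in ?I. norm ((L * s) ^ j / fact j) \<le> (L * t) ^ j / fact j"
          proof (rule AE_I2)
            fix s assume "s \<in> space ?I"
            then have s: "0 \<le> s" "s \<le> t" by (auto simp: space_restrict_space)
            then have "(L * s) ^ j \<le> (L * t) ^ j" using L0 by (intro power_mono mult_left_mono) auto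
            then show "norm ((L * s) ^ j / fact j) \<le> (L * t) ^ j / fact j"
              using s L0 by (simp add: divide_right_mono)
          qed
        qed measurable
        then show "\<bar>\<integral>s. tinner (W s) (?c (p + pi / 2)) \<partial>?I\<bar> \<le> (\<integral>s. (L * s) ^ j / fact j \<partial>?I)"
        proof (intro order_trans[OF integral_abs_bound] integral_mono')
          fix s assume "s \<in> space ?I"
          then have "s \<in> {0..T}" using Suc.prems by (simp add: space_restrict_space)
          then show "\<bar>tinner (W s) (?c (p + pi / 2))\<bar> \<le> (L * s) ^ j / fact j" by (rule Suc.IH)
        next
          fix s assume "s \<in> space ?I"
          then show "0 \<le> (L * s) ^ j / fact j" using L0 by (simp add: space_restrict_space)
        qed
      qed
      also have "\<dots> = (\<integral>s. L * ((L * s) ^ j / fact j) \<partial>?I)" by simp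
      also have "\<dots> = (L * t) ^ Suc j / fact (Suc j)" using Suc.prems by (intro interval_integral_power) auto
      finally show ?case .
    qed
    have "(\<lambda>j. (L * t) ^ j / fact j) \<longlonglongrightarrow> 0"
      using summable_LIMSEQ_zero[OF summable_exp[of "L * t"]] by (simp add: field_simps)
    then have "\<bar>tinner (W t) (?c p)\<bar> \<le> 0"
      using bnd[OF t] by (intro LIMSEQ_le_const) auto
    then show ?thesis by simp
  qed
  have "tinner (W t) (psi k) = 0" for k
    unfolding psi_eq_cos tinner_cmult_right using zero[OF t, of k "if k < 0 then - pi / 2 else 0"] by simp
  then have "AE u in torus. W t u = 0" by (rule fourier_AE_zero[OF Wb(1)[OF t]])
  then show ?thesis by (simp add: W_def)
qed

section \<open>Empirical measures and densities as functionals\<close>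

lemma empirical_functional:
  assumes f: "f \<in> bdd_fun" "periodic f"
  shows "(\<integral>u. f u \<partial>empirical_measure n \<eta>) = (\<Sum>x\<in>{1..n}. f (real x / real n) * real (\<eta> x)) / real n"
proof -
  have m: "(\<lambda>x. frac (real x / real n)) \<in> measurable (point_measure {1..n} (\<lambda>x. ennreal (real (\<eta> x) / real n))) torus"
    by (simp add: measurable_def space_point_measure sets_point_measure frac_lt_1)
  have "(\<integral>u. f u \<partial>empirical_measure n \<eta>) = (\<integral>x. f (frac (real x / real n)) \<partial>point_measure {1..n} (\<lambda>x. ennreal (real (\<eta> x) / real n)))"
    unfolding empirical_measure_def by (rule integral_distr[OF m torus_measurable[OF bdd_fun_measurable[OF f(1)]]])
  also have "\<dots> = (\<Sum>x\<in>{1..n}. (real (\<eta> x) / real n) *\<^sub>R f (frac (real x / real n)))"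
    by (rule lebesgue_integral_point_measure_finite) auto
  finally show ?thesis by (simp add: periodic_frac[OF f(2)] sum_divide_distrib mult.commute)
qed

lemma empirical_H_neg:
  assumes \<eta>: "\<eta> \<in> Omega n" and m: "m \<ge> 1"
  shows "functional_of_measure (empirical_measure n \<eta>) \<in> H_neg m"
proof -
  have eq: "functional_of_measure (empirical_measure n \<eta>) f = (\<Sum>x\<in>{1..n}. f (real x / real n) * real (\<eta> x)) / real n"
    if "f \<in> Cinf_torus" for f
    using that by (simp add: functional_of_measure_def empirical_functional Cinf_torusD)
  show ?thesis
  proof (rule H_negI[OF _ m])
    show "functional_of_measure (empirical_measure n \<eta>) \<in> extensional Cinf_torus"
      by (simp add: functional_of_measure_def)
    show "functional_of_measure (empirical_measure n \<eta>) (\<lambda>u. f u + r * g u)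
      = functional_of_measure (empirical_measure n \<eta>) f + r * functional_of_measure (empirical_measure n \<eta>) g"
      if "f \<in> Cinf_torus" "g \<in> Cinf_torus" for f g r
      unfolding eq[OF Cinf_lin[OF that]] eq[OF that(1)] eq[OF that(2)]
      by (simp add: sum.distrib sum_distrib_left add_divide_distrib algebra_simps)
    show "\<bar>functional_of_measure (empirical_measure n \<eta>) f\<bar> \<le> B" if f: "f \<in> Cinf_torus" and B: "\<And>u. \<bar>f u\<bar> \<le> B" for f B
    proof -
      have B0: "0 \<le> B" using B[of 0] by linarith
      have "\<bar>\<Sum>x\<in>{1..n}. f (real x / real n) * real (\<eta> x)\<bar> \<le> (\<Sum>x\<in>{1..n}. B)"
      proof (intro order_trans[OF sum_abs] sum_mono)
        fix x assume "x \<in> {1..n}"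
        then have "\<eta> x \<le> 1" by (rule Omega_le_1[OF \<eta>])
        then have "\<bar>f (real x / real n)\<bar> * real (\<eta> x) \<le> B * 1" using B B0 by (intro mult_mono) auto
        then show "\<bar>f (real x / real n) * real (\<eta> x)\<bar> \<le> B" by (simp add: abs_mult)
      qed
      then have "\<bar>\<Sum>x\<in>{1..n}. f (real x / real n) * real (\<eta> x)\<bar> \<le> B * real n" by (simp add: mult.commute)
      then show ?thesis unfolding eq[OF f] using B0
        by (cases "n = 0") (simp_all add: divide_le_eq)
    qed
  qed
qed

lemma density_functional:
  assumes h: "h \<in> bdd_fun" "\<And>u. 0 \<le> h u" and f: "f \<in> bdd_fun"
  shows "(\<integral>u. f u \<partial>density torus (\<lambda>u. ennreal (h u))) = tinner f h"
  unfolding tinner_def using torus_measurable[OF bdd_fun_measurable[OF h(1)]] torus_measurable[OF bdd_fun_measurable[OF f]]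
  by (subst integral_density) (auto simp: h(2) mult.commute)

lemma density_H_neg:
  assumes h: "h \<in> bdd_fun" "\<And>u. 0 \<le> h u" "\<And>u. h u \<le> 1" and m: "m \<ge> 1"
  shows "functional_of_measure (density torus (\<lambda>u. ennreal (h u))) \<in> H_neg m"
proof -
  have eq: "functional_of_measure (density torus (\<lambda>u. ennreal (h u))) f = tinner f h" if "f \<in> Cinf_torus" for f
    using that by (simp add: functional_of_measure_def density_functional[OF h(1,2)] Cinf_torusD)
  show ?thesis
  proof (rule H_negI[OF _ m])
    show "functional_of_measure (density torus (\<lambda>u. ennreal (h u))) \<in> extensional Cinf_torus"
      by (simp add: functional_of_measure_def)
    show "functional_of_measure (density torus (\<lambda>u. ennreal (h u))) (\<lambda>u. f u + r * g u)
      = functional_of_measure (density torus (\<lambda>u. ennreal (h u))) f + r * functional_of_measure (density torus (\<lambda>u. ennreal (h u))) g"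
      if "f \<in> Cinf_torus" "g \<in> Cinf_torus" for f g r
      unfolding eq[OF Cinf_lin[OF that]] eq[OF that(1)] eq[OF that(2)]
      using that by (simp add: tinner_add_left bdd_fun_cmult Cinf_torusD h tinner_cmult_left)
    show "\<bar>functional_of_measure (density torus (\<lambda>u. ennreal (h u))) f\<bar> \<le> B"
      if f: "f \<in> Cinf_torus" and B: "\<And>u. \<bar>f u\<bar> \<le> B" for f B
    proof -
      have "\<bar>tinner f h\<bar> \<le> B * 1" using h by (intro tinner_bound Cinf_torusD(4)[OF f] B) auto
      then show ?thesis by (simp add: eq[OF f])
    qed
  qed
qed

text \<open>Reads the pairing with \<open>psi k\<close> off the complex mode of the same index; for
  negative \<open>k\<close> the sine in \<open>psi k\<close> keeps its negative frequency, so no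
  sign correction arises.\<close>

definition psi_part :: "int \<Rightarrow> complex \<Rightarrow> real" where
  "psi_part k z = (if k < 0 then sqrt 2 * Im z else if k = 0 then Re z else sqrt 2 * Re z)"

lemma psi_part_diff: "psi_part k z - psi_part k w = psi_part k (z - w)"
  by (simp add: psi_part_def algebra_simps)

lemma psi_part_bound: "\<bar>psi_part k z\<bar> \<le> sqrt 2 * cmod z"
proof -
  have "1 * \<bar>Re z\<bar> \<le> sqrt 2 * cmod z" by (intro mult_mono abs_Re_le_cmod) auto
  then show ?thesis using abs_Re_le_cmod[of z] abs_Im_le_cmod[of z] by (auto simp: psi_part_def abs_mult)
qed

lemma empirical_psi: "functional_of_measure (empirical_measure n \<eta>) (psi k) = psi_part k (mode n k \<eta>)"
proof -
  have "functional_of_measure (empirical_measure n \<eta>) (psi k) = (\<Sum>x\<in>{1..n}. psi k (real x / real n) * real (\<eta> x)) / real n"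
    by (simp add: functional_of_measure_def Cinf_psi empirical_functional psi_bdd_fun periodic_psi)
  also have "\<dots> = psi_part k (mode n k \<eta>)"
    unfolding psi_def psi_part_def mode_def wave_sum_def
    by (simp add: Re_sum Im_sum sum_distrib_left sum_distrib_right sum_divide_distrib mult_ac)
  finally show ?thesis .
qed

text \<open>The exponent has the same sign as in \<open>mode\<close>, so that modes converge to
  these numbers without conjugation.\<close>

definition fourier_coeff :: "(real \<Rightarrow> real) \<Rightarrow> int \<Rightarrow> complex" where
  "fourier_coeff h k = Complex (tinner (\<lambda>u. cos (2 * pi * of_int k * u)) h) (tinner (\<lambda>u. sin (2 * pi * of_int k * u)) h)"

text \<open>Translating a density by \<open>s\<close> is translating the test wave by
  \<open>- s\<close>, which multiplies its complex form by a phase. With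
  \<open>s = \<kappa> * t\<close> this phase is the limit of the one in
  \<open>mode_deviation\<close>.\<close>

lemma density_psi:
  assumes g: "profile g"
  shows "functional_of_measure (density torus (\<lambda>u. ennreal (g (u + s)))) (psi k)
    = psi_part k (cis (- (2 * pi * of_int k * s)) * fourier_coeff g k)"
proof -
  note g' = profileD[OF g]
  let ?a = "- (2 * pi * of_int k * s)"
  have cb: "(\<lambda>u. cos (2 * pi * of_int k * u)) \<in> bdd_fun" "(\<lambda>u. sin (2 * pi * of_int k * u)) \<in> bdd_fun"
    by (auto intro!: bdd_funI[of _ 1])
  have "functional_of_measure (density torus (\<lambda>u. ennreal (g (u + s)))) (psi k) = tinner (\<lambda>u. g (u + s)) (psi k)"
    by (simp add: functional_of_measure_def Cinf_psi density_functional bdd_fun_shift g' psi_bdd_fun tinner_commute)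
  also have "\<dots> = tinner g (\<lambda>u. psi k (u + - s))"
    by (intro tinner_shift g' psi_bdd_fun periodic_psi)
  also have "\<dots> = psi_part k (cis ?a * fourier_coeff g k)"
  proof -
    have arg: "2 * pi * of_int k * (u + - s) = 2 * pi * of_int k * u + ?a" for u by (simp add: algebra_simps)
    have c: "tinner g (\<lambda>u. cos (2 * pi * of_int k * u + ?a)) = Re (cis ?a * fourier_coeff g k)"
    proof -
      have "(\<lambda>u. cos (2 * pi * of_int k * u + ?a)) = (\<lambda>u. cos ?a * cos (2 * pi * of_int k * u) + (- sin ?a) * sin (2 * pi * of_int k * u))"
        unfolding cos_add by (intro ext) (simp add: mult.commute)
      then have "tinner g (\<lambda>u. cos (2 * pi * of_int k * u + ?a)) = cos ?a * tinner g (\<lambda>u. cos (2 * pi * of_int k * u)) + (- sin ?a) * tinner g (\<lambda>u. sin (2 * pi * of_int k * u))"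
        by (simp only: tinner_add_right[OF bdd_fun_cmult[OF cb(1)] bdd_fun_cmult[OF cb(2)] g'(1)] tinner_cmult_right)
      then show ?thesis by (simp add: fourier_coeff_def tinner_commute[of g])
    qed
    have s: "tinner g (\<lambda>u. sin (2 * pi * of_int k * u + ?a)) = Im (cis ?a * fourier_coeff g k)"
    proof -
      have "(\<lambda>u. sin (2 * pi * of_int k * u + ?a)) = (\<lambda>u. sin ?a * cos (2 * pi * of_int k * u) + cos ?a * sin (2 * pi * of_int k * u))"
        unfolding sin_add by (intro ext) (simp add: mult.commute)
      then have "tinner g (\<lambda>u. sin (2 * pi * of_int k * u + ?a)) = sin ?a * tinner g (\<lambda>u. cos (2 * pi * of_int k * u)) + cos ?a * tinner g (\<lambda>u. sin (2 * pi * of_int k * u))"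
        by (simp only: tinner_add_right[OF bdd_fun_cmult[OF cb(1)] bdd_fun_cmult[OF cb(2)] g'(1)] tinner_cmult_right)
      then show ?thesis by (simp add: fourier_coeff_def tinner_commute[of g])
    qed
    show ?thesis
    proof (cases "k = 0")
      case True
      then show ?thesis using c by (simp add: psi_def psi_part_def)
    next
      case False
      then show ?thesis unfolding psi_def arg psi_part_def using c s by (simp add: tinner_cmult_right)
    qed
  qed
  finally show ?thesis .
qed

lemma fourier_coeff_bound: assumes "profile g" shows "cmod (fourier_coeff g k) \<le> 2"
proof -
  note g = profileD[OF assms]
  have "\<bar>tinner (\<lambda>u. cos (2 * pi * of_int k * u)) g\<bar> \<le> 1 * 1" "\<bar>tinner (\<lambda>u. sin (2 * pi * of_int k * u)) g\<bar> \<le> 1 * 1"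
    by (rule tinner_bound[OF _ g(1)]; use g(3,4) in \<open>auto intro!: bdd_funI[of _ 1]\<close>)+
  then show ?thesis using cmod_le[of "fourier_coeff g k"] by (simp add: fourier_coeff_def)
qed

lemma sqrt2_le_2: "sqrt 2 \<le> 2"
  using real_sqrt_le_mono[of 2 4] by simp

lemma psi_part_le: "cmod z \<le> B \<Longrightarrow> \<bar>psi_part k z\<bar> \<le> 2 * B"
proof -
  assume "cmod z \<le> B"
  then have "sqrt 2 * cmod z \<le> 2 * B" using sqrt2_le_2 by (intro mult_mono) auto
  then show ?thesis using psi_part_bound[of k z] by linarith
qed

lemma cis_diff_bound: "cmod (cis a - cis b) \<le> \<bar>a - b\<bar>"
proof -
  have "cis a - cis b = cis b * (cis (a - b) - 1)" by (simp add: cis_mult algebra_simps)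
  then show ?thesis using cis_approx(1)[of "a - b"] by (simp add: norm_mult)
qed

section \<open>The limit trajectory\<close>

definition transport_path :: "real \<Rightarrow> real \<Rightarrow> (real \<Rightarrow> real) \<Rightarrow> real \<Rightarrow> (real \<Rightarrow> real) \<Rightarrow> real" where
  "transport_path T \<theta> g = density_path T (\<lambda>t u. g (u + \<theta> * t))"

lemma transport_path_at:
  "t \<in> {0..T} \<Longrightarrow> transport_path T \<theta> g t = functional_of_measure (density torus (\<lambda>u. ennreal (g (u + \<theta> * t))))"
  by (simp add: transport_path_def density_path_def)

lemma transport_path_H_neg:
  assumes "profile g" "m \<ge> 1" "t \<in> {0..T}" shows "transport_path T \<theta> g t \<in> H_neg m"
  unfolding transport_path_at[OF assms(3)] using profileD[OF assms(1)] assms(2)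
  by (intro density_H_neg bdd_fun_shift) auto

lemma transport_path_psi:
  assumes "profile g" "t \<in> {0..T}"
  shows "transport_path T \<theta> g t (psi k) = psi_part k (cis (- (2 * pi * of_int k * \<theta> * t)) * fourier_coeff g k)"
  unfolding transport_path_at[OF assms(2)] density_psi[OF assms(1)] by (simp add: mult.assoc)

text \<open>The path is continuous in \<open>H_neg m\<close>: every coefficient is continuous in
  time and all are uniformly bounded. The claim \<open>lim\<close> leaves the set \<open>A\<close>
  free, to yield the right and the left limit at once.\<close>

lemma transport_path_D_space:
  assumes g: "profile g" and m: "m \<ge> 1"
  shows "transport_path T \<theta> g \<in> D_space T m"
proof -
  let ?p = "transport_path T \<theta> g"
  have lim: "limitin (H_neg_topology m) ?p (?p t) (at t within ({0..T} \<inter> A))" if t: "t \<in> {0..T}" for t A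
    unfolding H_neg_topology_def H.limitin_metric
  proof (intro conjI allI impI)
    show "?p t \<in> H_neg m" by (rule transport_path_H_neg[OF g m t])
    fix e :: real assume e: "e > 0"
    \<comment> \<open>A difference of two coefficients bounded by 2 has modulus at most 4, and
      \<open>psi_part\<close> at most doubles it: hence 8. For the same reason the coefficients in
      \<open>K\<close> are kept within \<open>d / 2\<close>.\<close>
    obtain K d where K: "finite K" "d > 0"
      "\<forall>a. (\<forall>k. \<bar>a k\<bar> \<le> 8) \<longrightarrow> (\<forall>k\<in>K. \<bar>a k\<bar> \<le> d) \<longrightarrow> coeff_norm m a \<le> e / 2"
      using coeff_norm_small[OF m half_gt_zero[OF e], of 8] by blast
    let ?c = "\<lambda>k s. cis (- (2 * pi * of_int k * \<theta> * s)) * fourier_coeff g k"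
    have diff: "?p s (psi k) - ?p t (psi k) = psi_part k (?c k s - ?c k t)" if "s \<in> {0..T}" for s k
      unfolding transport_path_psi[OF g that] transport_path_psi[OF g t] by (rule psi_part_diff)
    have cb: "cmod (?c k s) \<le> 2" for k s using fourier_coeff_bound[OF g, of k] by (simp add: norm_mult)
    have "eventually (\<lambda>s. cmod (?c k s - ?c k t) < d / 2) (at t within ({0..T} \<inter> A))" for k
    proof -
      have "continuous (at t within ({0..T} \<inter> A)) (?c k)"
        unfolding cis_conv_exp by (intro continuous_intros)
      then have "(?c k \<longlongrightarrow> ?c k t) (at t within ({0..T} \<inter> A))" by (simp add: continuous_within)
      then show ?thesis using K(2) unfolding tendsto_iff dist_norm by (metis half_gt_zero)
    qed
    then have "eventually (\<lambda>s. \<forall>k\<in>K. cmod (?c k s - ?c k t) < d / 2) (at t within ({0..T} \<inter> A))"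
      using K(1) by (intro eventually_ball_finite) auto
    moreover have "eventually (\<lambda>s. s \<in> {0..T} \<inter> A) (at t within ({0..T} \<inter> A))"
      by (simp add: eventually_at_filter)
    ultimately show "eventually (\<lambda>s. ?p s \<in> H_neg m \<and> H_neg_dist m (?p s) (?p t) < e) (at t within ({0..T} \<inter> A))"
    proof eventually_elim
      case (elim s)
      then have s: "s \<in> {0..T}" by simp
      have "H_neg_dist m (?p s) (?p t) \<le> e / 2"
        unfolding H_neg_dist_eq diff[OF s]
      proof (rule K(3)[rule_format])
        fix k
        have "cmod (?c k s - ?c k t) \<le> 4" using norm_triangle_ineq4[of "?c k s" "?c k t"] cb[of k s] cb[of k t] by linarith
        from psi_part_le[OF this] show "\<bar>psi_part k (?c k s - ?c k t)\<bar> \<le> 8" by simp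
        assume "k \<in> K"
        then have "cmod (?c k s - ?c k t) \<le> d / 2" using elim(1) by (simp add: less_imp_le)
        from psi_part_le[OF this] show "\<bar>psi_part k (?c k s - ?c k t)\<bar> \<le> d" by simp
      qed
      then show ?case using transport_path_H_neg[OF g m s] e by simp
    qed
  qed
  have "?p \<in> extensional {0..T}" by (simp add: transport_path_def density_path_def)
  moreover have "cadlag (H_neg_topology m) {0..T} ?p"
    unfolding cadlag_def
  proof (intro ballI conjI exI)
    fix t assume t: "t \<in> {0..T}"
    show "?p t \<in> topspace (H_neg_topology m)"
      using transport_path_H_neg[OF g m t] by (simp add: H_neg_topology_def H.topspace_mtopology)
  qed (rule lim, assumption)+
  ultimately show ?thesis by (simp add: D_space_def)
qed

section \<open>Convergence of the empirical paths\<close>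

lemma cadlag_discrete_scale:
  assumes y: "cadlag (discrete_topology S) {0..} y" and c: "c > 0"
  shows "cadlag (discrete_topology S) {0..T} (\<lambda>t. y (t * c))"
proof (rule cadlag_discreteI)
  fix t assume t: "t \<in> {0..T}"
  then have tc: "t * c \<in> {0..}" using c by simp
  show "y (t * c) \<in> S" using y tc by (simp add: cadlag_def)
  obtain \<delta> where d: "\<delta> > 0" "\<forall>s\<in>{0..}. t * c \<le> s \<and> s < t * c + \<delta> \<longrightarrow> y s = y (t * c)"
    using cadlag_discrete_right[OF y tc] by blast
  show "\<exists>\<delta>>0. \<forall>s\<in>{0..T}. t < s \<and> s < t + \<delta> \<longrightarrow> y (s * c) = y (t * c)"
  proof (rule exI[of _ "\<delta> / c"], intro conjI ballI impI)
    show "0 < \<delta> / c" using d(1) c by simp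
    fix s assume s: "s \<in> {0..T}" "t < s \<and> s < t + \<delta> / c"
    then show "y (s * c) = y (t * c)" using c by (intro d(2)[rule_format]) (auto simp: field_simps)
  qed
  obtain \<delta> l where l: "\<delta> > 0" "l \<in> S" "\<forall>s\<in>{0..}. t * c - \<delta> < s \<and> s < t * c \<longrightarrow> y s = l"
    using cadlag_discrete_left_in[OF y tc] by blast
  show "\<exists>\<delta>>0. \<exists>l\<in>S. \<forall>s\<in>{0..T}. t - \<delta> < s \<and> s < t \<longrightarrow> y (s * c) = l"
  proof (rule exI[of _ "\<delta> / c"], intro conjI bexI[of _ l] l(2) ballI impI)
    show "0 < \<delta> / c" using l(1) c by simp
    fix s assume s: "s \<in> {0..T}" "t - \<delta> / c < s \<and> s < t"
    then show "y (s * c) = l" using c by (intro l(3)[rule_format]) (auto simp: field_simps)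
  qed
qed

text \<open>A visit at the single time 0 is the case \<open>k = 0\<close> of the product formula,
  and events are finite unions of such visits.\<close>

lemma initial_law:
  assumes chain: "markov_chain M X S L \<mu>" and S: "finite S" and \<mu>: "set_pmf \<mu> \<subseteq> S"
  shows "{w \<in> space M. Q (X 0 w)} \<in> sets M"
    "measure M {w \<in> space M. Q (X 0 w)} = measure_pmf.prob \<mu> {x. Q x}"
proof -
  obtain P where "chain_fdd M X S \<mu> P" using markov_chain_fdd[OF chain S] by blast
  then interpret chain_fdd M X S \<mu> P .
  show "{w \<in> space M. Q (X 0 w)} \<in> sets M" by (rule X_set) simp
  have single: "measure M {w \<in> space M. X 0 w = x} = pmf \<mu> x" if "x \<in> S" for x
    using fdd[of "\<lambda>_. 0" 0 "\<lambda>_. x"] that by simp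
  let ?S = "{x \<in> S. Q x}"
  have "{w \<in> space M. Q (X 0 w)} = (\<Union>x\<in>?S. {w \<in> space M. X 0 w = x})"
    using X_in[of 0] by auto
  also have "measure M \<dots> = (\<Sum>x\<in>?S. measure M {w \<in> space M. X 0 w = x})"
  proof (rule finite_measure_finite_Union)
    show "(\<lambda>x. {w \<in> space M. X 0 w = x}) ` ?S \<subseteq> sets M" using X_set[of 0] by auto
  qed (use S in \<open>auto simp: disjoint_family_on_def\<close>)
  also have "\<dots> = (\<Sum>x\<in>?S. pmf \<mu> x)" by (intro sum.cong) (auto simp: single)
  also have "\<dots> = measure_pmf.prob \<mu> ?S" using S by (simp add: measure_measure_pmf_finite)
  also have "\<dots> = measure_pmf.prob \<mu> {x. Q x}"
    using \<mu> by (intro measure_pmf.finite_measure_eq_AE) (auto simp: AE_measure_pmf_iff)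
  finally show "measure M {w \<in> space M. Q (X 0 w)} = measure_pmf.prob \<mu> {x. Q x}" .
qed

text \<open>Association is applied to cosine and sine; if both parts deviate by at most
  \<open>d / 2\<close>, the modulus deviates by at most \<open>d\<close>.\<close>

lemma mode_initial:
  assumes assoc: "associated \<mu> g" and d: "d > 0"
  shows "(\<lambda>n. measure_pmf.prob (\<mu> n) {\<eta>. cmod (mode n k \<eta> - fourier_coeff g k) > d}) \<longlonglongrightarrow> 0"
proof -
  let ?C = "\<lambda>u. cos (2 * pi * of_int k * u)" and ?S = "\<lambda>u. sin (2 * pi * of_int k * u)"
  let ?D = "\<lambda>G n \<eta>. \<bar>(\<Sum>x\<in>{1..n}. G (real x / real n) * real (\<eta> x)) / real n - tinner G g\<bar>"
  have "periodic ?C" using periodic_wave[of 1 k 0] by simp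
  moreover have "periodic ?S" using periodic_wave[of 1 k "- pi / 2"] by (simp add: cos_add cos_diff)
  ultimately have
    "(\<lambda>n. measure_pmf.prob (\<mu> n) {\<eta>. ?D ?C n \<eta> > d / 2}) \<longlonglongrightarrow> 0"
    "(\<lambda>n. measure_pmf.prob (\<mu> n) {\<eta>. ?D ?S n \<eta> > d / 2}) \<longlonglongrightarrow> 0"
    using d by (intro assoc[unfolded associated_def, rule_format] conjI; simp add: continuous_intros)+
  then have lim: "(\<lambda>n. measure_pmf.prob (\<mu> n) {\<eta>. ?D ?C n \<eta> > d / 2} + measure_pmf.prob (\<mu> n) {\<eta>. ?D ?S n \<eta> > d / 2}) \<longlonglongrightarrow> 0"
    using tendsto_add by fastforce
  show ?thesis
  proof (rule tendsto_sandwich[OF _ _ tendsto_const lim])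
    show "eventually (\<lambda>n. measure_pmf.prob (\<mu> n) {\<eta>. cmod (mode n k \<eta> - fourier_coeff g k) > d}
      \<le> measure_pmf.prob (\<mu> n) {\<eta>. ?D ?C n \<eta> > d / 2} + measure_pmf.prob (\<mu> n) {\<eta>. ?D ?S n \<eta> > d / 2}) sequentially"
    proof (rule always_eventually, rule allI)
      fix n
      have "\<bar>Re (mode n k \<eta> - fourier_coeff g k)\<bar> = ?D ?C n \<eta>" "\<bar>Im (mode n k \<eta> - fourier_coeff g k)\<bar> = ?D ?S n \<eta>" for \<eta>
        by (simp_all add: mode_def wave_sum_def fourier_coeff_def Re_sum Im_sum sum_divide_distrib mult_ac)
      then have "cmod (mode n k \<eta> - fourier_coeff g k) \<le> ?D ?C n \<eta> + ?D ?S n \<eta>" for \<eta>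
        using cmod_le[of "mode n k \<eta> - fourier_coeff g k"] by metis
      then have "{\<eta>. cmod (mode n k \<eta> - fourier_coeff g k) > d} \<subseteq> {\<eta>. ?D ?C n \<eta> > d / 2} \<union> {\<eta>. ?D ?S n \<eta> > d / 2}"
        by (smt (verit) Collect_mono_iff Un_def field_sum_of_halves mem_Collect_eq)
      then have "measure_pmf.prob (\<mu> n) {\<eta>. cmod (mode n k \<eta> - fourier_coeff g k) > d}
        \<le> measure_pmf.prob (\<mu> n) ({\<eta>. ?D ?C n \<eta> > d / 2} \<union> {\<eta>. ?D ?S n \<eta> > d / 2})"
        by (intro measure_pmf.finite_measure_mono) auto
      also have "\<dots> \<le> measure_pmf.prob (\<mu> n) {\<eta>. ?D ?C n \<eta> > d / 2} + measure_pmf.prob (\<mu> n) {\<eta>. ?D ?S n \<eta> > d / 2}"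
        by (intro measure_Un_le) auto
      finally show "measure_pmf.prob (\<mu> n) {\<eta>. cmod (mode n k \<eta> - fourier_coeff g k) > d}
        \<le> measure_pmf.prob (\<mu> n) {\<eta>. ?D ?C n \<eta> > d / 2} + measure_pmf.prob (\<mu> n) {\<eta>. ?D ?S n \<eta> > d / 2}" .
    qed
  qed auto
qed

section \<open>Convergence in probability and in law for the particle system\<close>

locale card_particles =
  fixes an bn cn dn :: "nat \<Rightarrow> real" and \<kappa> T :: real and m :: nat and \<rho>0 :: "real \<Rightarrow> real"
    and \<mu> :: "nat \<Rightarrow> (nat \<Rightarrow> nat) pmf" and M :: "nat \<Rightarrow> 'w measure" and X :: "nat \<Rightarrow> real \<Rightarrow> 'w \<Rightarrow> nat \<Rightarrow> nat"
  assumes rates: "\<And>n. an n \<in> {0..1} \<and> bn n \<in> {0..1} \<and> cn n \<in> {0..1} \<and> dn n \<in> {0..1}"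
    and drift: "(\<lambda>n. an n + bn n - cn n) \<longlonglongrightarrow> \<kappa>"
    and T: "T > 0" and m: "m \<ge> 1" and \<rho>0: "profile \<rho>0"
    and \<mu>_supp: "\<And>n. n \<ge> 2 \<Longrightarrow> set_pmf (\<mu> n) \<subseteq> Omega n" and \<mu>_assoc: "associated \<mu> \<rho>0"
    and chain: "\<And>n. n \<ge> 2 \<Longrightarrow> markov_chain (M n) (X n) (Omega n) (gen n (an n) (bn n) (cn n) (dn n)) (\<mu> n)"
begin

lemma prob_M: "n \<ge> 2 \<Longrightarrow> prob_space (M n)"
  using chain[of n] by (simp add: markov_chain_def)

text \<open>Three errors, each at most \<open>d / 4\<close>: the deviation of the chain from its
  rotation, the rotation at speed \<open>an n + bn n - cn n\<close> in place of
  \<open>\<kappa>\<close>, and the initial mode in place of the Fourier coefficient. The second is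
  deterministic; the other two share the probability \<open>\<eta>\<close>.\<close>

lemma mode_convergence:
  assumes d: "d > 0" and \<eta>: "\<eta> > 0"
  shows "eventually (\<lambda>n. \<exists>A\<in>sets (M n). measure (M n) A \<le> \<eta> \<and> (\<forall>w\<in>space (M n) - A. \<forall>t\<in>{0..T}.
      cmod (mode n k (X n (t * real n) w) - cis (- (2 * pi * of_int k * \<kappa> * t)) * fourier_coeff \<rho>0 k) \<le> d)) sequentially"
proof -
  \<comment> \<open>The deviation in \<open>mode_deviation\<close> is \<open>2 * e\<close>, which
    must be \<open>d / 4\<close>.\<close>
  define e where "e = d / 8"
  have e: "e > 0" using d by (simp add: e_def)
  have "(\<lambda>n. 2 * T * mode_const k / e\<^sup>2 / real n) \<longlonglongrightarrow> 0" by (rule lim_const_over_n)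
  then have 1: "eventually (\<lambda>n. 2 * T * mode_const k / e\<^sup>2 / real n < \<eta> / 2) sequentially"
    using \<eta> by (intro order_tendstoD(2)) auto
  have 2: "eventually (\<lambda>n. measure_pmf.prob (\<mu> n) {\<xi>. cmod (mode n k \<xi> - fourier_coeff \<rho>0 k) > d / 4} < \<eta> / 2) sequentially"
    using \<eta> d by (intro order_tendstoD(2)[OF mode_initial[OF \<mu>_assoc]]) auto
  have "(\<lambda>n. 2 * pi * \<bar>of_int k\<bar> * \<bar>(an n + bn n - cn n) - \<kappa>\<bar> * T) \<longlonglongrightarrow> 2 * pi * \<bar>of_int k\<bar> * \<bar>\<kappa> - \<kappa>\<bar> * T"
    by (intro tendsto_intros drift)
  then have 3: "eventually (\<lambda>n. 2 * pi * \<bar>of_int k\<bar> * \<bar>(an n + bn n - cn n) - \<kappa>\<bar> * T < d / 4) sequentially"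
    using d by (intro order_tendstoD(2)) auto
  show ?thesis using 1 2 3 eventually_ge_at_top[of 2]
  proof eventually_elim
    case (elim n)
    then have n: "n \<ge> 2" by simp
    interpret prob_space "M n" by (rule prob_M[OF n])
    let ?\<kappa> = "an n + bn n - cn n" and ?r = "fourier_coeff \<rho>0 k"
    obtain A1 where A1: "A1 \<in> sets (M n)" "measure (M n) A1 \<le> 2 * T * mode_const k / (real n * e\<^sup>2)"
      "\<forall>w\<in>space (M n) - A1. \<forall>t\<in>{0..T}. cmod (mode n k (X n (t * real n) w) - cis (- (2 * pi * of_int k * ?\<kappa> * t)) * mode n k (X n 0 w)) \<le> 2 * e"
      using mode_deviation[OF n _ _ _ _ chain[OF n] \<mu>_supp[OF n] T e, of k] rates[of n] by blast
    define A2 where "A2 = {w \<in> space (M n). cmod (mode n k (X n 0 w) - ?r) > d / 4}"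
    have A2: "A2 \<in> sets (M n)" "measure (M n) A2 < \<eta> / 2"
      using initial_law[OF chain[OF n] finite_Omega \<mu>_supp[OF n], of "\<lambda>\<xi>. cmod (mode n k \<xi> - ?r) > d / 4"] elim(2)
      unfolding A2_def by auto
    show ?case
    proof (intro bexI[of _ "A1 \<union> A2"] conjI ballI)
      have "measure (M n) (A1 \<union> A2) \<le> measure (M n) A1 + measure (M n) A2"
        by (rule measure_Un_le[OF A1(1) A2(1)])
      moreover have "2 * T * mode_const k / (real n * e\<^sup>2) = 2 * T * mode_const k / e\<^sup>2 / real n" by simp
      ultimately show "measure (M n) (A1 \<union> A2) \<le> \<eta>" using A1(2) A2(2) elim(1) by linarith
      show "A1 \<union> A2 \<in> sets (M n)" using A1 A2 by blast
      fix w t assume w: "w \<in> space (M n) - (A1 \<union> A2)" and t: "t \<in> {0..T}"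
      let ?z = "mode n k (X n (t * real n) w)" and ?y = "mode n k (X n 0 w)"
      let ?c = "cis (- (2 * pi * of_int k * ?\<kappa> * t))" and ?c' = "cis (- (2 * pi * of_int k * \<kappa> * t))"
      have dev: "cmod (?z - ?c * ?y) \<le> d / 4"
      proof -
        have "w \<in> space (M n) - A1" using w by blast
        from A1(3)[rule_format, OF this t] show ?thesis by (simp add: e_def)
      qed
      have init: "cmod (?y - ?r) \<le> d / 4" using w by (auto simp: A2_def)
      have z0: "cmod ?y \<le> 1"
      proof (rule mode_bound)
        obtain P where "chain_fdd (M n) (X n) (Omega n) (\<mu> n) P" using markov_chain_fdd[OF chain[OF n] finite_Omega] by blast
        then interpret chain_fdd "M n" "X n" "Omega n" "\<mu> n" P .
        show "X n 0 w \<in> Omega n" using w by (intro X_in) auto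
      qed
      have "cmod (?c - ?c') \<le> \<bar>- (2 * pi * of_int k * ?\<kappa> * t) - - (2 * pi * of_int k * \<kappa> * t)\<bar>" by (rule cis_diff_bound)
      also have "- (2 * pi * of_int k * ?\<kappa> * t) - - (2 * pi * of_int k * \<kappa> * t) = - (2 * pi * of_int k * (?\<kappa> - \<kappa>) * t)"
        by (simp add: algebra_simps)
      also have "\<bar>- (2 * pi * of_int k * (?\<kappa> - \<kappa>) * t)\<bar> = 2 * pi * \<bar>of_int k\<bar> * \<bar>?\<kappa> - \<kappa>\<bar> * t"
        using t by (simp add: abs_mult)
      also have "\<dots> \<le> 2 * pi * \<bar>of_int k\<bar> * \<bar>?\<kappa> - \<kappa>\<bar> * T" using t by (intro mult_left_mono) auto
      finally have "cmod (?c - ?c') * cmod ?y \<le> d / 4 * 1" using elim(3) z0 d by (intro mult_mono) auto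
      then have rot: "cmod ((?c - ?c') * ?y) \<le> d / 4" by (simp add: norm_mult)
      have dec: "?z - ?c' * ?r = (?z - ?c * ?y) + (?c - ?c') * ?y + ?c' * (?y - ?r)" by (simp add: algebra_simps)
      have "cmod (?z - ?c' * ?r) \<le> cmod (?z - ?c * ?y) + cmod ((?c - ?c') * ?y) + cmod (?c' * (?y - ?r))"
        unfolding dec using norm_triangle_ineq[of "(?z - ?c * ?y) + (?c - ?c') * ?y" "?c' * (?y - ?r)"]
          norm_triangle_ineq[of "?z - ?c * ?y" "(?c - ?c') * ?y"] by linarith
      also have "cmod (?c' * (?y - ?r)) = cmod (?y - ?r)" by (simp add: norm_mult)
      finally show "cmod (?z - ?c' * ?r) \<le> d" using dev rot init d by linarith
    qed
  qed
qed

definition emp :: "nat \<Rightarrow> 'w \<Rightarrow> real \<Rightarrow> (real \<Rightarrow> real) \<Rightarrow> real" where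
  "emp n w = empirical_path T n 1 (\<lambda>t. X n t w)"

lemma emp_eq: "n \<ge> 2 \<Longrightarrow> emp n w = restrict (\<lambda>t. functional_of_measure (empirical_measure n (X n (t * real n) w))) {0..T}"
  by (simp add: emp_def empirical_path_def)

lemma scaled_cadlag:
  assumes "n \<ge> 2" "w \<in> space (M n)"
  shows "cadlag (discrete_topology (Omega n)) {0..T} (\<lambda>t. X n (t * real n) w)"
  using chain[OF assms(1)] assms by (intro cadlag_discrete_scale) (auto simp: markov_chain_def)

lemma emp_D_space:
  assumes "n \<ge> 2" "w \<in> space (M n)" shows "emp n w \<in> D_space T m"
  unfolding emp_eq[OF assms(1)]
  by (intro cadlag_discrete_H_neg cadlag_discrete_map[OF scaled_cadlag[OF assms]] empirical_H_neg m)

text \<open>Only with measurability is \<open>empirical_law\<close>, a \<open>distr\<close>, the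
  actual law of the paths.\<close>

lemma emp_measurable:
  assumes n: "n \<ge> 2"
  shows "emp n \<in> measurable (M n) (borel_of (skorokhod_topology T m))"
proof -
  have "(\<lambda>w. restrict (\<lambda>t. functional_of_measure (empirical_measure n (X n (t * real n) w))) {0..T})
    \<in> measurable (M n) (borel_of (skorokhod_topology T m))"
  proof (rule finite_state_path_measurable[OF T finite_Omega, of "\<lambda>t. X n (t * real n)" "M n" n])
    show "X n (t * real n) \<in> measurable (M n) (count_space (Omega n))" if "t \<in> {0..T}" for t
      using chain[OF n] that by (simp add: markov_chain_def)
    show "cadlag (discrete_topology (Omega n)) {0..T} (\<lambda>t. X n (t * real n) w)" if "w \<in> space (M n)" for w
      by (rule scaled_cadlag[OF n that])
    show "functional_of_measure (empirical_measure n \<eta>) \<in> H_neg m" if "\<eta> \<in> Omega n" for \<eta>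
      by (rule empirical_H_neg[OF that m])
  qed
  moreover have "emp n = (\<lambda>w. restrict (\<lambda>t. functional_of_measure (empirical_measure n (X n (t * real n) w))) {0..T})"
    by (intro ext emp_eq[OF n])
  ultimately show ?thesis by (simp only:)
qed

lemma emp_convergence:
  assumes e: "e > 0" and \<eta>: "\<eta> > 0"
  shows "eventually (\<lambda>n. \<exists>A\<in>sets (M n). measure (M n) A \<le> \<eta> \<and>
      (\<forall>w\<in>space (M n) - A. skorokhod_dist T m (emp n w) (transport_path T \<kappa> \<rho>0) \<le> e)) sequentially"
proof -
  obtain K d where K: "finite K" "d > 0"
    "\<forall>a. (\<forall>k. \<bar>a k\<bar> \<le> 8) \<longrightarrow> (\<forall>k\<in>K. \<bar>a k\<bar> \<le> d) \<longrightarrow> coeff_norm m a \<le> e"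
    using coeff_norm_small[OF m e, of 8] by blast
  let ?p = "transport_path T \<kappa> \<rho>0"
  let ?c = "\<lambda>k t. cis (- (2 * pi * of_int k * \<kappa> * t)) * fourier_coeff \<rho>0 k"
  \<comment> \<open>A union bound over \<open>K\<close> follows; the \<open>+ 1\<close> covers an
    empty \<open>K\<close>.\<close>
  define \<epsilon> where "\<epsilon> = \<eta> / (real (card K) + 1)"
  have \<epsilon>: "\<epsilon> > 0" using \<eta> by (simp add: \<epsilon>_def add_nonneg_pos)
  have "eventually (\<lambda>n. \<forall>k\<in>K. \<exists>A\<in>sets (M n). measure (M n) A \<le> \<epsilon> \<and> (\<forall>w\<in>space (M n) - A. \<forall>t\<in>{0..T}.
      cmod (mode n k (X n (t * real n) w) - ?c k t) \<le> d / 2)) sequentially"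
    using K(2) \<epsilon> by (intro eventually_ball_finite[OF K(1)] ballI mode_convergence) auto
  then show ?thesis using eventually_ge_at_top[of 2]
  proof eventually_elim
    case (elim n)
    then have n: "n \<ge> 2" by simp
    interpret prob_space "M n" by (rule prob_M[OF n])
    obtain A where A: "\<forall>k\<in>K. A k \<in> sets (M n) \<and> measure (M n) (A k) \<le> \<epsilon> \<and> (\<forall>w\<in>space (M n) - A k. \<forall>t\<in>{0..T}.
      cmod (mode n k (X n (t * real n) w) - ?c k t) \<le> d / 2)"
      using bchoice[OF elim(1)[unfolded Bex_def]] by blast
    show ?case
    proof (intro bexI[of _ "\<Union>k\<in>K. A k"] conjI ballI)
      have "measure (M n) (\<Union>k\<in>K. A k) \<le> (\<Sum>k\<in>K. measure (M n) (A k))"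
        using A by (intro finite_measure_subadditive_finite K(1)) auto
      also have "\<dots> \<le> (\<Sum>k\<in>K. \<epsilon>)" using A by (intro sum_mono) auto
      also have "\<dots> \<le> \<eta>" using \<eta> by (simp add: \<epsilon>_def divide_le_eq mult.commute)
      finally show "measure (M n) (\<Union>k\<in>K. A k) \<le> \<eta>" .
      show "(\<Union>k\<in>K. A k) \<in> sets (M n)" using A K(1) by (intro sets.finite_UN) auto
      fix w assume w: "w \<in> space (M n) - (\<Union>k\<in>K. A k)"
      then have wM: "w \<in> space (M n)" by simp
      show "skorokhod_dist T m (emp n w) ?p \<le> e"
      proof (rule skorokhod_dist_le_sup[OF emp_D_space[OF n wM] transport_path_D_space[OF \<rho>0 m]])
        fix t assume t: "t \<in> {0..T}"
        let ?z = "\<lambda>k. mode n k (X n (t * real n) w)"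
        have diff: "emp n w t (psi k) - ?p t (psi k) = psi_part k (?z k - ?c k t)" for k
          using t by (simp add: emp_eq[OF n] empirical_psi transport_path_psi[OF \<rho>0 t] psi_part_diff)
        have XO: "X n (t * real n) w \<in> Omega n" using scaled_cadlag[OF n wM] t by (simp add: cadlag_def)
        show "H_neg_dist m (emp n w t) (?p t) \<le> e"
          unfolding H_neg_dist_eq diff
        proof (rule K(3)[rule_format])
          fix k
          have "cmod (?c k t) \<le> 2" using fourier_coeff_bound[OF \<rho>0, of k] by (simp add: norm_mult)
          then have "cmod (?z k - ?c k t) \<le> 4"
            using norm_triangle_ineq4[of "?z k" "?c k t"] mode_bound[OF XO, of k] by linarith
          from psi_part_le[OF this] show "\<bar>psi_part k (?z k - ?c k t)\<bar> \<le> 8" by simp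
          assume k: "k \<in> K"
          then have "w \<in> space (M n) - A k" using w by blast
          then have "cmod (?z k - ?c k t) \<le> d / 2" using A k t by blast
          from psi_part_le[OF this] show "\<bar>psi_part k (?z k - ?c k t)\<bar> \<le> d" by simp
        qed
      qed (use T e in auto)
    qed
  qed
qed

text \<open>Convergence in probability to a deterministic path is enough: near the limit a
  continuous \<open>F\<close> varies by less than \<open>e / 2\<close>, and the exceptional event
  contributes at most \<open>2 * B\<close> times its probability.\<close>

lemma empirical_law_convergence:
  "weak_conv_topology (skorokhod_topology T m) (\<lambda>n. empirical_law T m n 1 (M n) (X n))
    (return (borel_of (skorokhod_topology T m)) (transport_path T \<kappa> \<rho>0))"
proof -
  let ?p = "transport_path T \<kappa> \<rho>0" and ?B = "borel_of (skorokhod_topology T m)"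
  have T0: "0 \<le> T" using T by simp
  interpret K: Metric_space "D_space T m" "skorokhod_dist T m" by (rule Metric_space_skorokhod[OF T0])
  have top: "skorokhod_topology T m = K.mtopology" by (simp add: skorokhod_topology_def)
  have spB: "space ?B = D_space T m"
    unfolding borel_of_def top using openin_subset[of K.mtopology] by (subst space_measure_of) auto
  have setB: "U \<in> sets ?B" if "openin K.mtopology U" for U
    unfolding borel_of_def top using that openin_subset[of K.mtopology]
    by (subst sets_measure_of) (auto intro!: sigma_sets.Basic)
  have pD: "?p \<in> D_space T m" by (rule transport_path_D_space[OF \<rho>0 m])
  have law: "empirical_law T m n 1 (M n) (X n) = distr (M n) ?B (emp n)" for n
    by (simp add: empirical_law_def emp_def[abs_def])
  show ?thesis unfolding weak_conv_topology_def
  proof (intro conjI allI impI)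
    show "eventually (\<lambda>n. prob_space (empirical_law T m n 1 (M n) (X n)) \<and> sets (empirical_law T m n 1 (M n) (X n)) = sets ?B) sequentially"
      using eventually_ge_at_top[of 2]
    proof eventually_elim
      case (elim n)
      then show ?case unfolding law by (simp add: prob_space.prob_space_distr[OF prob_M emp_measurable])
    qed
    show "prob_space (return ?B ?p)" by (rule prob_space_return) (simp add: spB pD)
    show "sets (return ?B ?p) = sets ?B" by simp
    fix F :: "(real \<Rightarrow> (real \<Rightarrow> real) \<Rightarrow> real) \<Rightarrow> real"
    assume F: "continuous_map (skorokhod_topology T m) euclideanreal F \<and> (\<exists>B. \<forall>x\<in>topspace (skorokhod_topology T m). \<bar>F x\<bar> \<le> B)"
    then have Fc: "continuous_map K.mtopology euclideanreal F" by (simp add: top)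
    obtain B where B: "\<And>x. x \<in> D_space T m \<Longrightarrow> \<bar>F x\<bar> \<le> B" using F by (auto simp: top)
    have B0: "0 \<le> B" using B[OF pD] by linarith
    have pre: "openin K.mtopology {x \<in> D_space T m. F x \<in> U}" if "open U" for U
      using Fc that by (auto simp: continuous_map_def)
    have Fm: "F \<in> borel_measurable ?B"
    proof (rule borel_measurableI)
      fix U :: "real set" assume "open U"
      then show "F -` U \<inter> space ?B \<in> sets ?B"
        using setB[OF pre] by (simp add: spB vimage_def Int_def conj_commute)
    qed
    have ret: "(\<integral>x. F x \<partial>return ?B ?p) = F ?p" by (rule integral_return) (simp_all add: spB pD Fm)
    show "(\<lambda>n. \<integral>x. F x \<partial>empirical_law T m n 1 (M n) (X n)) \<longlonglongrightarrow> (\<integral>x. F x \<partial>return ?B ?p)"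
      unfolding ret
    proof (rule tendstoI)
      fix e :: real assume e: "e > 0"
      have "openin K.mtopology {x \<in> D_space T m. F x \<in> ball (F ?p) (e / 2)}" by (rule pre) simp
      moreover have "?p \<in> {x \<in> D_space T m. F x \<in> ball (F ?p) (e / 2)}" using pD e by simp
      ultimately obtain r where r: "r > 0" "K.mball ?p r \<subseteq> {x \<in> D_space T m. F x \<in> ball (F ?p) (e / 2)}"
        unfolding K.openin_mtopology by blast
      have near: "\<bar>F x - F ?p\<bar> < e / 2" if "x \<in> D_space T m" "skorokhod_dist T m x ?p \<le> r / 2" for x
      proof -
        have "x \<in> K.mball ?p r" using that r(1) pD by (simp add: K.commute)
        then show ?thesis using r(2) by (auto simp: dist_real_def abs_minus_commute)
      qed
      \<comment> \<open>Chosen so that the exceptional event contributes at most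
        \<open>e / 4\<close>; the \<open>+ 1\<close> allows \<open>B = 0\<close>.\<close>
      define \<eta> where "\<eta> = e / (8 * (B + 1))"
      have \<eta>: "\<eta> > 0" using e B0 by (simp add: \<eta>_def)
      have "eventually (\<lambda>n. \<exists>A\<in>sets (M n). measure (M n) A \<le> \<eta> \<and>
          (\<forall>w\<in>space (M n) - A. skorokhod_dist T m (emp n w) ?p \<le> r / 2)) sequentially"
        using r(1) \<eta> by (intro emp_convergence) auto
      then show "eventually (\<lambda>n. dist (\<integral>x. F x \<partial>empirical_law T m n 1 (M n) (X n)) (F ?p) < e) sequentially"
        using eventually_ge_at_top[of 2]
      proof eventually_elim
        case (elim n)
        then have n: "n \<ge> 2" by simp
        interpret prob_space "M n" by (rule prob_M[OF n])
        obtain A where A: "A \<in> sets (M n)" "measure (M n) A \<le> \<eta>"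
          "\<forall>w\<in>space (M n) - A. skorokhod_dist T m (emp n w) ?p \<le> r / 2" using elim(1) by blast
        have Fe: "(\<lambda>w. F (emp n w)) \<in> borel_measurable (M n)"
          by (rule measurable_compose[OF emp_measurable[OF n] Fm])
        have int: "integrable (M n) (\<lambda>w. F (emp n w))"
          using Fe B[OF emp_D_space[OF n]] by (intro integrable_const_bound[of _ B] AE_I2) auto
        have bound: "\<bar>F (emp n w) - F ?p\<bar> \<le> e / 2 + 2 * B * indicator A w" if w: "w \<in> space (M n)" for w
        proof (cases "w \<in> A")
          case True
          then show ?thesis using B[OF emp_D_space[OF n w]] B[OF pD] e by (simp add: abs_le_iff)
        next
          case False
          then show ?thesis using near[OF emp_D_space[OF n w]] A(3) w by auto
        qed
        have "(\<integral>x. F x \<partial>empirical_law T m n 1 (M n) (X n)) - F ?p = (\<integral>w. F (emp n w) - F ?p \<partial>M n)"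
          unfolding law integral_distr[OF emp_measurable[OF n] Fm] using int prob_space by simp
        also have "\<bar>\<dots>\<bar> \<le> (\<integral>w. \<bar>F (emp n w) - F ?p\<bar> \<partial>M n)" by (rule integral_abs_bound)
        also have "\<dots> \<le> (\<integral>w. e / 2 + 2 * B * indicator A w \<partial>M n)"
          using int A(1) bound by (intro Bochner_Integration.integral_mono) (auto simp: emeasure_eq_measure)
        also have "\<dots> = e / 2 + 2 * B * measure (M n) A"
          using A(1) prob_space by (simp add: emeasure_eq_measure)
        also have "2 * B * measure (M n) A \<le> 2 * B * \<eta>" using A(2) B0 by (intro mult_left_mono) auto
        also have "2 * B * \<eta> \<le> e / 4"
        proof -
          have "2 * B * \<eta> = e / 4 * (B / (B + 1))"
            using B0 by (simp add: \<eta>_def field_simps)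
          also have "\<dots> \<le> e / 4 * 1" using e B0 by (intro mult_left_mono) auto
          finally show ?thesis by simp
        qed
        finally show ?case using e by (simp add: dist_real_def)
      qed
    qed
  qed
qed

end

theorem theorem2p2:
  fixes an bn cn dn :: "nat \<Rightarrow> real"
    and a b c d \<kappa> T :: real
    and m :: nat
    and \<rho>0 :: "real \<Rightarrow> real"
    and \<mu> :: "nat \<Rightarrow> (nat \<Rightarrow> nat) pmf"
    and M :: "nat \<Rightarrow> 'w measure"
    and X :: "nat \<Rightarrow> real \<Rightarrow> 'w \<Rightarrow> nat \<Rightarrow> nat"
  assumes rates_range: "\<And>n. an n \<in> {0..1} \<and> bn n \<in> {0..1} \<and> cn n \<in> {0..1} \<and> dn n \<in> {0..1}"
    and rates_lim: "an \<longlonglongrightarrow> a" "bn \<longlonglongrightarrow> b" "cn \<longlonglongrightarrow> c" "dn \<longlonglongrightarrow> d"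
    and irred: "\<And>n. n \<ge> 2 \<Longrightarrow> irreducible_rates n (an n) (bn n) (cn n) (dn n)"
    and T: "T > 0"
    and m: "real m > 3/2"
    and \<rho>0: "profile \<rho>0"
    and \<mu>_supp: "\<And>n. n \<ge> 2 \<Longrightarrow> set_pmf (\<mu> n) \<subseteq> Omega n"
    and \<mu>_assoc: "associated \<mu> \<rho>0"
    and chain: "\<And>n. n \<ge> 2 \<Longrightarrow>
      markov_chain (M n) (X n) (Omega n) (gen n (an n) (bn n) (cn n) (dn n)) (\<mu> n)"
    and \<kappa>: "(\<lambda>n. \<bar>an n + bn n - cn n\<bar>) \<longlonglongrightarrow> \<kappa>" "\<kappa> = a + b - c" "\<kappa> \<noteq> 0"
  shows "\<exists>\<rho>. weak_solution T \<kappa> \<rho>0 \<rho> \<and>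
    (\<forall>\<rho>'. weak_solution T \<kappa> \<rho>0 \<rho>' \<longrightarrow> (\<forall>t\<in>{0..T}. AE u in torus. \<rho>' t u = \<rho> t u)) \<and>
    weak_conv_topology (skorokhod_topology T m)
      (\<lambda>n. empirical_law T m n 1 (M n) (X n))
      (return (borel_of (skorokhod_topology T m)) (density_path T \<rho>))"
proof -
  \<comment> \<open>The direction of the rotation depends on the sign of the drift, so its limit is
    taken without the absolute value, from the limits of the rates.\<close>
  have "(\<lambda>n. an n + bn n - cn n) \<longlonglongrightarrow> \<kappa>"
    unfolding \<kappa>(2) by (intro tendsto_intros rates_lim)
  moreover have "m \<ge> 1" using m by linarith
  ultimately interpret card_particles an bn cn dn \<kappa> T m \<rho>0 \<mu> M X
    by (intro card_particles.intro rates_range T \<rho>0 \<mu>_supp \<mu>_assoc chain)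
  have sol: "weak_solution T \<kappa> \<rho>0 (\<lambda>t u. \<rho>0 (u + \<kappa> * t))" by (rule weak_solution_exists[OF \<rho>0])
  show ?thesis
  proof (intro exI[of _ "\<lambda>t u. \<rho>0 (u + \<kappa> * t)"] conjI allI impI ballI)
    show "weak_solution T \<kappa> \<rho>0 (\<lambda>t u. \<rho>0 (u + \<kappa> * t))" by (rule sol)
    show "AE u in torus. \<rho>' t u = \<rho>0 (u + \<kappa> * t)" if "weak_solution T \<kappa> \<rho>0 \<rho>'" "t \<in> {0..T}" for \<rho>' t
      by (rule weak_solution_unique[OF \<rho>0 sol that])
    show "weak_conv_topology (skorokhod_topology T m) (\<lambda>n. empirical_law T m n 1 (M n) (X n))
      (return (borel_of (skorokhod_topology T m)) (density_path T (\<lambda>t u. \<rho>0 (u + \<kappa> * t))))"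
      using empirical_law_convergence unfolding transport_path_def .
  qed
qed

end
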